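(* The subset sum problem with digraph constraint (SSG), restricted to instances whose digraph $G$ is a series-parallel digraph with $n$ vertices and $m$ arcs, can be solved in $\mathcal{O}(n\cdot c^2+n^{2.3729})$ time and $\mathcal{O}(n\cdot c)$ space, where $c$ is the capacity.
   Context: An instance consists of a set $A=\{a_1,\ldots,a_n\}$ of items, each $a_j$ with a positive integer size $s_j$, a positive integer capacity $c$, and a digraph $G=(A,E)$ without loops on the items. For $A'\subseteq A$ let $s(A')=\sum_{a_j\in A'}s_j$, and for $y\in A$ let $N^-(y)=\{u\in A : (u,y)\in E\}$. The capacity constraint is $s(A')\le c$. The digraph constraint is: for every $y\in A$, if $N^-(y)\cap A'\neq\emptyset$ then $y\in A'$. SSG asks for $A'\subseteq A$ maximizing $s(A')$ subject to both constraints. Minimal series-parallel digraphs: for vertex-disjoint digraphs $G_1=(V_1,E_1)$, $G_2=(V_2,E_2)$, let $O_1$ be the set of sinks of $G_1$ and $I_2$ the set of sources of $G_2$; the parallel composition has vertex set $V_1\cup V_2$ and arc set $E_1\cup E_2$; the series composition has vertex set $V_1\cup V_2$ and arc set $E_1\cup E_2\cup(O_1\times I_2)$. Minimal series-parallel digraphs form the smallest class containing every single-vertex digraph and closed under these two compositions of vertex-disjoint members. The transitive closure of a digraph $H$ has the same vertex set and an arc $(u,v)$, $u\neq v$, iff $H$ has a directed path from $u$ to $v$. A series-parallel digraph is a digraph whose transitive closure equals the transitive closure of some minimal series-parallel digraph. *)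

theory Defs
  imports Complex_Main "Graph_Theory.Pair_Digraph"
begin

section \<open>Series-parallel digraphs\<close>

definition sources :: "'a pair_pre_digraph \<Rightarrow> 'a set" where
  "sources G = {v \<in> pverts G. \<nexists>u. (u, v) \<in> parcs G}"

definition sinks :: "'a pair_pre_digraph \<Rightarrow> 'a set" where
  "sinks G = {v \<in> pverts G. \<nexists>w. (v, w) \<in> parcs G}"

definition single_vertex :: "'a \<Rightarrow> 'a pair_pre_digraph" where
  "single_vertex v = \<lparr>pverts = {v}, parcs = {}\<rparr>"

definition parallel_comp ::
    "'a pair_pre_digraph \<Rightarrow> 'a pair_pre_digraph \<Rightarrow> 'a pair_pre_digraph" where
  "parallel_comp G1 G2 =
     \<lparr>pverts = pverts G1 \<union> pverts G2, parcs = parcs G1 \<union> parcs G2\<rparr>"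

definition series_comp ::
    "'a pair_pre_digraph \<Rightarrow> 'a pair_pre_digraph \<Rightarrow> 'a pair_pre_digraph" where
  "series_comp G1 G2 =
     \<lparr>pverts = pverts G1 \<union> pverts G2,
      parcs = parcs G1 \<union> parcs G2 \<union> sinks G1 \<times> sources G2\<rparr>"

inductive minimal_series_parallel :: "'a pair_pre_digraph \<Rightarrow> bool" where
  single: "minimal_series_parallel (single_vertex v)"
| parallel: "\<lbrakk>minimal_series_parallel G1; minimal_series_parallel G2; pverts G1 \<inter> pverts G2 = {}\<rbrakk>
    \<Longrightarrow> minimal_series_parallel (parallel_comp G1 G2)"
| series: "\<lbrakk>minimal_series_parallel G1; minimal_series_parallel G2; pverts G1 \<inter> pverts G2 = {}\<rbrakk>
    \<Longrightarrow> minimal_series_parallel (series_comp G1 G2)"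

definition transitive_closure :: "'a pair_pre_digraph \<Rightarrow> 'a pair_pre_digraph" where
  "transitive_closure G =
     \<lparr>pverts = pverts G, parcs = {(u, v). u \<noteq> v \<and> u \<rightarrow>\<^sup>+\<^bsub>with_proj G\<^esub> v}\<rparr>"

definition series_parallel :: "'a pair_pre_digraph \<Rightarrow> bool" where
  "series_parallel G \<longleftrightarrow> pair_digraph G \<and>
     (\<exists>H. minimal_series_parallel H \<and> transitive_closure G = transitive_closure H)"


section \<open>Subset sum with digraph constraint\<close>

text \<open>The items are the numbers \<open>0, \<dots>, n - 1\<close>; item \<open>j\<close> has size \<open>sz j\<close>.\<close>

definition ssg_instance ::
    "nat \<Rightarrow> (nat \<Rightarrow> nat) \<Rightarrow> nat \<Rightarrow> nat pair_pre_digraph \<Rightarrow> bool" where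
  "ssg_instance n sz c G \<longleftrightarrow>
     pair_digraph G \<and> pverts G = {..<n} \<and> (\<forall>j<n. 0 < sz j) \<and> 0 < c"

definition in_nbrs :: "'a pair_pre_digraph \<Rightarrow> 'a \<Rightarrow> 'a set" where
  "in_nbrs G y = {u \<in> pverts G. (u, y) \<in> parcs G}"

definition ssg_feasible :: "(nat \<Rightarrow> nat) \<Rightarrow> nat \<Rightarrow> nat pair_pre_digraph \<Rightarrow> nat set \<Rightarrow> bool" where
  "ssg_feasible sz c G A' \<longleftrightarrow>
     A' \<subseteq> pverts G \<and> sum sz A' \<le> c \<and>
     (\<forall>y \<in> pverts G. in_nbrs G y \<inter> A' \<noteq> {} \<longrightarrow> y \<in> A')"

definition ssg_solution :: "(nat \<Rightarrow> nat) \<Rightarrow> nat \<Rightarrow> nat pair_pre_digraph \<Rightarrow> nat set \<Rightarrow> bool" where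
  "ssg_solution sz c G A' \<longleftrightarrow> is_arg_max (sum sz) (ssg_feasible sz c G) A'"


section \<open>Random access machine\<close>

text \<open>
  A structured word RAM. It has a read-only random-access input, finitely many registers (those
  occurring in the program) and a work memory. Every expression node and every executed command
  costs one time unit. The execution relation is parametrised by a word limit \<open>W\<close> and a memory
  limit \<open>S\<close>: a run gets stuck as soon as it computes a value that is not below \<open>W\<close>, accesses
  a memory cell with address not below \<open>S\<close>, or reads beyond the end of the input. The word limit
  prevents unit-cost arithmetic on huge numbers from hiding time or space. Space is work space:
  \<open>S\<close> does not include the read-only input, since a digraph alone may have order \<open>n\<^sup>2\<close> arcs,
  nor the constantly many registers.
\<close>

datatype binop = Plus | Minus | Times | Less | Equal

datatype expr =
    Const nat
  | Reg nat
  | Mem expr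
  | Inp expr
  | Bin binop expr expr

datatype com =
    Skip
  | Assign nat expr
  | Store expr expr
  | Seq com com
  | If expr com com
  | While expr com

fun apply_binop :: "binop \<Rightarrow> nat \<Rightarrow> nat \<Rightarrow> nat" where
  "apply_binop Plus a b = a + b"
| "apply_binop Minus a b = a - b"
| "apply_binop Times a b = a * b"
| "apply_binop Less a b = (if a < b then 1 else 0)"
| "apply_binop Equal a b = (if a = b then 1 else 0)"

text \<open>A state consists of the register contents and the memory contents.\<close>

type_synonym state = "(nat \<Rightarrow> nat) \<times> (nat \<Rightarrow> nat)"

fun val :: "nat list \<Rightarrow> state \<Rightarrow> expr \<Rightarrow> nat" where
  "val inp \<sigma> (Const k) = k"
| "val inp \<sigma> (Reg r) = fst \<sigma> r"
| "val inp \<sigma> (Mem e) = snd \<sigma> (val inp \<sigma> e)"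
| "val inp \<sigma> (Inp e) = inp ! val inp \<sigma> e"
| "val inp \<sigma> (Bin f a b) = apply_binop f (val inp \<sigma> a) (val inp \<sigma> b)"

fun expr_cost :: "expr \<Rightarrow> nat" where
  "expr_cost (Const k) = 1"
| "expr_cost (Reg r) = 1"
| "expr_cost (Mem e) = 1 + expr_cost e"
| "expr_cost (Inp e) = 1 + expr_cost e"
| "expr_cost (Bin f a b) = 1 + expr_cost a + expr_cost b"

fun legal :: "nat \<Rightarrow> nat \<Rightarrow> nat list \<Rightarrow> state \<Rightarrow> expr \<Rightarrow> bool" where
  "legal W S inp \<sigma> (Const k) \<longleftrightarrow> k < W"
| "legal W S inp \<sigma> (Reg r) \<longleftrightarrow> fst \<sigma> r < W"
| "legal W S inp \<sigma> (Mem e) \<longleftrightarrow>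
     legal W S inp \<sigma> e \<and> val inp \<sigma> e < S \<and> val inp \<sigma> (Mem e) < W"
| "legal W S inp \<sigma> (Inp e) \<longleftrightarrow>
     legal W S inp \<sigma> e \<and> val inp \<sigma> e < length inp \<and> val inp \<sigma> (Inp e) < W"
| "legal W S inp \<sigma> (Bin f a b) \<longleftrightarrow>
     legal W S inp \<sigma> a \<and> legal W S inp \<sigma> b \<and> val inp \<sigma> (Bin f a b) < W"

text \<open>
  \<open>exec W S inp p \<sigma> t \<sigma>'\<close>: started in state \<open>\<sigma>\<close>, program \<open>p\<close> terminates in state \<open>\<sigma>'\<close> after
  exactly \<open>t\<close> time units.
\<close>

inductive exec ::
    "nat \<Rightarrow> nat \<Rightarrow> nat list \<Rightarrow> com \<Rightarrow> state \<Rightarrow> nat \<Rightarrow> state \<Rightarrow> bool"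
  for W S :: nat and inp :: "nat list" where
  Skip: "exec W S inp Skip \<sigma> 1 \<sigma>"
| Assign: "legal W S inp (\<rho>, \<mu>) e
    \<Longrightarrow> exec W S inp (Assign r e) (\<rho>, \<mu>) (1 + expr_cost e) (\<rho>(r := val inp (\<rho>, \<mu>) e), \<mu>)"
| Store: "\<lbrakk>legal W S inp (\<rho>, \<mu>) a; legal W S inp (\<rho>, \<mu>) e; val inp (\<rho>, \<mu>) a < S\<rbrakk>
    \<Longrightarrow> exec W S inp (Store a e) (\<rho>, \<mu>) (1 + expr_cost a + expr_cost e)
          (\<rho>, \<mu>(val inp (\<rho>, \<mu>) a := val inp (\<rho>, \<mu>) e))"
| Seq: "\<lbrakk>exec W S inp p \<sigma> t \<sigma>'; exec W S inp q \<sigma>' t' \<sigma>''\<rbrakk>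
    \<Longrightarrow> exec W S inp (Seq p q) \<sigma> (1 + t + t') \<sigma>''"
| IfTrue: "\<lbrakk>legal W S inp \<sigma> e; val inp \<sigma> e \<noteq> 0; exec W S inp p \<sigma> t \<sigma>'\<rbrakk>
    \<Longrightarrow> exec W S inp (If e p q) \<sigma> (1 + expr_cost e + t) \<sigma>'"
| IfFalse: "\<lbrakk>legal W S inp \<sigma> e; val inp \<sigma> e = 0; exec W S inp q \<sigma> t \<sigma>'\<rbrakk>
    \<Longrightarrow> exec W S inp (If e p q) \<sigma> (1 + expr_cost e + t) \<sigma>'"
| WhileFalse: "\<lbrakk>legal W S inp \<sigma> e; val inp \<sigma> e = 0\<rbrakk>
    \<Longrightarrow> exec W S inp (While e p) \<sigma> (1 + expr_cost e) \<sigma>"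
| WhileTrue: "\<lbrakk>legal W S inp \<sigma> e; val inp \<sigma> e \<noteq> 0; exec W S inp p \<sigma> t \<sigma>';
      exec W S inp (While e p) \<sigma>' t' \<sigma>''\<rbrakk>
    \<Longrightarrow> exec W S inp (While e p) \<sigma> (1 + expr_cost e + t + t') \<sigma>''"

definition init_state :: state where
  "init_state = (\<lambda>_. 0, \<lambda>_. 0)"

text \<open>
  An instance is presented as \<open>n\<close>, \<open>c\<close>, the \<open>n\<close> sizes and the adjacency matrix of the digraph in
  row-major order. The result \<open>A'\<close> is left in the first \<open>n\<close> memory cells as a
  characteristic vector.
\<close>

definition ssg_input ::
    "nat \<Rightarrow> (nat \<Rightarrow> nat) \<Rightarrow> nat \<Rightarrow> nat pair_pre_digraph \<Rightarrow> nat list" where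
  "ssg_input n sz c G =
     [n, c] @ map sz [0..<n] @
     concat (map (\<lambda>u. map (\<lambda>v. if (u, v) \<in> parcs G then 1 else 0) [0..<n]) [0..<n])"

definition ssg_output :: "nat \<Rightarrow> state \<Rightarrow> nat set" where
  "ssg_output n \<sigma> = {j. j < n \<and> snd \<sigma> j \<noteq> 0}"

text \<open>
  Words of \<open>k * log 2 (n + c + s(A))\<close> bits; the base is at least 3, so any
  constant factor is absorbed by \<open>k\<close>.
\<close>

definition word_limit :: "nat \<Rightarrow> nat \<Rightarrow> (nat \<Rightarrow> nat) \<Rightarrow> nat \<Rightarrow> nat" where
  "word_limit k n sz c = (n + c + sum sz {..<n}) ^ k"

end

theory Submission
  imports Defs
begin

text \<open>
  Let \<open>D(v)\<close> be the set of items reachable from \<open>v\<close>. Only items with \<open>s({v} \<union> D(v)) \<le> c\<close> can be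
  chosen; they have at most \<open>c\<close> descendants, so a search from each item that is aborted as soon as
  the total size exceeds \<open>c\<close> costs \<open>O(c\<^sup>2)\<close> and lists all these \<open>D(v)\<close> in \<open>O(n c)\<close> space. No matrix
  multiplication is needed.

  The reachability order of a series-parallel digraph has no induced N. Give every item the key
  \<open>\<tau>(v)\<close>, the largest position in \<open>D(v)\<close> in a fixed linear extension. Without an N, \<open>\<tau>(u) = \<tau>(v)\<close>
  holds iff \<open>D(u) = D(v)\<close>. Descending from a virtual top element, always to a candidate of largest
  key, one meets after at most \<open>c\<close> steps two elements which are twins, either incomparable or
  adjacent in the order. Contracting twins \<open>n - 1\<close> times builds a series-parallel decomposition tree at a
  cost of \<open>O(n + c\<^sup>2)\<close> per contraction.

  For a module \<open>M\<close> let \<open>F(M)\<close> be the set of sizes of its closed subsets. Parallel composition gives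
  the sumset \<open>F(M\<^sub>1) + F(M\<^sub>2)\<close>; placing \<open>M\<^sub>1\<close> above \<open>M\<^sub>2\<close> gives \<open>F(M\<^sub>2) \<union> (s(M\<^sub>2) + F(M\<^sub>1))\<close>. These tables up
  to \<open>c\<close> cost \<open>O(c\<^sup>2)\<close> per node, and walking down from the best entry at the root yields a solution.
\<close>

section \<open>Bounded-loop programs over two-dimensional arrays\<close>

text \<open>Every loop is bounded by \<open>n\<close> or by \<open>c + 1\<close>, so the running
  time can be read off the program text: \<open>cost\<close> evaluates to a polynomial, and the
  correctness proofs ignore time. The price is that no loop can stop early; rounds after the goal is
  reached have to be harmless. Space is the obstacle: neither the full reachability relation nor one
  complete adjacency list per item fits into O(n c) cells. As sizes are positive, an item with more
  than \<open>c\<close> neighbours is too heavy to be chosen, so cutting lists at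
  \<open>c + 1\<close> entries loses nothing that matters. Positivity also bounds the descent, since
  each step moves to a strictly smaller weight and the weights involved are at most
  \<open>c\<close>. The descent maintains the invariant \<open>lonely\<close>; it guarantees that a
  comparable pair which passes a purely numerical test can be contracted to a module. Reading the
  matrix and scanning the top level in each contraction cost O(n^2), which the exponent 2.3729
  absorbs.\<close>

datatype aexp =
    Lit nat
  | Rg nat
  | Cell nat aexp aexp
  | Input aexp
  | Op binop aexp aexp

text \<open>\<open>Loop r b p\<close> runs exactly \<open>n\<close> rounds if \<open>b\<close> holds
  and \<open>c + 1\<close> rounds otherwise. \<open>Out\<close> is separate from \<open>Put\<close>
  because the output vector must lie in the first \<open>n\<close> memory cells, outside the layout
  of the other arrays.\<close>

datatype prog =
    Nop
  | Set nat aexp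
  | Put nat aexp aexp aexp
  | Out aexp aexp
  | Then prog prog  (infixr \<open>;;\<close> 60)
  | Cond aexp prog prog
  | Loop nat bool prog

text \<open>Memory is idealised as array number, row and column, so that correctness proofs never
  meet address arithmetic.\<close>

datatype astate = State (reg: "nat \<Rightarrow> nat") (mem: "nat \<Rightarrow> nat \<Rightarrow> nat \<Rightarrow> nat")

primrec iterate :: "(nat \<Rightarrow> 's \<Rightarrow> 's option) \<Rightarrow> nat \<Rightarrow> 's \<Rightarrow> 's option" where
  "iterate f 0 s = Some s"
| "iterate f (Suc k) s = Option.bind (iterate f k s) (f k)"

fun mods :: "prog \<Rightarrow> nat set" where
  "mods (Set r e) = {r}"
| "mods (p ;; q) = mods p \<union> mods q"
| "mods (Cond e p q) = mods p \<union> mods q"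
| "mods (Loop r b p) = insert r (mods p)"
| "mods _ = {}"

fun amods :: "prog \<Rightarrow> nat set" where
  "amods (Put t e1 e2 e) = {t}"
| "amods (Out e1 e) = {0}"
| "amods (p ;; q) = amods p \<union> amods q"
| "amods (Cond e p q) = amods p \<union> amods q"
| "amods (Loop r b p) = amods p"
| "amods _ = {}"

text \<open>Registers 0 and 1 hold \<open>n\<close> and \<open>c + 1\<close>, the two possible loop bounds.\<close>

fun well_formed :: "prog \<Rightarrow> bool" where
  "well_formed (Set r e) \<longleftrightarrow> 1 < r"
| "well_formed (p ;; q) \<longleftrightarrow> well_formed p \<and> well_formed q"
| "well_formed (Cond e p q) \<longleftrightarrow> well_formed p \<and> well_formed q"
| "well_formed (Loop r b p) \<longleftrightarrow> 1 < r \<and> well_formed p \<and> r \<notin> mods p"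
| "well_formed _ \<longleftrightarrow> True"

text \<open>The arrays are interleaved: behind the \<open>n\<close> output cells, the entries of all
  16 arrays at row \<open>a\<close> and column \<open>b\<close> are consecutive, and a row has
  \<open>c + 1\<close> columns (register 1).\<close>

fun address :: "nat \<Rightarrow> expr \<Rightarrow> expr \<Rightarrow> expr" where
  "address t a b = Bin Plus (Reg 0)
     (Bin Plus (Bin Times (Const 16) (Bin Plus (Bin Times a (Reg 1)) b)) (Const t))"

fun cexp :: "aexp \<Rightarrow> expr" where
  "cexp (Lit k) = Const k"
| "cexp (Rg r) = Reg r"
| "cexp (Cell t a b) = Mem (address t (cexp a) (cexp b))"
| "cexp (Input e) = Inp (cexp e)"
| "cexp (Op f a b) = Bin f (cexp a) (cexp b)"

fun compile :: "prog \<Rightarrow> com" where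
  "compile Nop = Skip"
| "compile (Set r e) = Assign r (cexp e)"
| "compile (Put t a b e) = Store (address t (cexp a) (cexp b)) (cexp e)"
| "compile (Out a e) = Store (cexp a) (cexp e)"
| "compile (p ;; q) = Seq (compile p) (compile q)"
| "compile (Cond e p q) = If (cexp e) (compile p) (compile q)"
| "compile (Loop r b p) = Seq (Assign r (Const 0))
     (While (Bin Less (Reg r) (Reg (if b then 0 else 1)))
        (Seq (compile p) (Assign r (Bin Plus (Reg r) (Const 1)))))"

text \<open>An upper bound, since \<open>Cond\<close> charges both branches. In a loop, 7 pays for
  the sequencing, the initialisation and the final failing test; 9 pays per round for the test, the
  sequencing and the increment.\<close>

fun cost :: "nat \<Rightarrow> nat \<Rightarrow> prog \<Rightarrow> nat" where
  "cost n c Nop = 1"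
| "cost n c (Set r e) = 1 + expr_cost (cexp e)"
| "cost n c (Put t a b e) = 1 + expr_cost (address t (cexp a) (cexp b)) + expr_cost (cexp e)"
| "cost n c (Out a e) = 1 + expr_cost (cexp a) + expr_cost (cexp e)"
| "cost n c (p ;; q) = 1 + cost n c p + cost n c q"
| "cost n c (Cond e p q) = 1 + expr_cost (cexp e) + cost n c p + cost n c q"
| "cost n c (Loop r b p) = 7 + (if b then n else c + 1) * (cost n c p + 9)"

definition agree :: "nat set \<Rightarrow> nat set \<Rightarrow> astate \<Rightarrow> astate \<Rightarrow> bool" where
  "agree X Y s s' \<longleftrightarrow> (\<forall>r. r \<notin> X \<longrightarrow> reg s' r = reg s r) \<and> (\<forall>t. t \<notin> Y \<longrightarrow> mem s' t = mem s t)"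

lemma agree_refl: "agree X Y s s"
  by (simp add: agree_def)

definition set_reg :: "nat \<Rightarrow> nat \<Rightarrow> astate \<Rightarrow> astate" where
  "set_reg r k s = State ((reg s)(r := k)) (mem s)"

definition set_cell :: "nat \<Rightarrow> nat \<Rightarrow> nat \<Rightarrow> nat \<Rightarrow> astate \<Rightarrow> astate" where
  "set_cell t i j k s = State (reg s) ((mem s)(t := (mem s t)(i := (mem s t i)(j := k))))"

lemma set_reg_simps [simp]:
  "reg (set_reg r k s) r' = (if r' = r then k else reg s r')"
  "mem (set_reg r k s) = mem s"
  by (simp_all add: set_reg_def)

lemma set_cell_simps [simp]:
  "reg (set_cell t i j k s) = reg s"
  "t' \<noteq> t \<Longrightarrow> mem (set_cell t i j k s) t' = mem s t'"
  "mem (set_cell t i j k s) t i' j' = (if i' = i \<and> j' = j then k else mem s t i' j')"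
  by (auto simp add: set_cell_def)

lemma set_cell_apply:
  "mem (set_cell t i j k s) t' i' j' = (if t' = t \<and> i' = i \<and> j' = j then k else mem s t' i' j')"
  by (auto simp add: set_cell_def)

text \<open>\<open>M\<close> bounds the values that programs compute; the word limit
  \<open>W\<close>, which must also cover addresses, appears only in the simulation.\<close>

locale machine =
  fixes n c M :: nat and inp :: "nat list"
begin

fun aval :: "astate \<Rightarrow> aexp \<Rightarrow> nat" where
  "aval s (Lit k) = k"
| "aval s (Rg r) = reg s r"
| "aval s (Cell t a b) = mem s t (aval s a) (aval s b)"
| "aval s (Input e) = inp ! aval s e"
| "aval s (Op f a b) = apply_binop f (aval s a) (aval s b)"

text \<open>Rows go up to \<open>2 * n\<close> because the inner nodes of the decomposition tree are
  stored in rows from \<open>n\<close> on.\<close>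

fun alegal :: "astate \<Rightarrow> aexp \<Rightarrow> bool" where
  "alegal s (Lit k) \<longleftrightarrow> k < M"
| "alegal s (Rg r) \<longleftrightarrow> reg s r < M"
| "alegal s (Cell t a b) \<longleftrightarrow> alegal s a \<and> alegal s b \<and> 0 < t \<and> t < 16 \<and>
     aval s a \<le> 2 * n \<and> aval s b \<le> c \<and> mem s t (aval s a) (aval s b) < M"
| "alegal s (Input e) \<longleftrightarrow> alegal s e \<and> aval s e < length inp \<and> inp ! aval s e < M"
| "alegal s (Op f a b) \<longleftrightarrow> alegal s a \<and> alegal s b \<and> apply_binop f (aval s a) (aval s b) < M"

primrec run :: "prog \<Rightarrow> astate \<Rightarrow> astate option" where
  "run Nop = (\<lambda>s. Some s)"
| "run (Set r e) = (\<lambda>s. if alegal s e then Some (set_reg r (aval s e) s) else None)"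
| "run (Put t a b e) = (\<lambda>s.
     if alegal s a \<and> alegal s b \<and> alegal s e \<and> 0 < t \<and> t < 16 \<and> aval s a \<le> 2 * n \<and> aval s b \<le> c
     then Some (set_cell t (aval s a) (aval s b) (aval s e) s)
     else None)"
| "run (Out a e) = (\<lambda>s. if alegal s a \<and> alegal s e \<and> aval s a < n
     then Some (set_cell 0 (aval s a) 0 (aval s e) s)
     else None)"
| "run (p ;; q) = (\<lambda>s. Option.bind (run p s) (run q))"
| "run (Cond e p q) = (\<lambda>s. if alegal s e then if aval s e \<noteq> 0 then run p s else run q s else None)"
| "run (Loop r b p) = (\<lambda>s. Option.bind
     (iterate (\<lambda>k s. run p (set_reg r k s)) (if b then n else c + 1) s)
     (\<lambda>s. Some (set_reg r (if b then n else c + 1) s)))"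

lemma run_agree: "run p s = Some s' \<Longrightarrow> agree (mods p) (amods p) s s'"
proof (induction p arbitrary: s s')
  case (Then p1 p2)
  then obtain s1 where "run p1 s = Some s1" "run p2 s1 = Some s'"
    by (auto simp: bind_eq_Some_conv)
  from Then.IH(1)[OF this(1)] Then.IH(2)[OF this(2)] show ?case
    by (auto simp: agree_def)
next
  case (Loop r b p)
  have *: "iterate (\<lambda>k s. run p (set_reg r k s)) N s = Some s' \<Longrightarrow>
     agree (insert r (mods p)) (amods p) s s'" for N s'
  proof (induction N arbitrary: s')
    case (Suc N)
    then obtain s1 where 1: "agree (insert r (mods p)) (amods p) s s1"
      "run p (set_reg r N s1) = Some s'"
      unfolding iterate.simps bind_eq_Some_conv by blast
    then show ?case using Loop.IH[OF 1(2)] by (auto simp: agree_def)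
  qed (auto simp: agree_refl)
  show ?case using Loop.prems by (auto simp: bind_eq_Some_conv agree_def dest!: *)
qed (auto simp: agree_def split: if_splits)

text \<open>\<open>run\<close> yields \<open>None\<close> on an illegal access or an overflow, so
  \<open>wp\<close> also asserts that the run stays within the limits.\<close>

definition wp :: "prog \<Rightarrow> (astate \<Rightarrow> bool) \<Rightarrow> astate \<Rightarrow> bool" where
  "wp p Q s \<longleftrightarrow> (\<exists>s'. run p s = Some s' \<and> Q s')"

lemma wp_simps [simp]:
  "wp Nop Q s \<longleftrightarrow> Q s"
  "wp (Set r e) Q s \<longleftrightarrow> alegal s e \<and> Q (set_reg r (aval s e) s)"
  "wp (Put t a b e) Q s \<longleftrightarrow>
     (alegal s a \<and> alegal s b \<and> alegal s e \<and> 0 < t \<and> t < 16 \<and> aval s a \<le> 2 * n \<and> aval s b \<le> c) \<and>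
     Q (set_cell t (aval s a) (aval s b) (aval s e) s)"
  "wp (Out a e) Q s \<longleftrightarrow> (alegal s a \<and> alegal s e \<and> aval s a < n) \<and>
     Q (set_cell 0 (aval s a) 0 (aval s e) s)"
  "wp (p ;; q) Q s \<longleftrightarrow> wp p (wp q Q) s"
  "wp (Cond e p q) Q s \<longleftrightarrow> alegal s e \<and> (if aval s e \<noteq> 0 then wp p Q s else wp q Q s)"
  by (auto simp: wp_def bind_eq_Some_conv)

lemma wp_Then [simp]: "wp (p ;; q) Q = wp p (wp q Q)"
  by (rule ext) simp

text \<open>The consequence rule with the frame built in: a postcondition need only mention what the
  program changes, everything else comes back through \<open>agree\<close>.\<close>

lemma wp_mono: "wp p P s \<Longrightarrow> (\<And>s'. P s' \<Longrightarrow> agree (mods p) (amods p) s s' \<Longrightarrow> Q s') \<Longrightarrow> wp p Q s"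
  unfolding wp_def using run_agree by blast

text \<open>The round number is a parameter of \<open>I\<close> instead of a register value, so the
  invariant makes sense before the counter is set.\<close>

lemma wp_Loop:
  assumes "I 0 s"
    and "\<And>k s'. k < (if b then n else c + 1) \<Longrightarrow> I k s' \<Longrightarrow> agree (insert r (mods p)) (amods p) s s' \<Longrightarrow>
           wp p (I (Suc k)) (set_reg r k s')"
    and "\<And>s'. I (if b then n else c + 1) s' \<Longrightarrow> agree (insert r (mods p)) (amods p) s s' \<Longrightarrow>
           Q (set_reg r (if b then n else c + 1) s')"
  shows "wp (Loop r b p) Q s"
proof -
  let ?f = "\<lambda>k s. run p (set_reg r k s)"
  have "N \<le> (if b then n else c + 1) \<Longrightarrow> \<exists>s'. iterate ?f N s = Some s' \<and> I N s' \<and>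
          agree (insert r (mods p)) (amods p) s s'" for N
  proof (induction N)
    case 0
    then show ?case using assms(1) by (simp add: agree_refl)
  next
    case (Suc N)
    then obtain s1 where 1: "iterate ?f N s = Some s1" "I N s1" "agree (insert r (mods p)) (amods p) s s1"
      using Suc_leD by blast
    from assms(2)[of N s1] 1 Suc.prems obtain s2 where 2: "run p (set_reg r N s1) = Some s2"
      "I (Suc N) s2" by (auto simp: wp_def)
    have "agree (insert r (mods p)) (amods p) s s2"
      using 1(3) run_agree[OF 2(1)] by (auto simp: agree_def)
    moreover have "iterate ?f (Suc N) s = Some s2" using 1 2 by simp
    ultimately show ?case using 2 by blast
  qed
  from this[OF order_refl] show ?thesis using assms(3) by (fastforce simp: wp_def)
qed

definition adr :: "nat \<Rightarrow> nat \<Rightarrow> nat \<Rightarrow> nat" where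
  "adr t i j = n + (16 * (i * (c + 1) + j) + t)"

text \<open>The remainder mod 16 recovers the array and the remainder mod \<open>c + 1\<close> the
  column; what is left is the row.\<close>

lemma adr_inj: "t < 16 \<Longrightarrow> t' < 16 \<Longrightarrow> j \<le> c \<Longrightarrow> j' \<le> c \<Longrightarrow> adr t i j = adr t' i' j' \<longleftrightarrow> t = t' \<and> i = i' \<and> j = j'"
proof
  assume a: "t < 16" "t' < 16" "j \<le> c" "j' \<le> c" "adr t i j = adr t' i' j'"
  then have e: "16 * (i * (c + 1) + j) + t = 16 * (i' * (c + 1) + j') + t'" by (simp add: adr_def)
  have "(16 * x + y) mod 16 = y" if "y < 16" for x y :: nat
    using that by (metis mod_less mod_mult_self4)
  then have t: "t = t'" using arg_cong[OF e, of "\<lambda>x. x mod 16"] a by metis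
  have e: "i * (c + 1) + j = i' * (c + 1) + j'" using e t by simp
  have "(x * (c + 1) + y) mod (c + 1) = y" if "y \<le> c" for x y :: nat
    using that by (metis add.commute le_imp_less_Suc mod_less mod_mult_self1 Suc_eq_plus1)
  then have j: "j = j'" using arg_cong[OF e, of "\<lambda>x. x mod (c + 1)"] a(3,4) by metis
  have "i * (c + 1) = i' * (c + 1)" using e j by linarith
  then have "i = i'" using mult_right_cancel[of "c + 1" i i'] by simp
  then show "t = t' \<and> i = i' \<and> j = j'" using t j by simp
qed simp

definition simulates :: "state \<Rightarrow> astate \<Rightarrow> bool" where
  "simulates \<sigma> s \<longleftrightarrow> fst \<sigma> = reg s \<and> reg s 0 = n \<and> reg s 1 = c + 1 \<and>
     (\<forall>i<n. snd \<sigma> i = mem s 0 i 0) \<and>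
     (\<forall>t i j. 0 < t \<longrightarrow> t < 16 \<longrightarrow> i \<le> 2 * n \<longrightarrow> j \<le> c \<longrightarrow> snd \<sigma> (adr t i j) = mem s t i j)"

text \<open>The least admissible \<open>S\<close> is one more than the largest address, that of
  array 15 at row \<open>2 * n\<close> and column \<open>c\<close>.\<close>

context
  fixes W S :: nat
  assumes S: "n + 16 * (2 * n * (c + 1) + c) + 16 \<le> S" and SW: "S \<le> W" and MW: "M \<le> W"
    and M: "n < M" "c + 1 < M" "16 < M"
begin

lemma index_bound: "i \<le> 2 * n \<Longrightarrow> j \<le> c \<Longrightarrow> i * (c + 1) + j \<le> 2 * n * (c + 1) + c"
  by (intro add_mono mult_mono) auto

lemma address_legal:
  assumes "val inp \<sigma> a \<le> 2 * n" "val inp \<sigma> b \<le> c" "legal W S inp \<sigma> a" "legal W S inp \<sigma> b"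
    "fst \<sigma> 0 = n" "fst \<sigma> 1 = c + 1" "t < 16"
  shows "legal W S inp \<sigma> (address t a b)" "val inp \<sigma> (address t a b) = adr t (val inp \<sigma> a) (val inp \<sigma> b)"
    "val inp \<sigma> (address t a b) < S"
proof -
  let ?i = "val inp \<sigma> a" and ?j = "val inp \<sigma> b"
  have 1: "?i * (c + 1) + ?j \<le> 2 * n * (c + 1) + c" using index_bound assms(1,2) .
  have "16 * (?i * (c + 1) + ?j) \<le> 16 * (2 * n * (c + 1) + c)" using 1 by (rule mult_le_mono2)
  then have 2: "n + (16 * (?i * (c + 1) + ?j) + t) < S" using S assms(7) by linarith
  then show "val inp \<sigma> (address t a b) < S" using assms by simp
  \<comment> \<open>Each subexpression of the address is bounded by the address itself, by
    \<open>n\<close>, by \<open>c + 1\<close> or by 16. The variable \<open>x\<close> abstracts the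
    product so that the arithmetic is linear.\<close>
  have gen: "x + ?j < W \<and> 16 * (x + ?j) < W \<and> 16 * (x + ?j) + t < W \<and> n + (16 * (x + ?j) + t) < W \<and>
    x < W \<and> 16 < W \<and> t < W \<and> n < W \<and> c + 1 < W \<and> ?j < W"
    if "n + (16 * (x + ?j) + t) < S" "n + 16 * y + 16 \<le> S" for x y
    using that SW assms(2,7) M MW by auto
  have "?i * (c + 1) + ?j < W" "16 * (?i * (c + 1) + ?j) < W" "16 * (?i * (c + 1) + ?j) + t < W"
    "n + (16 * (?i * (c + 1) + ?j) + t) < W" "?i * (c+1) < W" "16 < W" "t < W" "n < W" "c+1 < W" "?j < W"
    using gen[OF 2 S] by blast+
  then show "legal W S inp \<sigma> (address t a b)" using assms by simp
  show "val inp \<sigma> (address t a b) = adr t (val inp \<sigma> a) (val inp \<sigma> b)"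
    using assms by (simp add: adr_def)
qed

lemma cexp_correct:
  assumes "simulates \<sigma> s" "alegal s e"
  shows "legal W S inp \<sigma> (cexp e) \<and> val inp \<sigma> (cexp e) = aval s e"
  using assms(2)
proof (induction e)
  case (Cell t a b)
  then show ?case using assms(1) MW address_legal[of \<sigma> "cexp a" "cexp b" t]
    by (simp add: simulates_def del: address.simps)
next
  case (Op f a b)
  then show ?case using MW by (cases f) auto
qed (use assms(1) MW in \<open>auto simp: simulates_def\<close>)

lemma adr_ge: "n \<le> adr t i j"
  by (simp add: adr_def)

text \<open>\<open>iterate\<close> adds rounds at the end while \<open>WhileTrue\<close> unfolds
  them at the front; the induction therefore runs over the number \<open>d\<close> of rounds that
  remain.\<close>

lemma compile_Loop:
  assumes IH: "\<And>s s' \<sigma>. simulates \<sigma> s \<Longrightarrow> run p s = Some s' \<Longrightarrow>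
      \<exists>t \<sigma>'. exec W S inp (compile p) \<sigma> t \<sigma>' \<and> simulates \<sigma>' s' \<and> t \<le> cost n c p"
    and r: "1 < r" "r \<notin> mods p" and "simulates \<sigma> s" "run (Loop r b p) s = Some s'"
  shows "\<exists>t \<sigma>'. exec W S inp (compile (Loop r b p)) \<sigma> t \<sigma>' \<and> simulates \<sigma>' s' \<and> t \<le> cost n c (Loop r b p)"
proof -
  define N where "N = (if b then n else c + 1)"
  let ?f = "\<lambda>k s. run p (set_reg r k s)"
  let ?e = "Bin Less (Reg r) (Reg (if b then 0 else 1))"
  let ?w = "While ?e (Seq (compile p) (Assign r (Bin Plus (Reg r) (Const 1))))"
  have simr: "simulates (\<rho>(r := k), \<mu>) (set_reg r k s)" if "simulates (\<rho>, \<mu>) s" for \<rho> \<mu> s k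
    using that r by (auto simp: simulates_def)
  have eleg: "legal W S inp \<sigma> ?e \<and> (val inp \<sigma> ?e = (if fst \<sigma> r < N then 1 else 0))"
    if "simulates \<sigma> s" "fst \<sigma> r \<le> N" for \<sigma> s
  proof -
    have "fst \<sigma> r < W" "fst \<sigma> 0 < W" "fst \<sigma> 1 < W" "1 < W"
      using that M MW S SW by (auto simp: simulates_def N_def split: if_splits)
    then show ?thesis using that by (auto simp: simulates_def N_def split: if_splits)
  qed
  obtain s1 where s1: "iterate ?f N s = Some s1" "s' = set_reg r N s1"
    using assms(5) by (auto simp: bind_eq_Some_conv N_def)
  have *: "\<exists>t \<sigma>'. exec W S inp ?w \<sigma> t \<sigma>' \<and> simulates \<sigma>' s' \<and> t \<le> 4 + d * (cost n c p + 9)"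
    if "d \<le> N" "iterate ?f (N - d) s = Some s2" "simulates \<sigma> (set_reg r (N - d) s2)" for d s2 \<sigma>
    using that
  proof (induction d arbitrary: s2 \<sigma>)
    case 0
    then have "fst \<sigma> r = N" by (simp add: simulates_def)
    have "s2 = s1" using 0 s1 by simp
    then have "exec W S inp ?w \<sigma> (1 + expr_cost ?e) \<sigma>"
      using eleg[OF 0(3)] \<open>fst \<sigma> r = N\<close> by (intro WhileFalse) auto
    moreover have "simulates \<sigma> s'" using 0(3) s1 \<open>s2 = s1\<close> by simp
    ultimately show ?case by (intro exI[of _ "1 + expr_cost ?e"] exI[of _ \<sigma>]) simp
  next
    case (Suc d)
    have Nd: "N - d = Suc (N - Suc d)" using Suc.prems(1) by simp
    obtain s3 where s3: "iterate ?f (N - d) s = Some s3"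
      using s1(1) Suc.prems(1)
    proof -
      \<comment> \<open>A prefix of a successful iteration is successful, by downward induction from
        \<open>N\<close>.\<close>
      have "iterate ?f k s \<noteq> None" if "k \<le> N" for k
        using that
      proof (induction "N - k" arbitrary: k)
        case (Suc x)
        have "iterate ?f (Suc k) s \<noteq> None"
          using Suc.hyps(1)[of "Suc k"] Suc.hyps(2) by simp
        then show ?case by (cases "iterate ?f k s") auto
      qed (use s1 in auto)
      then show ?thesis using that[of "the (iterate ?f (N - d) s)"] by auto
    qed
    have run3: "run p (set_reg r (N - Suc d) s2) = Some s3"
      using s3 Suc.prems(2) unfolding Nd by simp
    have fr: "fst \<sigma> r = N - Suc d" using Suc.prems(3) by (auto simp: simulates_def)
    obtain t \<rho> \<mu> where ex: "exec W S inp (compile p) \<sigma> t (\<rho>, \<mu>)" "simulates (\<rho>, \<mu>) s3" "t \<le> cost n c p"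
      using IH[OF Suc.prems(3) run3] by auto
    \<comment> \<open>The body may not write the counter, so it still holds the round number when it
      is incremented.\<close>
    have r3: "\<rho> r = N - Suc d"
      using run_agree[OF run3] r(2) ex(2) by (auto simp: simulates_def agree_def)
    have "N \<le> c + 1 \<or> N \<le> n" by (auto simp: N_def)
    then have "N < W" "1 < W" using M MW S SW by auto
    then have "N - Suc d < W \<and> Suc (N - Suc d) < W" using Suc.prems(1) by arith
    then have a: "exec W S inp (Assign r (Bin Plus (Reg r) (Const 1))) (\<rho>, \<mu>) 4
       (\<rho>(r := N - d), \<mu>)"
      using Assign[of W S inp \<rho> \<mu> "Bin Plus (Reg r) (Const 1)" r] r3 Nd Suc.prems(1) \<open>1 < W\<close>
      by (auto simp: numeral_eq_Suc)
    obtain t2 \<sigma>2 where w: "exec W S inp ?w (\<rho>(r := N - d), \<mu>) t2 \<sigma>2" "simulates \<sigma>2 s'"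
       "t2 \<le> 4 + d * (cost n c p + 9)"
      using Suc.IH[OF _ s3 simr[OF ex(2)]] Suc.prems(1) by auto
    have "exec W S inp ?w \<sigma> (1 + expr_cost ?e + (1 + t + 4) + t2) \<sigma>2"
      using eleg[OF Suc.prems(3)] fr Suc.prems(1)
      by (intro WhileTrue[OF _ _ Seq[OF ex(1) a] w(1)]) auto
    moreover have "1 + expr_cost ?e + (1 + t + 4) + t2 \<le> 4 + Suc d * (cost n c p + 9)"
      using w(3) ex(3) by simp
    ultimately show ?case using w(2) by blast
  qed
  obtain \<rho> \<mu> where \<sigma>: "\<sigma> = (\<rho>, \<mu>)" by fastforce
  have a: "exec W S inp (Assign r (Const 0)) (\<rho>, \<mu>) 2 (\<rho>(r := 0), \<mu>)"
    using Assign[of W S inp \<rho> \<mu> "Const 0" r] M MW by (auto simp: numeral_eq_Suc)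
  obtain t \<sigma>' where "exec W S inp ?w (\<rho>(r := 0), \<mu>) t \<sigma>'" "simulates \<sigma>' s'" "t \<le> 4 + N * (cost n c p + 9)"
    using *[of N s "(\<rho>(r := 0), \<mu>)"] simr[of \<rho> \<mu> s 0] assms(4) \<sigma> by auto
  then show ?thesis using Seq[OF a, of ?w t \<sigma>'] unfolding \<sigma>
    by (intro exI[of _ "1 + 2 + t"] exI[of _ \<sigma>']) (auto simp: N_def)
qed

lemma compile_correct:
  "well_formed p \<Longrightarrow> simulates \<sigma> s \<Longrightarrow> run p s = Some s' \<Longrightarrow>
    \<exists>t \<sigma>'. exec W S inp (compile p) \<sigma> t \<sigma>' \<and> simulates \<sigma>' s' \<and> t \<le> cost n c p"
proof (induction p arbitrary: s s' \<sigma>)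
  case Nop
  then show ?case using exec.Skip by fastforce
next
  case (Set r e)
  obtain \<rho> \<mu> where \<sigma>: "\<sigma> = (\<rho>, \<mu>)" by fastforce
  have l: "alegal s e" "s' = set_reg r (aval s e) s" using Set by (auto split: if_splits)
  have "exec W S inp (Assign r (cexp e)) (\<rho>, \<mu>) (1 + expr_cost (cexp e)) (\<rho>(r := val inp (\<rho>, \<mu>) (cexp e)), \<mu>)"
    by (rule Assign) (use cexp_correct[OF Set(2) l(1)] \<sigma> in auto)
  then show ?case unfolding \<sigma> compile.simps cost.simps
    by (intro exI conjI, assumption) (use cexp_correct[OF Set(2) l(1)] Set \<sigma> l(2) in \<open>auto simp: simulates_def\<close>)
next
  case (Put t a b e)
  obtain \<rho> \<mu> where \<sigma>: "\<sigma> = (\<rho>, \<mu>)" by fastforce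
  have l: "alegal s a" "alegal s b" "alegal s e" "0 < t" "t < 16" "aval s a \<le> 2 * n" "aval s b \<le> c"
    "s' = set_cell t (aval s a) (aval s b) (aval s e) s"
    using Put by (auto split: if_splits)
  note ce = l(1-3)[THEN cexp_correct[OF Put(2)]]
  have sim0: "fst \<sigma> 0 = n" "fst \<sigma> 1 = c + 1" using Put(2) by (auto simp: simulates_def)
  have le: "val inp \<sigma> (cexp a) \<le> 2 * n" "val inp \<sigma> (cexp b) \<le> c" using ce l by auto
  note ad = address_legal[OF le _ _ sim0 l(5)]
  have "exec W S inp (compile (Put t a b e)) (\<rho>, \<mu>) (cost n c (Put t a b e))
     (\<rho>, \<mu>(val inp (\<rho>, \<mu>) (address t (cexp a) (cexp b)) := val inp (\<rho>, \<mu>) (cexp e)))"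
    unfolding compile.simps cost.simps
    by (rule Store) (use ad ce \<sigma> in auto)
  moreover have "val inp (\<rho>, \<mu>) (address t (cexp a) (cexp b)) = adr t (aval s a) (aval s b)"
    using ad(2) ce \<sigma> by auto
  \<comment> \<open>Output cells lie below \<open>n\<close> and all addresses at \<open>n\<close> or
    above, so the two areas never overlap.\<close>
  moreover have "simulates (\<rho>, \<mu>(adr t (aval s a) (aval s b) := aval s e)) s'"
    using Put(2) l(4-7) unfolding \<sigma> l(8) simulates_def
    by (auto simp: adr_inj set_cell_apply) (metis adr_ge leD)
  ultimately show ?case unfolding \<sigma> using ce \<sigma> by auto
next
  case (Out a e)
  obtain \<rho> \<mu> where \<sigma>: "\<sigma> = (\<rho>, \<mu>)" by fastforce
  have l: "alegal s a" "alegal s e" "aval s a < n"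
    "s' = set_cell 0 (aval s a) 0 (aval s e) s"
    using Out by (auto split: if_splits)
  note ce = l(1-2)[THEN cexp_correct[OF Out(2)]]
  have "exec W S inp (compile (Out a e)) (\<rho>, \<mu>) (cost n c (Out a e))
     (\<rho>, \<mu>(val inp (\<rho>, \<mu>) (cexp a) := val inp (\<rho>, \<mu>) (cexp e)))"
    unfolding compile.simps cost.simps
    by (rule Store) (use ce \<sigma> l S in auto)
  moreover have "simulates (\<rho>, \<mu>(aval s a := aval s e)) s'"
    using Out(2) l(3) unfolding \<sigma> l(4) simulates_def
    by (auto simp: set_cell_apply) (metis adr_ge leD)
  ultimately show ?case unfolding \<sigma> using ce \<sigma> by auto
next
  case (Then p q)
  from Then.prems obtain s1 where s1: "run p s = Some s1" "run q s1 = Some s'"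
    by (auto simp: bind_eq_Some_conv)
  from Then.IH(1)[OF _ Then.prems(2) s1(1)] Then.prems(1) obtain t1 \<sigma>1 where 1:
    "exec W S inp (compile p) \<sigma> t1 \<sigma>1" "simulates \<sigma>1 s1" "t1 \<le> cost n c p" by auto
  from Then.IH(2)[OF _ 1(2) s1(2)] Then.prems(1) obtain t2 \<sigma>2 where 2:
    "exec W S inp (compile q) \<sigma>1 t2 \<sigma>2" "simulates \<sigma>2 s'" "t2 \<le> cost n c q" by auto
  show ?case using exec.Seq[OF 1(1) 2(1)] 1(3) 2(2,3)
    by (intro exI[of _ "1 + t1 + t2"] exI[of _ \<sigma>2]) auto
next
  case (Cond e p q)
  have l: "alegal s e" using Cond.prems by (auto split: if_splits)
  note ce = cexp_correct[OF Cond.prems(2) l]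
  show ?case
  proof (cases "aval s e = 0")
    case True
    then obtain t \<sigma>' where 1: "exec W S inp (compile q) \<sigma> t \<sigma>'" "simulates \<sigma>' s'" "t \<le> cost n c q"
      using Cond.IH(2)[of \<sigma> s s'] Cond.prems l by auto
    show ?thesis using exec.IfFalse[OF _ _ 1(1), of "cexp e"] True ce 1
      by (intro exI[of _ "1 + expr_cost (cexp e) + t"] exI[of _ \<sigma>']) auto
  next
    case False
    then obtain t \<sigma>' where 1: "exec W S inp (compile p) \<sigma> t \<sigma>'" "simulates \<sigma>' s'" "t \<le> cost n c p"
      using Cond.IH(1)[of \<sigma> s s'] Cond.prems l by auto
    show ?thesis using exec.IfTrue[OF _ _ 1(1), of "cexp e"] False ce 1
      by (intro exI[of _ "1 + expr_cost (cexp e) + t"] exI[of _ \<sigma>']) auto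
  qed
next
  case (Loop r b p)
  show ?case
    by (rule compile_Loop[OF Loop.IH _ _ Loop.prems(2,3)]) (use Loop.prems(1) in auto)
qed

end

end

section \<open>Orders without an induced N\<close>

text \<open>Reading (u, v) as u > v, an N is a zigzag a > b < c > d whose other pairs are
  incomparable. The alternatives list the comparabilities that break it; the missing one, (d, a),
  would give (c, a) by transitivity.\<close>

definition nfree :: "'a rel \<Rightarrow> bool" where
  "nfree r \<longleftrightarrow> (\<forall>a b c d. (a, b) \<in> r \<longrightarrow> (c, b) \<in> r \<longrightarrow> (c, d) \<in> r \<longrightarrow>
     (a, d) \<in> r \<or> a = c \<or> (a, c) \<in> r \<or> (c, a) \<in> r \<or> b = d \<or> (b, d) \<in> r \<or> (d, b) \<in> r)"

lemma nfreeD: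
  "nfree r \<Longrightarrow> (a, b) \<in> r \<Longrightarrow> (c, b) \<in> r \<Longrightarrow> (c, d) \<in> r \<Longrightarrow>
     (a, d) \<in> r \<or> a = c \<or> (a, c) \<in> r \<or> (c, a) \<in> r \<or> b = d \<or> (b, d) \<in> r \<or> (d, b) \<in> r"
  unfolding nfree_def by blast

lemma trans_disjoint_Un:
  assumes "r1 \<subseteq> V1 \<times> V1" "r2 \<subseteq> V2 \<times> V2" "V1 \<inter> V2 = {}" "trans r1" "trans r2"
  shows "trans (r1 \<union> r2)" "trans (r1 \<union> r2 \<union> V1 \<times> V2)"
proof -
  show "trans (r1 \<union> r2)"
    by (rule transI) (use assms(1-3) transD[OF assms(4)] transD[OF assms(5)] in blast)
  show "trans (r1 \<union> r2 \<union> V1 \<times> V2)"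
  proof (rule transI)
    fix x y z assume *: "(x, y) \<in> r1 \<union> r2 \<union> V1 \<times> V2" "(y, z) \<in> r1 \<union> r2 \<union> V1 \<times> V2"
    then consider "(x, y) \<in> r1" "(y, z) \<in> r1" | "(x, y) \<in> r2" "(y, z) \<in> r2" | "x \<in> V1" "z \<in> V2"
      using assms(1-3) by blast
    then show "(x, z) \<in> r1 \<union> r2 \<union> V1 \<times> V2"
      using assms(4,5) by cases (auto dest: transD)
  qed
qed

text \<open>Applied to the converse relation, it also yields a source from which a given vertex is
  reached.\<close>

lemma finite_acyclic_sink:
  assumes "finite V" "r \<subseteq> V \<times> V" "irrefl (r\<^sup>+)" "v \<in> V"
  shows "\<exists>w \<in> V. (v, w) \<in> r\<^sup>* \<and> (\<nexists>x. (w, x) \<in> r)"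
proof -
  have f: "finite r" using assms(1,2) finite_subset by blast
  have "wf (r\<inverse>)" using f assms(3) by (intro finite_acyclic_wf_converse) (auto simp: acyclic_def irrefl_def)
  then show ?thesis using assms(4)
  proof (induction v rule: wf_induct_rule)
    case (less v)
    show ?case
    proof (cases "\<exists>x. (v, x) \<in> r")
      case True
      then obtain x where x: "(v, x) \<in> r" by blast
      then show ?thesis using less.IH[of x] assms(2)
        by (metis converse_iff converse_rtrancl_into_rtrancl mem_Sigma_iff subsetD)
    qed (use less in auto)
  qed
qed

text \<open>\<open>nfree\<close> alone is not inductive: the series case needs finiteness and
  acyclicity to lead each vertex to a sink or from a source.\<close>

definition msp_inv :: "'a pair_pre_digraph \<Rightarrow> bool" where
  "msp_inv H \<longleftrightarrow> finite (pverts H) \<and> parcs H \<subseteq> pverts H \<times> pverts H \<and> pverts H \<noteq> {} \<and>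
     irrefl ((parcs H)\<^sup>+) \<and> nfree ((parcs H)\<^sup>+)"

lemma trancl_on: "r \<subseteq> V \<times> V \<Longrightarrow> r\<^sup>+ \<subseteq> V \<times> V"
  by (rule trancl_subset_Sigma)

text \<open>Lets the closure be guessed instead of computed.\<close>

lemma trancl_eqI:
  assumes "r \<subseteq> s" "s \<subseteq> r\<^sup>+" "trans s" shows "r\<^sup>+ = s"
proof
  show "r\<^sup>+ \<subseteq> s" using assms(1,3) trancl_mono trancl_id by blast
qed (use assms in auto)

lemma msp_inv_single: "msp_inv (single_vertex v)"
  by (auto simp: msp_inv_def single_vertex_def irrefl_def nfree_def)

lemma msp_inv_parallel:
  assumes "msp_inv G1" "msp_inv G2" "pverts G1 \<inter> pverts G2 = {}"
  shows "msp_inv (parallel_comp G1 G2)"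
proof -
  let ?r1 = "(parcs G1)\<^sup>+" and ?r2 = "(parcs G2)\<^sup>+"
  have on: "?r1 \<subseteq> pverts G1 \<times> pverts G1" "?r2 \<subseteq> pverts G2 \<times> pverts G2"
    using assms by (auto simp: msp_inv_def dest: trancl_on)
  have "trans (?r1 \<union> ?r2)"
    by (rule trans_disjoint_Un[OF on assms(3)]) (rule trans_trancl)+
  then have eq: "(parcs G1 \<union> parcs G2)\<^sup>+ = ?r1 \<union> ?r2"
    by (intro trancl_eqI) (auto intro: trancl_mono)
  have "irrefl (?r1 \<union> ?r2)" using assms by (auto simp: msp_inv_def irrefl_def)
  moreover have "nfree (?r1 \<union> ?r2)"
    unfolding nfree_def
  proof (intro allI impI)
    fix a b c d assume abcd: "(a, b) \<in> ?r1 \<union> ?r2" "(c, b) \<in> ?r1 \<union> ?r2" "(c, d) \<in> ?r1 \<union> ?r2"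
    then have "(a, b) \<in> ?r1 \<and> (c, b) \<in> ?r1 \<and> (c, d) \<in> ?r1 \<or> (a, b) \<in> ?r2 \<and> (c, b) \<in> ?r2 \<and> (c, d) \<in> ?r2"
      using on assms(3) by blast
    then show "(a, d) \<in> ?r1 \<union> ?r2 \<or> a = c \<or> (a, c) \<in> ?r1 \<union> ?r2 \<or> (c, a) \<in> ?r1 \<union> ?r2 \<or> b = d \<or>
       (b, d) \<in> ?r1 \<union> ?r2 \<or> (d, b) \<in> ?r1 \<union> ?r2"
      using nfreeD[of ?r1 a b c d] nfreeD[of ?r2 a b c d] assms(1,2) unfolding msp_inv_def by auto
  qed
  ultimately show ?thesis
    using assms unfolding msp_inv_def by (auto simp: parallel_comp_def eq)
qed

text \<open>Only arcs from sinks to sources are added, but in the closure they relate every vertex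
  of \<open>G1\<close> to every vertex of \<open>G2\<close>. A zigzag not inside one part then
  contains a comparable pair across the parts that breaks it.\<close>

lemma msp_inv_series:
  assumes "msp_inv G1" "msp_inv G2" "pverts G1 \<inter> pverts G2 = {}"
  shows "msp_inv (series_comp G1 G2)"
proof -
  let ?r1 = "(parcs G1)\<^sup>+" and ?r2 = "(parcs G2)\<^sup>+" and ?V = "pverts G1 \<times> pverts G2"
  let ?E = "parcs G1 \<union> parcs G2 \<union> sinks G1 \<times> sources G2"
  let ?s = "?r1 \<union> ?r2 \<union> ?V"
  have on: "?r1 \<subseteq> pverts G1 \<times> pverts G1" "?r2 \<subseteq> pverts G2 \<times> pverts G2"
    using assms by (auto simp: msp_inv_def dest: trancl_on)
  have tr: "trans ?s"
    by (rule trans_disjoint_Un[OF on assms(3)]) (rule trans_trancl)+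
  have "?V \<subseteq> ?E\<^sup>+"
  proof safe
    fix u v assume uv: "u \<in> pverts G1" "v \<in> pverts G2"
    obtain u' where u': "u' \<in> pverts G1" "(u, u') \<in> (parcs G1)\<^sup>*" "\<nexists>x. (u', x) \<in> parcs G1"
      using finite_acyclic_sink[of "pverts G1" "parcs G1" u] uv assms(1) by (auto simp: msp_inv_def)
    obtain v' where v': "v' \<in> pverts G2" "(v, v') \<in> ((parcs G2)\<inverse>)\<^sup>*" "\<nexists>x. (v', x) \<in> (parcs G2)\<inverse>"
      using finite_acyclic_sink[of "pverts G2" "(parcs G2)\<inverse>" v] uv assms(2)
      by (auto simp: msp_inv_def irrefl_def trancl_converse)
    have "(u', v') \<in> ?E" using u' v' by (auto simp: sinks_def sources_def)
    moreover have "(u, u') \<in> ?E\<^sup>*" using u'(2) by (rule rtrancl_mono[THEN subsetD, rotated]) auto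
    moreover have "(v', v) \<in> ?E\<^sup>*"
      using v'(2) unfolding rtrancl_converse by (auto intro: rtrancl_mono[THEN subsetD, rotated])
    ultimately show "(u, v) \<in> ?E\<^sup>+" by (meson rtrancl_into_trancl1 trancl_rtrancl_trancl)
  qed
  then have eq: "?E\<^sup>+ = ?s"
    using tr by (intro trancl_eqI) (auto simp: sinks_def sources_def intro: trancl_mono)
  have "irrefl ?s" using assms by (auto simp: msp_inv_def irrefl_def)
  moreover have "nfree ?s"
    unfolding nfree_def
  proof (intro allI impI)
    fix a b c d assume abcd: "(a, b) \<in> ?s" "(c, b) \<in> ?s" "(c, d) \<in> ?s"
    have "a \<in> pverts G1 \<or> a \<in> pverts G2" "c \<in> pverts G1 \<or> c \<in> pverts G2" "b \<in> pverts G1 \<or> b \<in> pverts G2"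
      "d \<in> pverts G1 \<or> d \<in> pverts G2"
      using abcd on by auto
    then consider "(a, b) \<in> ?r1 \<and> (c, b) \<in> ?r1 \<and> (c, d) \<in> ?r1" | "(a, b) \<in> ?r2 \<and> (c, b) \<in> ?r2 \<and> (c, d) \<in> ?r2"
      | "(a, c) \<in> ?V \<or> (c, a) \<in> ?V \<or> (b, d) \<in> ?V \<or> (d, b) \<in> ?V \<or> (a, d) \<in> ?V"
      using abcd on assms(3) by blast
    then show "(a, d) \<in> ?s \<or> a = c \<or> (a, c) \<in> ?s \<or> (c, a) \<in> ?s \<or> b = d \<or> (b, d) \<in> ?s \<or> (d, b) \<in> ?s"
    proof cases
      case 1 then show ?thesis using nfreeD[of ?r1 a b c d] assms(1) unfolding msp_inv_def by auto
    next
      case 2 then show ?thesis using nfreeD[of ?r2 a b c d] assms(2) unfolding msp_inv_def by auto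
    qed auto
  qed
  moreover have "?E \<subseteq> (pverts G1 \<union> pverts G2) \<times> (pverts G1 \<union> pverts G2)"
    using assms(1,2) by (auto simp: msp_inv_def sinks_def sources_def)
  ultimately show ?thesis
    using assms unfolding msp_inv_def series_comp_def pair_pre_digraph.simps eq by simp
qed

lemma minimal_series_parallel_nfree: "minimal_series_parallel H \<Longrightarrow> msp_inv H"
  by (induction rule: minimal_series_parallel.induct)
    (simp_all add: msp_inv_single msp_inv_parallel msp_inv_series)

lemma parcs_transitive_closure: "parcs (transitive_closure G) = (parcs G)\<^sup>+ - Id"
proof -
  have "arcs_ends (with_proj G) = parcs G" by (auto simp: arcs_ends_def arc_to_ends_def)
  then show ?thesis by (auto simp: transitive_closure_def)
qed

text \<open>\<open>transitive_closure\<close> drops diagonal pairs, so acyclicity does not transfer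
  at once. As \<open>G\<close> has no loops, a cycle has two distinct vertices, and both arcs
  between them would be in the closure of the acyclic \<open>H\<close>.\<close>

lemma series_parallel_order:
  assumes "series_parallel G"
  shows "pverts G \<noteq> {}" "irrefl ((parcs G)\<^sup>+)" "nfree ((parcs G)\<^sup>+)"
proof -
  obtain H where G: "pair_digraph G" and H: "msp_inv H" and eq: "transitive_closure G = transitive_closure H"
    using assms minimal_series_parallel_nfree by (auto simp: series_parallel_def)
  have "pverts G = pverts H" using arg_cong[OF eq, of pverts] by (simp add: transitive_closure_def)
  then show "pverts G \<noteq> {}" using H by (auto simp: msp_inv_def)
  have *: "(parcs G)\<^sup>+ - Id = (parcs H)\<^sup>+"
    using arg_cong[OF eq, of parcs] H unfolding parcs_transitive_closure by (auto simp: msp_inv_def irrefl_def)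
  show irr: "irrefl ((parcs G)\<^sup>+)"
  proof (rule irreflI)
    fix u show "(u, u) \<notin> (parcs G)\<^sup>+"
    proof
      assume "(u, u) \<in> (parcs G)\<^sup>+"
      then obtain v where v: "(u, v) \<in> parcs G" "(v, u) \<in> (parcs G)\<^sup>*" by (meson tranclD)
      interpret pair_digraph G by (rule G)
      have "u \<noteq> v" using pair_no_loops[OF v(1)] by simp
      then have "(u, v) \<in> (parcs H)\<^sup>+" "(v, u) \<in> (parcs H)\<^sup>+"
        using v unfolding *[symmetric] by (auto simp: rtrancl_eq_or_trancl)
      then show False using H by (auto simp: msp_inv_def irrefl_def dest: trancl_trans)
    qed
  qed
  then have "(parcs G)\<^sup>+ = (parcs H)\<^sup>+" unfolding *[symmetric] by (auto simp: irrefl_def)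
  then show "nfree ((parcs G)\<^sup>+)" using H by (simp add: msp_inv_def)
qed

section \<open>Twin reduction\<close>

text \<open>In \<open>Ser a b\<close> every leaf of \<open>a\<close> lies above every leaf of \<open>b\<close>.\<close>

datatype sp = Leaf nat | Par sp sp | Ser sp sp

fun leaves :: "sp \<Rightarrow> nat set" where
  "leaves (Leaf v) = {v}"
| "leaves (Par a b) = leaves a \<union> leaves b"
| "leaves (Ser a b) = leaves a \<union> leaves b"

section \<open>The linear extension and the keys\<close>

locale nfree_items =
  fixes n :: nat and sz :: "nat \<Rightarrow> nat" and c :: nat and r :: "nat rel"
  assumes r_on: "r \<subseteq> {..<n} \<times> {..<n}" and r_trans: "trans r" and r_irrefl: "irrefl r"
    and r_nfree: "nfree r" and sz_pos: "j < n \<Longrightarrow> 0 < sz j"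
begin

definition below :: "nat \<Rightarrow> nat set" where "below v = r `` {v}"

text \<open>The least size of a closed set containing \<open>v\<close>.\<close>

definition weight :: "nat \<Rightarrow> nat" where "weight v = sum sz (insert v (below v))"

text \<open>Weight first, item number as tie-breaker: an injective linear extension that is computed
  from stored data without sorting.\<close>

definition pos :: "nat \<Rightarrow> nat" where "pos v = weight v * n + v"

text \<open>The successor reserves 0 for elements with nothing below them.\<close>

definition tau :: "nat \<Rightarrow> nat" where
  "tau v = (if below v = {} then 0 else Suc (Max (pos ` below v)))"

definition relevant :: "nat set" where "relevant = {v. v < n \<and> weight v \<le> c}"

lemma in_below [simp]: "u \<in> below v \<longleftrightarrow> (v, u) \<in> r"
  by (simp add: below_def)

lemma r_less: "(u, v) \<in> r \<Longrightarrow> u < n \<and> v < n"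
  using r_on by auto

lemma r_not_refl [simp]: "(v, v) \<notin> r"
  using r_irrefl by (simp add: irrefl_def)

lemma r_tr: "(u, v) \<in> r \<Longrightarrow> (v, w) \<in> r \<Longrightarrow> (u, w) \<in> r"
  using r_trans by (rule transD)

lemma r_asym: "(u, v) \<in> r \<Longrightarrow> (v, u) \<notin> r"
  using r_tr r_not_refl by blast

lemma r_N: "(a, b) \<in> r \<Longrightarrow> (d, b) \<in> r \<Longrightarrow> (d, e) \<in> r \<Longrightarrow>
     (a, e) \<in> r \<or> a = d \<or> (a, d) \<in> r \<or> (d, a) \<in> r \<or> b = e \<or> (b, e) \<in> r \<or> (e, b) \<in> r"
  using nfreeD[OF r_nfree] .

lemma below_subset: "below v \<subseteq> {..<n}"
  using r_on by auto

lemma finite_below [simp]: "finite (below v)"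
  using below_subset finite_subset by blast

lemma weight_mono: assumes "(v, u) \<in> r" shows "weight u < weight v"
proof -
  have "weight v = sz v + sum sz (below v)" by (simp add: weight_def)
  moreover have "weight u \<le> sum sz (below v)"
    unfolding weight_def using assms by (intro sum_mono2) (auto intro: r_tr)
  moreover have "0 < sz v" using assms r_less sz_pos by blast
  ultimately show ?thesis by simp
qed

lemma pos_inj: assumes "u < n" "v < n" "pos u = pos v" shows "u = v"
  using arg_cong[OF assms(3), of "\<lambda>x. x mod n"] assms(1,2) by (simp add: pos_def)

lemma pos_mono: assumes "(v, u) \<in> r" shows "pos u < pos v"
proof -
  have "Suc (weight u) * n \<le> weight v * n" using weight_mono[OF assms] by (intro mult_le_mono1) simp
  moreover have "u < n" using assms r_less by blast
  ultimately show ?thesis by (simp add: pos_def)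
qed

lemma tau_top:
  assumes "below v \<noteq> {}"
  obtains x where "(v, x) \<in> r" "tau v = Suc (pos x)" "\<And>z. (v, z) \<in> r \<Longrightarrow> pos z \<le> pos x"
proof -
  have "Max (pos ` below v) \<in> pos ` below v" using assms by (intro Max_in) auto
  then obtain x where "x \<in> below v" "Max (pos ` below v) = pos x" by auto
  then show ?thesis using that[of x] assms by (metis Max_ge finite_below finite_imageI imageI in_below tau_def)
qed

lemma pos_less_tau: "(v, u) \<in> r \<Longrightarrow> pos u < tau v"
  using tau_top by (metis empty_iff in_below le_imp_less_Suc)

lemma tau_le_pos: "tau v \<le> pos v"
proof (cases "below v = {}")
  case False
  then show ?thesis using tau_top pos_mono by (metis Suc_leI)
qed (simp add: tau_def)

lemma tau_mono: "(v, u) \<in> r \<Longrightarrow> tau u < tau v"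
  using pos_less_tau tau_le_pos le_less_trans by blast

text \<open>\<open>x\<close> is the top of \<open>below q\<close>, so no \<open>z\<close> below
  \<open>q\<close> lies above \<open>x\<close>. If \<open>y\<close> were not above such a
  \<open>z\<close>, the zigzag y > x < q > z would be an induced N.\<close>

lemma below_mono_top:
  assumes "(q, x) \<in> r" "tau q = Suc (pos x)" "(y, x) \<in> r" "(q, y) \<notin> r"
  shows "below q \<subseteq> below y"
proof
  fix z assume "z \<in> below q"
  then have z: "(q, z) \<in> r" by simp
  have "pos z \<le> pos x" using pos_less_tau[OF z] assms(2) by simp
  then have "(z, x) \<notin> r" using pos_mono by fastforce
  then show "z \<in> below y"
    using r_N[OF assms(3,1) z] assms(3,4) z r_tr by auto
qed

text \<open>Elements with equal keys have the same top element, as \<open>pos\<close> is injective,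
  and are incomparable, as \<open>tau\<close> is strictly monotone; so \<open>below_mono_top\<close>
  applies both ways.\<close>

lemma tau_eq_below: assumes "tau q = tau y" shows "below q = below y"
proof (cases "below q = {}")
  case True
  then have "tau y = 0" using assms by (simp add: tau_def)
  then show ?thesis using True by (simp add: tau_def split: if_splits)
next
  case False
  then obtain x where x: "(q, x) \<in> r" "tau q = Suc (pos x)" by (rule tau_top)
  then have "below y \<noteq> {}" using assms by (auto simp: tau_def)
  then obtain x' where x': "(y, x') \<in> r" "tau y = Suc (pos x')" by (rule tau_top)
  then have "x' = x" using x assms pos_inj r_less by (metis Suc_inject)
  moreover have "(q, y) \<notin> r" "(y, q) \<notin> r" using tau_mono assms by fastforce+
  ultimately show ?thesis using below_mono_top[OF x, of y] below_mono_top[OF x', of q] x x' by auto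
qed

lemma below_eq_tau: "below q = below y \<Longrightarrow> tau q = tau y"
  by (simp add: tau_def)

lemma relevant_below: "v \<in> relevant \<Longrightarrow> (v, u) \<in> r \<Longrightarrow> u \<in> relevant"
  using weight_mono r_less by (fastforce simp: relevant_def)

lemma finite_relevant [simp]: "finite relevant"
  by (simp add: relevant_def)

text \<open>
  \<open>M\<close> maps each representative \<open>v \<in> A\<close> to a module of the order on the relevant items; the
  representative is minimal in its module, so \<open>below v\<close> consists of the items below the module.
\<close>

definition modules :: "nat set \<Rightarrow> (nat \<Rightarrow> nat set) \<Rightarrow> bool" where
  "modules A M \<longleftrightarrow> A \<subseteq> relevant \<and> (\<Union>v\<in>A. M v) = relevant \<and>
     (\<forall>u\<in>A. \<forall>v\<in>A. u \<noteq> v \<longrightarrow> M u \<inter> M v = {}) \<and>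
     (\<forall>v\<in>A. v \<in> M v \<and> (\<forall>x\<in>M v. (v, x) \<notin> r)) \<and>
     (\<forall>u\<in>A. \<forall>v\<in>A. u \<noteq> v \<longrightarrow> (\<forall>x\<in>M u. \<forall>y\<in>M v. (x, y) \<in> r \<longleftrightarrow> (u, v) \<in> r))"

lemma modules_init: "modules relevant (\<lambda>v. {v})"
  by (auto simp: modules_def)

lemma modulesD:
  assumes "modules A M"
  shows "A \<subseteq> relevant" "(\<Union>v\<in>A. M v) = relevant" "u \<in> A \<Longrightarrow> v \<in> A \<Longrightarrow> u \<noteq> v \<Longrightarrow> M u \<inter> M v = {}"
    "v \<in> A \<Longrightarrow> v \<in> M v" "v \<in> A \<Longrightarrow> x \<in> M v \<Longrightarrow> (v, x) \<notin> r"
    "u \<in> A \<Longrightarrow> v \<in> A \<Longrightarrow> u \<noteq> v \<Longrightarrow> x \<in> M u \<Longrightarrow> y \<in> M v \<Longrightarrow> (x, y) \<in> r \<longleftrightarrow> (u, v) \<in> r"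
    "v \<in> A \<Longrightarrow> M v \<subseteq> relevant"
  using assms unfolding modules_def by blast+

lemma modulesI:
  assumes "A \<subseteq> relevant" "(\<Union>v\<in>A. M v) = relevant" "\<And>u v. u \<in> A \<Longrightarrow> v \<in> A \<Longrightarrow> u \<noteq> v \<Longrightarrow> M u \<inter> M v = {}"
    "\<And>v. v \<in> A \<Longrightarrow> v \<in> M v \<and> (\<forall>x\<in>M v. (v, x) \<notin> r)"
    "\<And>u v x y. u \<in> A \<Longrightarrow> v \<in> A \<Longrightarrow> u \<noteq> v \<Longrightarrow> x \<in> M u \<Longrightarrow> y \<in> M v \<Longrightarrow> (x, y) \<in> r \<longleftrightarrow> (u, v) \<in> r"
  shows "modules A M"
  using assms(1-4) unfolding modules_def by (intro conjI ballI impI assms(5)) auto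

text \<open>Minimality of the representative keeps its own module out of the union. Hence
  \<open>below\<close>, computed once for single items, can be reused throughout the
  contractions.\<close>

lemma module_below:
  assumes "modules A M" "v \<in> A"
  shows "below v = (\<Union>u\<in>{u\<in>A. (v, u) \<in> r}. M u)"
proof (intro set_eqI iffI)
  fix x assume "x \<in> below v"
  then have vx: "(v, x) \<in> r" by simp
  then have "x \<in> relevant" using relevant_below modulesD(1)[OF assms(1)] assms(2) by blast
  then obtain u where u: "u \<in> A" "x \<in> M u" using modulesD(2)[OF assms(1)] by blast
  then have "u \<noteq> v" using modulesD(5)[OF assms(1)] vx assms(2) by blast
  then have "(v, u) \<in> r" using modulesD(4,6)[OF assms(1)] u vx assms(2) by blast
  then show "x \<in> (\<Union>u\<in>{u\<in>A. (v, u) \<in> r}. M u)" using u by blast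
next
  fix x assume "x \<in> (\<Union>u\<in>{u\<in>A. (v, u) \<in> r}. M u)"
  then obtain u where "u \<in> A" "(v, u) \<in> r" "x \<in> M u" by blast
  then show "x \<in> below v" using modulesD(4)[OF assms(1,2)] modulesD(6)[OF assms(1), where u=v and v=u and x=v and y=x] assms(2) r_not_refl[of v] by (cases "v = u") auto
qed

section \<open>Descent and contraction of twins\<close>

text \<open>\<open>None\<close> stands for a virtual element above all representatives.\<close>

definition candidates :: "nat set \<Rightarrow> nat option \<Rightarrow> nat set" where
  "candidates A p = (case p of None \<Rightarrow> A | Some p \<Rightarrow> {v\<in>A. (p, v) \<in> r})"

text \<open>The invariant of the descent. Another element with the same items below lies above
  everything that \<open>p\<close> lies above, but not above \<open>p\<close>; this is what would
  spoil a series contraction with \<open>p\<close> on top.\<close>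

definition lonely :: "nat set \<Rightarrow> nat option \<Rightarrow> bool" where
  "lonely A p \<longleftrightarrow> (case p of None \<Rightarrow> True | Some p \<Rightarrow> \<forall>y\<in>A. below y = below p \<longrightarrow> y = p)"

text \<open>An \<open>a\<close> above \<open>q\<close> has a larger key, hence is no candidate,
  hence is not below \<open>p\<close>. Unless a > y, the zigzag a > q < p > y is an induced
  N.\<close>

lemma parallel_twins:
  assumes "A \<subseteq> relevant" "q \<in> candidates A p" "y \<in> candidates A p" "q \<noteq> y" "tau q = tau y"
    and max: "\<And>z. z \<in> candidates A p \<Longrightarrow> tau z \<le> tau q"
    and a: "a \<in> A" "(a, q) \<in> r"
  shows "(a, y) \<in> r"
proof -
  have nr: "(q, y) \<notin> r" "(y, q) \<notin> r" using tau_mono assms(5) by fastforce+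
  have "a \<notin> candidates A p" using max[of a] tau_mono[OF a(2)] by auto
  with a obtain p' where p: "p = Some p'" "(p', a) \<notin> r" by (auto simp: candidates_def split: option.splits)
  then have pq: "(p', q) \<in> r" "(p', y) \<in> r" using assms(2,3) by (auto simp: candidates_def)
  show ?thesis using r_N[OF a(2) pq] p(2) nr pq(2) r_tr \<open>q \<noteq> y\<close> by auto
qed

text \<open>Equal keys give equal sets below, and \<open>parallel_twins\<close>, used both ways,
  gives the same representatives above.\<close>

lemma merge_parallel:
  assumes m: "modules A M" and "q \<in> candidates A p" "y \<in> candidates A p" "q \<noteq> y" "tau q = tau y"
    and max: "\<And>z. z \<in> candidates A p \<Longrightarrow> tau z \<le> tau q"
  shows "modules (A - {y}) (M(q := M q \<union> M y))"
    and "x \<in> M q \<Longrightarrow> x' \<in> M y \<Longrightarrow> (x, x') \<notin> r \<and> (x', x) \<notin> r"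
proof -
  have A: "q \<in> A" "y \<in> A" "A \<subseteq> relevant"
    using assms(2,3) modulesD(1)[OF m] by (auto simp: candidates_def split: option.splits)
  have nr: "(q, y) \<notin> r" "(y, q) \<notin> r" using tau_mono assms(5) by fastforce+
  have below: "below q = below y" by (rule tau_eq_below[OF assms(5)])
  have up: "(a, q) \<in> r \<longleftrightarrow> (a, y) \<in> r" if "a \<in> A" for a
    using parallel_twins[OF A(3) assms(2-6) that] assms(5)
      parallel_twins[OF A(3) assms(3,2) assms(4,5)[symmetric] max[unfolded assms(5)] that] by blast
  have dn: "(q, a) \<in> r \<longleftrightarrow> (y, a) \<in> r" for a using below by (metis in_below)
  show tw: "x \<in> M q \<Longrightarrow> x' \<in> M y \<Longrightarrow> (x, x') \<notin> r \<and> (x', x) \<notin> r" for x x'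
    using modulesD(6)[OF m A(1,2) assms(4), of x x'] modulesD(6)[OF m A(2,1) assms(4)[symmetric], of x' x] nr by blast
  let ?M = "M(q := M q \<union> M y)"
  have 1: "(\<Union>v\<in>A - {y}. ?M v) = relevant"
    unfolding modulesD(2)[OF m, symmetric] using A(1,2) assms(4) by auto
  have 2: "?M u \<inter> ?M v = {}" if "u \<in> A - {y}" "v \<in> A - {y}" "u \<noteq> v" for u v
    using that modulesD(3)[OF m] A by (auto split: if_splits)
  have 3: "v \<in> ?M v \<and> (\<forall>x\<in>?M v. (v, x) \<notin> r)" if "v \<in> A - {y}" for v
    using that modulesD(4,5)[OF m] A tw by auto
  have 4: "(x, z) \<in> r \<longleftrightarrow> (u, v) \<in> r"
    if uv: "u \<in> A - {y}" "v \<in> A - {y}" "u \<noteq> v" "x \<in> ?M u" "z \<in> ?M v" for u v x z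
  proof -
    obtain u' where u': "u' \<in> A" "x \<in> M u'" "u' = u \<or> u = q \<and> u' = y"
      using uv(1,4) A(1,2) by (auto split: if_splits)
    obtain v' where v': "v' \<in> A" "z \<in> M v'" "v' = v \<or> v = q \<and> v' = y"
      using uv(2,5) A(1,2) by (auto split: if_splits)
    have "u' \<noteq> v'" using u'(3) v'(3) uv(1-3) by blast
    then have "(x, z) \<in> r \<longleftrightarrow> (u', v') \<in> r" using modulesD(6)[OF m] u' v' by blast
    also have "\<dots> \<longleftrightarrow> (u, v) \<in> r"
      using u'(3) v'(3) up[of u] dn[of v] uv(1-3) by blast
    finally show ?thesis .
  qed
  show "modules (A - {y}) ?M"
    by (rule modulesI[OF _ 1 2 3 4]) (use A(3) in auto)
qed

text \<open>A rival \<open>y\<close> with the same items below is no candidate. The failed series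
  test supplies a \<open>z\<close> below \<open>p\<close> outside \<open>M q\<close> and
  \<open>below q\<close>; with the top \<open>x\<close> of \<open>below q\<close>, the zigzag y > x
  < p > z is an induced N.\<close>

lemma lonely_step:
  assumes m: "modules A M" and q: "q \<in> candidates A p"
    and max: "\<And>z. z \<in> candidates A p \<Longrightarrow> tau z \<le> tau q"
    and uniq: "\<And>z. z \<in> candidates A p \<Longrightarrow> tau z = tau q \<Longrightarrow> z = q"
    and ns: "\<And>p'. p = Some p' \<Longrightarrow> p' \<in> A \<and> below p' \<noteq> M q \<union> below q"
  shows "lonely A (Some q)"
proof -
  have "y = q" if y: "y \<in> A" "below y = below q" for y
  proof (rule ccontr)
    assume yq: "y \<noteq> q"
    then have "y \<notin> candidates A p" using uniq below_eq_tau y by blast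
    then obtain p' where p: "p = Some p'" "(p', y) \<notin> r" using y
      by (auto simp: candidates_def split: option.splits)
    have pq: "(p', q) \<in> r" "q \<in> A" using q p by (auto simp: candidates_def)
    have p'A: "p' \<in> A" using ns p by blast
    have "M q \<union> below q \<subseteq> below p'"
      using pq r_tr[OF pq(1)] module_below[OF m p'A] by auto
    then obtain z' where z': "z' \<in> below p'" "z' \<notin> M q" "z' \<notin> below q" using ns p by blast
    then obtain z where z: "z \<in> A" "(p', z) \<in> r" "z' \<in> M z" using module_below[OF m p'A] by auto
    have zq: "z \<noteq> q" "(q, z) \<notin> r" using z z' module_below[OF m pq(2)] by auto
    have zc: "z \<in> candidates A p" using z p by (simp add: candidates_def)
    \<comment> \<open>Uniqueness of the maximal key enters here: it makes the key of
      \<open>q\<close> positive, so that the top \<open>x\<close> exists.\<close>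
    have "tau z < tau q" using max[OF zc] uniq[OF zc] zq by fastforce
    then have "below q \<noteq> {}" by (auto simp: tau_def)
    then obtain x where x: "(q, x) \<in> r" "tau q = Suc (pos x)" by (rule tau_top)
    \<comment> \<open>Otherwise \<open>z\<close> would lie above all of \<open>below q\<close> and
      its key would reach that of \<open>q\<close>.\<close>
    have "(z, x) \<notin> r"
    proof
      assume "(z, x) \<in> r"
      then have "below q \<subseteq> below z" using below_mono_top[OF x] zq by blast
      then have "tau q \<le> tau z" using x pos_less_tau[of z x] by auto
      then show False using \<open>tau z < tau q\<close> by simp
    qed
    moreover have "(x, z) \<notin> r" using r_tr x zq by blast
    moreover have "x \<noteq> z" using x zq by blast
    moreover have yx: "(y, x) \<in> r" using y x by (metis in_below)
    moreover have "(y, z) \<notin> r" using y zq by (metis in_below)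
    moreover have "(y, p') \<notin> r" using y pq by (metis in_below r_tr r_not_refl)
    ultimately show False
      using r_N[OF yx r_tr[OF pq(1) x(1)] z(2)] p(2) y pq r_not_refl
      by (metis in_below)
  qed
  then show ?thesis by (simp add: lonely_def)
qed

text \<open>Agreement downwards is the assumption \<open>ser\<close>. Upwards, an element above
  \<open>q\<close> but not above \<open>p\<close> with the smallest key would have the same items
  below as \<open>p\<close>, against \<open>lonely\<close>. The lower element \<open>q\<close> stays
  the representative because it is minimal in the union.\<close>

lemma merge_series:
  assumes m: "modules A M" and lp: "lonely A (Some p)" and p: "p \<in> A" and q: "q \<in> A" "(p, q) \<in> r"
    and ser: "below p = M q \<union> below q"
  shows "modules (A - {p}) (M(q := M q \<union> M p))"
    and "x \<in> M p \<Longrightarrow> x' \<in> M q \<Longrightarrow> (x, x') \<in> r"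
proof -
  have pq: "p \<noteq> q" using q by auto
  have A: "A \<subseteq> relevant" by (rule modulesD(1)[OF m])
  show tw: "x \<in> M p \<Longrightarrow> x' \<in> M q \<Longrightarrow> (x, x') \<in> r" for x x'
    using modulesD(6)[OF m] p q pq by metis
  have dn: "(p, a) \<in> r \<longleftrightarrow> (q, a) \<in> r" if "a \<in> A" "a \<noteq> q" for a
  proof -
    have "(p, a) \<in> r \<longleftrightarrow> a \<in> M q \<or> (q, a) \<in> r" using ser by (metis Un_iff in_below)
    moreover have "a \<notin> M q" using modulesD(3,4)[OF m] that q by blast
    ultimately show ?thesis by simp
  qed
  have up: "(a, q) \<in> r \<longleftrightarrow> (a, p) \<in> r" if a: "a \<in> A" "a \<noteq> p" for a
  proof (rule iffI, rule ccontr)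
    assume aq: "(a, q) \<in> r" "(a, p) \<notin> r"
    let ?P = "\<lambda>a. a \<in> A \<and> a \<noteq> p \<and> (a, q) \<in> r \<and> (a, p) \<notin> r"
    define b where "b = arg_min tau ?P"
    have b: "?P b" and bmin: "\<And>z. ?P z \<Longrightarrow> tau b \<le> tau z"
      using arg_min_natI[of ?P a tau] arg_min_nat_le[of ?P _ tau] a aq unfolding b_def by blast+
    have pb: "(p, b) \<notin> r" using dn[of b] b r_asym by auto
    have "below p \<subseteq> below b"
      using ser b r_tr[of b q] module_below[OF m, of b] q by auto
    moreover have "below b \<subseteq> below p"
    proof
      fix u assume "u \<in> below b"
      then obtain u' where u': "u' \<in> A" "(b, u') \<in> r" "u \<in> M u'" using module_below[OF m, of b] b by auto
      have "(p, u') \<in> r"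
      proof (rule ccontr)
        assume npu: "(p, u') \<notin> r"
        have 1: "u' \<noteq> p" "(u', p) \<notin> r" "u' \<noteq> q" using u' b q npu r_tr by auto
        \<comment> \<open>Elements below \<open>b\<close> have smaller keys, so minimality of
          \<open>b\<close> keeps \<open>u'\<close> from lying above \<open>q\<close>; then p > q < b
          > u' is an induced N.\<close>
        have 2: "(u', q) \<notin> r" using bmin[of u'] u' 1 tau_mono[OF u'(2)] by auto
        have 3: "(q, u') \<notin> r" using npu q r_tr by blast
        show False using r_N[OF q(2) _ u'(2)] b pb npu 1 2 3 by blast
      qed
      then show "u \<in> below p" using u' module_below[OF m p] by auto
    qed
    ultimately have "below b = below p" by simp
    then show False using lp b by (auto simp: lonely_def)
  qed (use q r_tr in blast)
  let ?M = "M(q := M q \<union> M p)"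
  have 1: "(\<Union>v\<in>A - {p}. ?M v) = relevant"
    unfolding modulesD(2)[OF m, symmetric] using p q pq by auto
  have 2: "?M u \<inter> ?M v = {}" if "u \<in> A - {p}" "v \<in> A - {p}" "u \<noteq> v" for u v
    using that modulesD(3)[OF m] p q by (auto split: if_splits)
  have 3: "v \<in> ?M v \<and> (\<forall>x\<in>?M v. (v, x) \<notin> r)" if "v \<in> A - {p}" for v
    using that modulesD(4,5)[OF m] q tw r_asym by auto
  have 4: "(x, z) \<in> r \<longleftrightarrow> (u, v) \<in> r"
    if uv: "u \<in> A - {p}" "v \<in> A - {p}" "u \<noteq> v" "x \<in> ?M u" "z \<in> ?M v" for u v x z
  proof -
    obtain u' where u': "u' \<in> A" "x \<in> M u'" "u' = u \<or> u = q \<and> u' = p"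
      using uv(1,4) p q(1) by (auto split: if_splits)
    obtain v' where v': "v' \<in> A" "z \<in> M v'" "v' = v \<or> v = q \<and> v' = p"
      using uv(2,5) p q(1) by (auto split: if_splits)
    have "u' \<noteq> v'" using u'(3) v'(3) uv(1-3) by blast
    then have "(x, z) \<in> r \<longleftrightarrow> (u', v') \<in> r" using modulesD(6)[OF m] u' v' by blast
    also have "\<dots> \<longleftrightarrow> (u, v) \<in> r"
      using u'(3) v'(3) up[of u] dn[of v] uv(1-3) by blast
    finally show ?thesis .
  qed
  show "modules (A - {p}) ?M"
    by (rule modulesI[OF _ 1 2 3 4]) (use A in auto)
qed


section \<open>Closed sets along the decomposition tree\<close>

definition closed_in :: "nat set \<Rightarrow> nat set \<Rightarrow> bool" where
  "closed_in V U \<longleftrightarrow> U \<subseteq> V \<and> (\<forall>x\<in>U. \<forall>y\<in>V. (x, y) \<in> r \<longrightarrow> y \<in> U)"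

fun ordered :: "sp \<Rightarrow> bool" where
  "ordered (Leaf v) \<longleftrightarrow> v < n"
| "ordered (Par a b) \<longleftrightarrow> ordered a \<and> ordered b \<and> leaves a \<inter> leaves b = {} \<and>
     (\<forall>x\<in>leaves a. \<forall>y\<in>leaves b. (x, y) \<notin> r \<and> (y, x) \<notin> r)"
| "ordered (Ser a b) \<longleftrightarrow> ordered a \<and> ordered b \<and> leaves a \<inter> leaves b = {} \<and>
     (\<forall>x\<in>leaves a. \<forall>y\<in>leaves b. (x, y) \<in> r)"

text \<open>The sets F of the overview, without truncation; the tables store their parts up to
  \<open>c\<close>.\<close>

fun totals :: "sp \<Rightarrow> nat set" where
  "totals (Leaf v) = {0, sz v}"
| "totals (Par a b) = {i + j | i j. i \<in> totals a \<and> j \<in> totals b}"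
| "totals (Ser a b) = totals b \<union> {i + sum sz (leaves b) | i. i \<in> totals a}"

lemma leaves_less: "ordered t \<Longrightarrow> leaves t \<subseteq> {..<n}"
  by (induction t) auto

lemma finite_leaves [simp]: "finite (leaves t)"
  by (induction t) auto

lemma closed_in_Par:
  assumes "ordered (Par a b)"
  shows "closed_in (leaves (Par a b)) U \<longleftrightarrow> (\<exists>X Y. U = X \<union> Y \<and> closed_in (leaves a) X \<and> closed_in (leaves b) Y)"
proof
  assume "closed_in (leaves (Par a b)) U"
  then have "U = (U \<inter> leaves a) \<union> (U \<inter> leaves b) \<and> closed_in (leaves a) (U \<inter> leaves a) \<and>
     closed_in (leaves b) (U \<inter> leaves b)"
    by (auto simp: closed_in_def)
  then show "\<exists>X Y. U = X \<union> Y \<and> closed_in (leaves a) X \<and> closed_in (leaves b) Y" by blast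
qed (use assms in \<open>auto simp: closed_in_def\<close>)

text \<open>A closed set that meets the upper part contains the whole lower part.\<close>

lemma closed_in_Ser:
  assumes "ordered (Ser a b)"
  shows "closed_in (leaves (Ser a b)) U \<longleftrightarrow>
     closed_in (leaves b) U \<or> (\<exists>X. U = X \<union> leaves b \<and> closed_in (leaves a) X)"
proof
  assume U: "closed_in (leaves (Ser a b)) U"
  show "closed_in (leaves b) U \<or> (\<exists>X. U = X \<union> leaves b \<and> closed_in (leaves a) X)"
  proof (cases "U \<inter> leaves a = {}")
    case True
    then show ?thesis using U by (auto simp: closed_in_def)
  next
    case False
    then obtain x where x: "x \<in> U" "x \<in> leaves a" by blast
    then have "leaves b \<subseteq> U" using assms U by (auto simp: closed_in_def)
    then have "U = (U \<inter> leaves a) \<union> leaves b \<and> closed_in (leaves a) (U \<inter> leaves a)"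
      using U by (auto simp: closed_in_def)
    then show ?thesis by blast
  qed
qed (use assms r_asym in \<open>auto simp: closed_in_def\<close>)

lemma sum_closed_in_Un:
  assumes "closed_in (leaves a) X" "closed_in (leaves b) Y" "leaves a \<inter> leaves b = {}"
  shows "sum sz (X \<union> Y) = sum sz X + sum sz Y"
proof (rule sum.union_disjoint)
  show "finite X" "finite Y" using assms(1,2) finite_leaves finite_subset unfolding closed_in_def by blast+
  show "X \<inter> Y = {}" using assms unfolding closed_in_def by blast
qed

lemma closed_in_leaves: "closed_in (leaves t) (leaves t)"
  by (simp add: closed_in_def)

lemma totals_closed_in: "ordered t \<Longrightarrow> totals t = sum sz ` {U. closed_in (leaves t) U}"
proof (induction t)
  case (Leaf v)
  have "{U. closed_in (leaves (Leaf v)) U} = {{}, {v}}" by (auto simp: closed_in_def)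
  then show ?case by simp
next
  case (Par a b)
  have s: "sum sz (X \<union> Y) = sum sz X + sum sz Y" if "closed_in (leaves a) X" "closed_in (leaves b) Y" for X Y
    using sum_closed_in_Un[OF that] Par.prems by simp
  show ?case
  proof (intro set_eqI iffI)
    fix x assume "x \<in> totals (Par a b)"
    then obtain X Y where "closed_in (leaves a) X" "closed_in (leaves b) Y" "x = sum sz X + sum sz Y"
      using Par by auto
    then show "x \<in> sum sz ` {U. closed_in (leaves (Par a b)) U}"
      unfolding closed_in_Par[OF Par.prems] using s by (intro image_eqI[of _ _ "X \<union> Y"]) auto
  next
    fix x assume "x \<in> sum sz ` {U. closed_in (leaves (Par a b)) U}"
    then obtain X Y where "closed_in (leaves a) X" "closed_in (leaves b) Y" "x = sum sz (X \<union> Y)"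
      unfolding closed_in_Par[OF Par.prems] by auto
    then show "x \<in> totals (Par a b)" using Par s by auto
  qed
next
  case (Ser a b)
  have s: "sum sz (X \<union> leaves b) = sum sz X + sum sz (leaves b)" if "closed_in (leaves a) X" for X
    using sum_closed_in_Un[OF that closed_in_leaves] Ser.prems by simp
  have "{U. closed_in (leaves (Ser a b)) U} =
     {U. closed_in (leaves b) U} \<union> (\<lambda>X. X \<union> leaves b) ` {X. closed_in (leaves a) X}"
    unfolding closed_in_Ser[OF Ser.prems] by auto
  moreover have "sum sz ` (\<lambda>X. X \<union> leaves b) ` {X. closed_in (leaves a) X} =
     (\<lambda>i. i + sum sz (leaves b)) ` sum sz ` {X. closed_in (leaves a) X}"
    unfolding image_image using s by (intro image_cong) auto
  ultimately show ?case using Ser by (auto simp: image_Un)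
qed

text \<open>Positive sizes turn equality of nested sets into equality of numbers. Both the series
  test and the reading of a solution rest on this.\<close>

lemma sum_sz_eq_imp_eq:
  assumes "U \<subseteq> V" "V \<subseteq> {..<n}" "sum sz U = sum sz V" shows "U = V"
proof (rule ccontr)
  assume "U \<noteq> V"
  then obtain x where x: "x \<in> V - U" using assms(1) by blast
  have "finite V" using assms(2) finite_subset by blast
  moreover have "0 < sz x" using x assms(2) sz_pos by blast
  ultimately have "sum sz U < sum sz V"
    using x assms(1) sum_strict_mono2[of V U x sz] by simp
  then show False using assms(3) by simp
qed

definition split_Par :: "sp \<Rightarrow> sp \<Rightarrow> nat \<Rightarrow> nat \<Rightarrow> nat \<Rightarrow> bool" where
  "split_Par a b w wa wb \<longleftrightarrow> wa \<in> totals a \<and> wb \<in> totals b \<and> w = wa + wb"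

text \<open>One formula for both branches of \<open>totals\<close>: nothing is taken above, or
  everything below.\<close>

definition split_Ser :: "sp \<Rightarrow> sp \<Rightarrow> nat \<Rightarrow> nat \<Rightarrow> nat \<Rightarrow> bool" where
  "split_Ser a b w wa wb \<longleftrightarrow> wb \<in> totals b \<and> wa \<in> totals a \<and> w = wa + wb \<and>
     (wa = 0 \<or> wb = sum sz (leaves b))"

lemma closed_in_split_Par:
  assumes "ordered (Par a b)" "split_Par a b w wa wb" "closed_in (leaves a) U" "closed_in (leaves b) V"
    "sum sz U = wa" "sum sz V = wb"
  shows "closed_in (leaves (Par a b)) (U \<union> V) \<and> sum sz (U \<union> V) = w"
proof
  show "closed_in (leaves (Par a b)) (U \<union> V)"
    unfolding closed_in_Par[OF assms(1)] using assms by blast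
  show "sum sz (U \<union> V) = w"
    using sum_closed_in_Un[OF assms(3,4)] assms by (simp add: split_Par_def)
qed

lemma closed_in_split_Ser:
  assumes o: "ordered (Ser a b)" and "split_Ser a b w wa wb" "closed_in (leaves a) U" "closed_in (leaves b) V"
    "sum sz U = wa" "sum sz V = wb"
  shows "closed_in (leaves (Ser a b)) (U \<union> V) \<and> sum sz (U \<union> V) = w"
proof
  have UV: "U \<subseteq> {..<n}" "V \<subseteq> leaves b" "leaves b \<subseteq> {..<n}"
    using assms(3,4) leaves_less[of a] leaves_less[of b] o by (auto simp: closed_in_def)
  have "wa = 0 \<or> wb = sum sz (leaves b)" using assms(2) by (simp add: split_Ser_def)
  moreover have "U = {}" if "wa = 0"
    using sum_sz_eq_imp_eq[OF _ UV(1), of "{}"] that assms(5) by simp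
  moreover have "V = leaves b" if "wb = sum sz (leaves b)"
    using sum_sz_eq_imp_eq[OF UV(2,3)] that assms(6) by simp
  ultimately show "closed_in (leaves (Ser a b)) (U \<union> V)"
    unfolding closed_in_Ser[OF o] using assms(3,4) by (metis Un_empty_left)
  show "sum sz (U \<union> V) = w"
    using sum_closed_in_Un[OF assms(3,4)] assms(2,5,6) o by (simp add: split_Ser_def)
qed

text \<open>A member brings along everything below it, so its weight is at most the size of the set.
  Conversely, \<open>relevant\<close> is closed under the order.\<close>

lemma closed_iff_relevant:
  assumes "sum sz U \<le> c"
  shows "closed_in {..<n} U \<longleftrightarrow> closed_in relevant U"
proof
  assume U: "closed_in {..<n} U"
  have "v \<in> relevant" if "v \<in> U" for v
  proof -
    have *: "insert v (below v) \<subseteq> U" "U \<subseteq> {..<n}"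
    proof -
      show "U \<subseteq> {..<n}" using U unfolding closed_in_def by blast
      have "u \<in> U" if "(v, u) \<in> r" for u
        using U \<open>v \<in> U\<close> that r_less[OF that] unfolding closed_in_def lessThan_iff by blast
      then show "insert v (below v) \<subseteq> U" using \<open>v \<in> U\<close> in_below by blast
    qed
    then have "finite U" using finite_subset by blast
    then have "weight v \<le> sum sz U" unfolding weight_def using * by (intro sum_mono2) auto
    then show ?thesis using assms that *(2) by (auto simp: relevant_def)
  qed
  moreover have "relevant \<subseteq> {..<n}" by (auto simp: relevant_def)
  ultimately show "closed_in relevant U" using U unfolding closed_in_def by blast
next
  assume U: "closed_in relevant U"
  then show "closed_in {..<n} U"
    using relevant_below unfolding closed_in_def relevant_def by blast
qed

end

section \<open>The program\<close>

abbreviation (input) "aadd \<equiv> Op Plus"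
abbreviation (input) "asub \<equiv> Op Minus"
abbreviation (input) "amul \<equiv> Op Times"
abbreviation (input) "alt \<equiv> Op Less"
abbreviation (input) "aeq \<equiv> Op Equal"
abbreviation (input) "cell1 t e \<equiv> Cell t e (Lit 0)"
abbreviation (input) "put1 t e x \<equiv> Put t e (Lit 0) x"
abbreviation (input) "bound_n \<equiv> Rg 0"
abbreviation (input) "bound_c \<equiv> Rg 1"
abbreviation (input) "size_of e \<equiv> Input (aadd (Lit 2) e)"

abbreviation (input) "rU \<equiv> 2"
abbreviation (input) "rV \<equiv> 3"
abbreviation (input) "rD \<equiv> 4"
abbreviation (input) "rI \<equiv> 5"
abbreviation (input) "rK \<equiv> 6"
abbreviation (input) "rS \<equiv> 7"
abbreviation (input) "rW \<equiv> 8"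
abbreviation (input) "rT \<equiv> 9"
abbreviation (input) "rP \<equiv> 10"
abbreviation (input) "rQ \<equiv> 11"
abbreviation (input) "rY \<equiv> 12"
abbreviation (input) "rF \<equiv> 13"
abbreviation (input) "rG \<equiv> 14"
abbreviation (input) "rCur \<equiv> 15"
abbreviation (input) "rM \<equiv> 16"
abbreviation (input) "rA \<equiv> 17"
abbreviation (input) "rB \<equiv> 18"
abbreviation (input) "rX \<equiv> 19"
abbreviation (input) "rSB \<equiv> 20"
abbreviation (input) "rRow \<equiv> 24"

abbreviation (input) "tADJ \<equiv> 1"
abbreviation (input) "tDEG \<equiv> 2"
abbreviation (input) "tL \<equiv> 3"
abbreviation (input) "tLEN \<equiv> 4"
abbreviation (input) "tMARK \<equiv> 5"
abbreviation (input) "tWT \<equiv> 6"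
abbreviation (input) "tTAU \<equiv> 7"
abbreviation (input) "tALIVE \<equiv> 8"
abbreviation (input) "tTID \<equiv> 9"
abbreviation (input) "tMS \<equiv> 10"
abbreviation (input) "tT \<equiv> 11"
abbreviation (input) "tC1 \<equiv> 12"
abbreviation (input) "tC2 \<equiv> 13"
abbreviation (input) "tTYP \<equiv> 14"
abbreviation (input) "tWANT \<equiv> 15"

section \<open>Truncated adjacency lists and the aborted search\<close>

text \<open>
  Registers are named \<open>r\<dots>\<close> and arrays \<open>t\<dots>\<close>. \<open>ADJ\<close> and \<open>DEG\<close> hold adjacency lists cut off after \<open>c + 1\<close>
  entries, \<open>L\<close> and \<open>LEN\<close> the items reachable from each item, \<open>WT\<close> their total size. \<open>ALIVE\<close> marks the
  representatives of the current modules, \<open>TID\<close> is the row of \<open>T\<close> with the table of the module and \<open>MS\<close>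
  the size of the module. Rows of \<open>T\<close> from \<open>n\<close> on are inner nodes of the decomposition tree, with
  children \<open>C1\<close> and \<open>C2\<close>; \<open>TYP\<close> is 0 for a parallel node and the size of the lower child for a series
  node. Array 0 is the output. After \<open>find_twins\<close>, \<open>rF\<close> is 1 for parallel and 2 for series twins.
\<close>

definition adjacency_body :: prog where
  "adjacency_body =
     Cond (amul (Input (aadd (aadd (Lit 2) bound_n) (aadd (amul (Rg rU) bound_n) (Rg rV)))) (alt (Rg rD) bound_c))
       (Put tADJ (Rg rU) (Rg rD) (Rg rV) ;; Set rD (aadd (Rg rD) (Lit 1))) Nop"

definition adjacency :: prog where
  "adjacency = Loop rU True (Set rD (Lit 0) ;; Loop rV True adjacency_body ;; put1 tDEG (Rg rU) (Rg rD))"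

text \<open>Products of tests are conjunctions without short-circuit: all factors are evaluated and
  must be legal.\<close>

definition bfs_visit :: prog where
  "bfs_visit =
     Cond (amul (alt (Rg rK) (cell1 tDEG (Rg rU))) (alt (Rg rS) bound_c))
       (Set rW (Cell tADJ (Rg rU) (Rg rK)) ;;
        Cond (aeq (cell1 tMARK (Rg rW)) (aadd (Rg rV) (Lit 1))) Nop
          (put1 tMARK (Rg rW) (aadd (Rg rV) (Lit 1)) ;;
           Set rS (aadd (Rg rS) (size_of (Rg rW))) ;;
           Cond (alt (Rg rS) bound_c)
             (Put tL (Rg rV) (Rg rD) (Rg rW) ;; Set rD (aadd (Rg rD) (Lit 1))) Nop)) Nop"

definition bfs_expand :: prog where
  "bfs_expand =
     Cond (amul (alt (Rg rI) (Rg rD)) (alt (Rg rS) bound_c))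
       (Set rU (Cell tL (Rg rV) (Rg rI)) ;; Loop rK False bfs_visit) Nop"

definition bfs :: prog where
  "bfs = Loop rV True
     (put1 tMARK (Rg rV) (aadd (Rg rV) (Lit 1)) ;; Put tL (Rg rV) (Lit 0) (Rg rV) ;;
      Set rD (Lit 1) ;; Set rS (size_of (Rg rV)) ;;
      Loop rI False bfs_expand ;;
      put1 tLEN (Rg rV) (Rg rD) ;; put1 tWT (Rg rV) (Rg rS))"

text \<open>The order is reachability along \<open>E\<close>. In \<open>M_bound\<close>,
  \<open>n * n\<close> is for indices into the matrix, \<open>n * c\<close> for positions
  \<open>weight u * n + u\<close>, and the factor 100 leaves room for sums of a few sizes and
  indices.\<close>

locale ssg_machine = nfree_items n sz c "E\<^sup>+" + machine n c M inp
  for n :: nat and sz :: "nat \<Rightarrow> nat" and c :: nat and E :: "nat rel" and M :: nat and inp :: "nat list" +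
  assumes n_pos: "0 < n" and c_pos: "0 < c"
    and inp_length: "length inp = 2 + n + n * n"
    and inp_size: "v < n \<Longrightarrow> inp ! (2 + v) = sz v"
    and inp_arc: "u < n \<Longrightarrow> v < n \<Longrightarrow> inp ! (2 + n + (u * n + v)) = (if (u, v) \<in> E then 1 else 0)"
    and M_bound: "100 * (n + c + sum sz {..<n} + 1) + n * n + n * c < M"
begin

lemma less_M: "x \<le> 100 * (n + c + sum sz {..<n} + 1) \<Longrightarrow> x < M"
  using M_bound by simp

lemma M_simps [simp]: "x \<le> 2 * n \<Longrightarrow> x < M" "x \<le> c + 1 \<Longrightarrow> x < M" "x < n \<Longrightarrow> sz x < M"
  "0 < M" "Suc 0 < M" "2 < M" "n < M" "Suc n < M" "Suc c < M" "c < M" "Suc (Suc n) < M"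
proof -
  show "x < n \<Longrightarrow> sz x < M" using member_le_sum[of x "{..<n}" sz] by (intro less_M) simp
qed (use less_M in auto)

lemma E_less: "(u, v) \<in> E \<Longrightarrow> u < n \<and> v < n"
  using r_less by blast

lemma inp_size' [simp]: "v < n \<Longrightarrow> inp ! Suc (Suc v) = sz v"
  using inp_size by simp

lemma index_less [simp]: "u < n \<Longrightarrow> v < n \<Longrightarrow> u * n + v < n * n"
proof -
  assume "u < n" "v < n"
  then have "Suc u * n \<le> n * n" by (intro mult_le_mono1) simp
  then show ?thesis using \<open>v < n\<close> by simp
qed

definition base :: "astate \<Rightarrow> bool" where
  "base s \<longleftrightarrow> reg s 0 = n \<and> reg s 1 = c + 1"

text \<open>Either the list is complete up to column \<open>v\<close>, or it overflowed. An overflow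
  is refuted later by counting, whenever the search stays within the capacity.\<close>

definition adj_row :: "nat \<Rightarrow> (nat \<Rightarrow> nat) \<Rightarrow> nat \<Rightarrow> nat \<Rightarrow> bool" where
  "adj_row u f d v \<longleftrightarrow> d \<le> c + 1 \<and> (\<forall>k<d. f k < v \<and> (u, f k) \<in> E) \<and> inj_on f {..<d} \<and>
     (d = c + 1 \<or> (\<forall>v'<v. (u, v') \<in> E \<longrightarrow> v' \<in> f ` {..<d}))"

definition adj_ok :: "nat \<Rightarrow> astate \<Rightarrow> bool" where
  "adj_ok m s \<longleftrightarrow> (\<forall>u<m. adj_row u (mem s tADJ u) (mem s tDEG u 0) n)"

lemma adj_row_Suc_skip: "adj_row u f d v \<Longrightarrow> (u, v) \<notin> E \<or> d = c + 1 \<Longrightarrow> adj_row u f d (Suc v)"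
  unfolding adj_row_def by (auto simp: less_Suc_eq)

lemma adj_row_Suc_add:
  assumes "adj_row u f d v" "(u, v) \<in> E" "d < c + 1"
  shows "adj_row u (f(d := v)) (Suc d) (Suc v)"
proof -
  have *: "(f(d := v)) ` {..<Suc d} = insert v (f ` {..<d})" by (auto simp: lessThan_Suc)
  show ?thesis using assms unfolding adj_row_def * 
    by (auto simp: less_Suc_eq inj_on_def)
qed

lemma adjacency_body_correct:
  assumes "base s" "reg s rU = u" "u < n" "reg s rV = v" "v < n" "adj_row u (mem s tADJ u) (reg s rD) v"
  shows "wp adjacency_body (\<lambda>s'. adj_row u (mem s' tADJ u) (reg s' rD) (Suc v) \<and>
     (\<forall>u'. u' \<noteq> u \<longrightarrow> mem s' tADJ u' = mem s tADJ u')) s"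
proof -
  have "u * n + v < n * n" using assms by simp
  then have 1: "Suc (Suc (n + (u * n + v))) < length inp" "Suc (Suc (n + (u * n + v))) < M" "u * n + v < M" "u * n < M"
    using inp_length M_bound by auto
  have 2: "inp ! Suc (Suc (n + (u * n + v))) = (if (u, v) \<in> E then 1 else 0)"
    using inp_arc[OF assms(3,5)] by simp
  show ?thesis
    using assms 1 2 adj_row_Suc_skip[OF assms(6)] adj_row_Suc_add[OF assms(6)]
    by (auto simp: adjacency_body_def base_def adj_row_def set_cell_def)
qed

lemma agree_base: "agree X Y s s' \<Longrightarrow> 0 \<notin> X \<Longrightarrow> 1 \<notin> X \<Longrightarrow> base s \<Longrightarrow> base s'"
  by (simp add: agree_def base_def)

lemma base_set_reg [simp]: "r \<noteq> 0 \<Longrightarrow> r \<noteq> Suc 0 \<Longrightarrow> base (set_reg r x s) \<longleftrightarrow> base s"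
  by (simp add: base_def)

lemma base_set_cell [simp]: "base (set_cell t i j x s) \<longleftrightarrow> base s"
  by (simp add: base_def)

lemma adjacency_correct:
  assumes "base s" shows "wp adjacency (adj_ok n) s"
  unfolding adjacency_def
proof (rule wp_Loop[where I = adj_ok])
  show "adj_ok 0 s" by (simp add: adj_ok_def)
next
  fix u s1 assume u: "u < (if True then n else c + 1)" and I: "adj_ok u s1"
    and ag: "agree (insert rU (mods (Set rD (Lit 0) ;; Loop rV True adjacency_body ;; put1 tDEG (Rg rU) (Rg rD))))
         (amods (Set rD (Lit 0) ;; Loop rV True adjacency_body ;; put1 tDEG (Rg rU) (Rg rD))) s s1"
  have b: "base s1" by (rule agree_base[OF ag _ _ assms]) (auto simp: adjacency_body_def)
  let ?s = "set_reg rD 0 (set_reg rU u s1)"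
  have "wp (Loop rV True adjacency_body) (wp (put1 tDEG (Rg rU) (Rg rD)) (adj_ok (Suc u))) ?s"
  proof (rule wp_Loop[where I = "\<lambda>v s'. adj_row u (mem s' tADJ u) (reg s' rD) v \<and>
      (\<forall>u'. u' \<noteq> u \<longrightarrow> mem s' tADJ u' = mem s1 tADJ u')"], goal_cases)
    case 1
    then show ?case by (simp add: adj_row_def)
  next
    case (2 v s2)
    have "base s2" by (rule agree_base[OF 2(3)]) (use b in \<open>auto simp: adjacency_body_def\<close>)
    moreover have "reg s2 rU = u" using 2(3) by (simp add: agree_def adjacency_body_def)
    ultimately show ?case using 2 u
      by (intro wp_mono[OF adjacency_body_correct[of _ u v]]) (auto)
  next
    case (3 s2)
    have "reg s2 rU = u" "mem s2 tDEG = mem s1 tDEG" using 3(2) by (simp_all add: agree_def adjacency_body_def)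
    then show ?case using 3(1) I u M_simps(1)[of u] M_simps(2)[of "reg s2 rD"]
      by (auto simp: adj_ok_def less_Suc_eq adj_row_def)
  qed
  then show "wp (Set rD (Lit 0) ;; Loop rV True adjacency_body ;; put1 tDEG (Rg rU) (Rg rD)) (adj_ok (Suc u)) (set_reg rU u s1)"
    by simp
next
  fix s' assume "adj_ok (if True then n else c + 1) s'"
  then show "adj_ok n (set_reg rU (if True then n else c + 1) s')" by (simp add: adj_ok_def)
qed

text \<open>
  The search from \<open>v\<close> has listed \<open>d\<close> items in \<open>f\<close>; \<open>w\<close> is their total size until it exceeds \<open>c\<close>,
  and then the search is aborted. The mark \<open>v + 1\<close> is not used by earlier searches, so the marks
  are never reset.
\<close>

definition found :: "nat \<Rightarrow> (nat \<Rightarrow> nat) \<Rightarrow> (nat \<Rightarrow> nat) \<Rightarrow> nat \<Rightarrow> nat \<Rightarrow> bool" where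
  "found v f mk d w \<longleftrightarrow> 0 < d \<and> f 0 = v \<and> inj_on f {..<d} \<and> f ` {..<d} \<subseteq> insert v ((E\<^sup>+) `` {v}) \<and>
     w \<le> c + sum sz {..<n} \<and> (\<forall>u<n. mk u \<le> Suc v) \<and>
     (if w \<le> c then w = sum sz (f ` {..<d}) \<and> (\<forall>u<n. mk u = Suc v \<longleftrightarrow> u \<in> f ` {..<d})
      else c < weight v)"

lemma found_range: "found v f mk d w \<Longrightarrow> v < n \<Longrightarrow> f ` {..<d} \<subseteq> {..<n}"
  unfolding found_def using below_subset[of v] by (auto simp: below_def)

lemma sum_sz_ge_card: "X \<subseteq> {..<n} \<Longrightarrow> card X \<le> sum sz X"
  using sum_bounded_below[of X 1 sz] sz_pos by (fastforce simp: Suc_le_eq)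

text \<open>This is why loops of \<open>c + 1\<close> rounds reach all listed items.\<close>

lemma found_le:
  assumes "found v f mk d w" "v < n" "w \<le> c" shows "d \<le> w"
proof -
  have "d = card (f ` {..<d})" using assms(1) by (simp add: found_def card_image)
  also have "\<dots> \<le> sum sz (f ` {..<d})" using found_range[OF assms(1,2)] by (rule sum_sz_ge_card)
  finally show ?thesis using assms by (simp add: found_def)
qed

text \<open>If the new item pushes the total over \<open>c\<close>, then it and the listed items are
  all \<open>v\<close> or below \<open>v\<close>, which already shows that \<open>v\<close> is too
  heavy.\<close>

lemma found_add:
  assumes f: "found v f mk d w" and v: "v < n" and w: "w \<le> c" and i: "i < d" "(f i, x) \<in> E" "mk x \<noteq> Suc v"
  shows "w + sz x \<le> c \<Longrightarrow> found v (f(d := x)) (mk(x := Suc v)) (Suc d) (w + sz x)"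
    and "c < w + sz x \<Longrightarrow> found v f (mk(x := Suc v)) d (w + sz x)"
proof -
  have x: "x < n" using E_less i by blast
  have "f i = v \<or> (v, f i) \<in> E\<^sup>+" using f i unfolding found_def by auto
  then have vx: "(v, x) \<in> E\<^sup>+" using i(2) by (auto intro: trancl_into_trancl)
  have nx: "x \<notin> f ` {..<d}" using f w i(3) x by (simp add: found_def)
  have eq: "(f(d := x)) ` {..<Suc d} = insert x (f ` {..<d})" by (auto simp: lessThan_Suc)
  have le: "sz x \<le> sum sz {..<n}" using x member_le_sum[of x "{..<n}" sz] by simp
  have fin: "finite (f ` {..<d})" by simp
  have "inj_on (f(d := x)) {..<Suc d}" using f nx by (auto simp: found_def inj_on_def less_Suc_eq)
  then show "w + sz x \<le> c \<Longrightarrow> found v (f(d := x)) (mk(x := Suc v)) (Suc d) (w + sz x)"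
    using f w nx vx x fin unfolding found_def eq by auto
  assume c: "c < w + sz x"
  have "w + sz x = sum sz (insert x (f ` {..<d}))" using f w nx fin by (simp add: found_def)
  also have "\<dots> \<le> weight v" unfolding weight_def using f vx finite_below[of v]
    by (intro sum_mono2) (auto simp: found_def below_def)
  finally show "found v f (mk(x := Suc v)) d (w + sz x)"
    using f w c le by (auto simp: found_def)
qed

definition found_state :: "nat \<Rightarrow> astate \<Rightarrow> bool" where
  "found_state v s \<longleftrightarrow> found v (mem s tL v) (\<lambda>u. mem s tMARK u 0) (reg s rD) (reg s rS)"

text \<open>The list grows only at its end, so what was shown for entries already expanded stays
  true.\<close>

definition extends :: "nat \<Rightarrow> astate \<Rightarrow> astate \<Rightarrow> bool" where
  "extends v s s' \<longleftrightarrow> reg s rD \<le> reg s' rD \<and> reg s rS \<le> reg s' rS \<and>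
     (\<forall>j<reg s rD. mem s' tL v j = mem s tL v j) \<and> (\<forall>u. u \<noteq> v \<longrightarrow> mem s' tL u = mem s tL u)"

lemma extends_trans: "extends v s s' \<Longrightarrow> extends v s' s'' \<Longrightarrow> extends v s s''"
  unfolding extends_def by auto

definition listed :: "nat \<Rightarrow> astate \<Rightarrow> nat set" where
  "listed v s = mem s tL v ` {..<reg s rD}"

lemma extends_listed: "extends v s s' \<Longrightarrow> listed v s \<subseteq> listed v s'"
proof
  fix x assume "extends v s s'" "x \<in> listed v s"
  then obtain j where "j < reg s rD" "x = mem s' tL v j" "reg s rD \<le> reg s' rD"
    unfolding extends_def listed_def by auto
  then show "x \<in> listed v s'" by (auto simp: listed_def)
qed

lemma bfs_visit_correct:
  assumes b: "base s" and v: "reg s rV = v" "v < n" and u: "reg s rU = u" "i < reg s rD" "mem s tL v i = u"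
    and k: "reg s rK = k" "k \<le> c" and f: "found_state v s" and adj: "adj_ok n s"
  shows "wp bfs_visit (\<lambda>s'. found_state v s' \<and> extends v s s' \<and>
     (reg s' rS \<le> c \<longrightarrow> k < mem s tDEG u 0 \<longrightarrow> mem s tADJ u k \<in> listed v s')) s"
proof -
  note f' = f[unfolded found_state_def]
  have "u < n" using found_range[OF f' v(2)] u by auto
  then have row: "adj_row u (mem s tADJ u) (mem s tDEG u 0) n" using adj by (simp add: adj_ok_def)
  let ?x = "mem s tADJ u k"
  have deg: "mem s tDEG u 0 \<le> c + 1" using row by (simp add: adj_row_def)
  have rS: "reg s rS \<le> c + sum sz {..<n}" using f' by (simp add: found_def)
  then have rSM: "reg s rS < M" using less_M by simp
  have noop: "found_state v s \<and> extends v s s" using f by (simp add: extends_def)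
  show ?thesis
  proof (cases "k < mem s tDEG u 0 \<and> reg s rS \<le> c")
    case False
    then show ?thesis using deg rSM noop b v u k \<open>u < n\<close>
      by (auto simp: bfs_visit_def base_def)
  next
    case True
    then have x: "?x < n" "(u, ?x) \<in> E" using row by (auto simp: adj_row_def)
    have szx: "sz ?x \<le> sum sz {..<n}" using x member_le_sum[of ?x "{..<n}" sz] by simp
    then have sM: "reg s rS + sz ?x < M" "sz ?x < M" using rS by (auto intro!: less_M)
    have mk: "mem s tMARK ?x 0 \<le> Suc v" using f' x by (simp add: found_def)
    then have mkM: "mem s tMARK ?x 0 < M" using v(2) by (auto intro: less_M)
    have d: "reg s rD \<le> c" using found_le[OF f' v(2)] True by simp
    show ?thesis
    proof (cases "mem s tMARK ?x 0 = Suc v")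
      case marked: True
      then have "?x \<in> listed v s" using f' True x by (simp add: found_def listed_def)
      moreover have "?x \<in> listed v (set_reg rW ?x s)" using calculation by (simp add: listed_def)
      ultimately show ?thesis
        using deg rSM noop b v u k \<open>u < n\<close> True marked x
        by (auto simp: bfs_visit_def base_def found_state_def extends_def inp_length)
    next
      case unmarked: False
      note add = found_add[OF f' v(2) _ u(2) _ unmarked, unfolded u(3), OF _ x(2)]
      show ?thesis
      proof (cases "reg s rS + sz ?x \<le> c")
        case le: True
        note add = add(1)[OF _ le]
        have "?x \<in> listed v (set_reg rD (Suc (reg s rD)) (set_cell tL v (reg s rD) ?x
           (set_reg rS (reg s rS + sz ?x) (set_cell tMARK ?x 0 (Suc v) (set_reg rW ?x s)))))"
          by (auto simp: listed_def)
        then show ?thesis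
          using deg rSM b v u k \<open>u < n\<close> True unmarked x add le sM mkM d
          by (auto simp: bfs_visit_def base_def found_state_def extends_def inp_length set_cell_def fun_upd_def if_distrib[of "\<lambda>f. f 0"] if_distribR)
      next
        case gt: False
        then show ?thesis
          using deg rSM b v u k \<open>u < n\<close> True unmarked x add(2) sM mkM d
          by (auto simp: bfs_visit_def base_def found_state_def extends_def inp_length set_cell_def fun_upd_def if_distrib[of "\<lambda>f. f 0"] if_distribR)
      qed
    qed
  qed
qed

lemma bfs_mods [simp]:
  "mods bfs_visit = {rW, rS, rD}" "amods bfs_visit = {tMARK, tL}"
  "mods bfs_expand = {rU, rK, rW, rS, rD}" "amods bfs_expand = {tMARK, tL}"
  by (auto simp: bfs_visit_def bfs_expand_def)

lemma adj_ok_agree: "agree X Y s s' \<Longrightarrow> tADJ \<notin> Y \<Longrightarrow> tDEG \<notin> Y \<Longrightarrow> adj_ok m s \<Longrightarrow> adj_ok m s'"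
  by (simp add: agree_def adj_ok_def)

text \<open>The clause for \<open>reg s rD \<le> i\<close> makes indices beyond the end harmless: no
  entry can appear later at an index that has been passed.\<close>

lemma bfs_expand_correct:
  assumes b: "base s" and v: "reg s rV = v" "v < n" and i: "reg s rI = i" "i \<le> c"
    and f: "found_state v s" and adj: "adj_ok n s"
  shows "wp bfs_expand (\<lambda>s'. found_state v s' \<and> extends v s s' \<and> (reg s rD \<le> i \<longrightarrow> reg s' rD = reg s rD) \<and>
     (reg s' rS \<le> c \<longrightarrow> i < reg s rD \<longrightarrow> E `` {mem s tL v i} \<subseteq> listed v s')) s"
proof -
  note f' = f[unfolded found_state_def]
  have rS: "reg s rS < M" using f' less_M by (simp add: found_def)
  have noop: "found_state v s \<and> extends v s s" using f by (simp add: extends_def)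
  have "reg s rD = card (listed v s)" using f' by (simp add: found_def listed_def card_image)
  also have "\<dots> \<le> card {..<n}" using found_range[OF f' v(2)] by (intro card_mono) (auto simp: listed_def)
  finally have rD: "reg s rD \<le> n" by simp
  show ?thesis
  proof (cases "i < reg s rD \<and> reg s rS \<le> c")
    case False
    then show ?thesis using rS rD noop b v i by (auto simp: bfs_expand_def base_def)
  next
    case True
    define u where "u = mem s tL v i"
    have u: "u < n" using found_range[OF f' v(2)] True unfolding u_def by auto
    then have row: "adj_row u (mem s tADJ u) (mem s tDEG u 0) n" using adj by (simp add: adj_ok_def)
    let ?s = "set_reg rU u s"
    have "wp (Loop rK False bfs_visit) (\<lambda>s'. found_state v s' \<and> extends v s s' \<and> (reg s rD \<le> i \<longrightarrow> reg s' rD = reg s rD) \<and>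
       (reg s' rS \<le> c \<longrightarrow> i < reg s rD \<longrightarrow> E `` {mem s tL v i} \<subseteq> listed v s')) ?s"
    proof (rule wp_Loop[where I = "\<lambda>k s'. found_state v s' \<and> extends v s s' \<and>
       (reg s' rS \<le> c \<longrightarrow> (\<forall>k'<k. k' < mem s tDEG u 0 \<longrightarrow> mem s tADJ u k' \<in> listed v s'))"], goal_cases)
      case 1
      then show ?case using noop by (auto simp: found_state_def extends_def)
    next
      case (2 k s2)
      let ?s2 = "set_reg rK k s2"
      have ag: "reg s2 rV = v" "reg s2 rU = u" "mem s2 tADJ = mem s tADJ" "mem s2 tDEG = mem s tDEG"
        using 2(3) v by (auto simp: agree_def)
      have "i < reg s2 rD" "mem s2 tL v i = u" using 2(2) True by (auto simp: extends_def u_def)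
      moreover have "base ?s2" using agree_base[OF 2(3)] b by simp
      moreover have "adj_ok n ?s2" using adj ag by (simp add: adj_ok_def)
      moreover have "found_state v ?s2" using 2(2) by (simp add: found_state_def)
      ultimately have "wp bfs_visit (\<lambda>s'. found_state v s' \<and> extends v ?s2 s' \<and>
         (reg s' rS \<le> c \<longrightarrow> k < mem ?s2 tDEG u 0 \<longrightarrow> mem ?s2 tADJ u k \<in> listed v s')) ?s2"
        using ag v 2(1) by (intro bfs_visit_correct) auto
      then show ?case
      proof (rule wp_mono)
        fix s3 assume 3: "found_state v s3 \<and> extends v ?s2 s3 \<and>
           (reg s3 rS \<le> c \<longrightarrow> k < mem ?s2 tDEG u 0 \<longrightarrow> mem ?s2 tADJ u k \<in> listed v s3)"
        then have e: "extends v s2 s3" by (simp add: extends_def)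
        then have "extends v s s3" using 2(2) extends_trans by blast
        moreover have "reg s2 rS \<le> reg s3 rS" using e by (simp add: extends_def)
        ultimately show "found_state v s3 \<and> extends v s s3 \<and>
          (reg s3 rS \<le> c \<longrightarrow> (\<forall>k'<Suc k. k' < mem s tDEG u 0 \<longrightarrow> mem s tADJ u k' \<in> listed v s3))"
          using 2(2) 3 ag extends_listed[OF e] by (auto simp: less_Suc_eq)
      qed
    next
      case (3 s2)
      have "E `` {u} \<subseteq> listed v s2" if le: "reg s2 rS \<le> c"
      proof -
        have f2: "found v (mem s2 tL v) (\<lambda>u. mem s2 tMARK u 0) (reg s2 rD) (reg s2 rS)"
          using 3(1) by (simp add: found_state_def)
        let ?d = "mem s tDEG u 0"
        have sub: "mem s tADJ u ` {..<?d} \<subseteq> listed v s2"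
          using 3(1) le row by (force simp: adj_row_def)
        have "card (mem s tADJ u ` {..<?d}) = ?d" using row by (simp add: adj_row_def card_image)
        moreover have "card (listed v s2) \<le> reg s2 rD" using card_image_le[of "{..<reg s2 rD}"] by (simp add: listed_def)
        moreover have "finite (listed v s2)" by (simp add: listed_def)
        moreover note card_mono[OF this sub] found_le[OF f2 v(2) le]
        \<comment> \<open>A truncated list would contribute \<open>c + 1\<close> distinct listed
          items, more than a total size of at most \<open>c\<close> allows; so the list was
          complete.\<close>
        ultimately have "?d \<noteq> c + 1" using le by simp
        then show ?thesis using row sub E_less by (fastforce simp: adj_row_def)
      qed
      then show ?case using 3(1) True by (auto simp: found_state_def extends_def listed_def u_def)
    qed
    then show ?thesis using True u b v i rS rD
      by (simp add: bfs_expand_def base_def u_def)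
  qed
qed

definition list_row :: "nat \<Rightarrow> (nat \<Rightarrow> nat) \<Rightarrow> nat \<Rightarrow> nat \<Rightarrow> bool" where
  "list_row v f d w \<longleftrightarrow> w \<le> c + sum sz {..<n} \<and> d \<le> n \<and>
     (if v \<in> relevant then w = weight v \<and> 0 < d \<and> d \<le> c \<and> f 0 = v \<and> inj_on f {..<d} \<and> f ` {..<d} = insert v (below v)
      else c < w)"

definition lists_ok :: "nat \<Rightarrow> astate \<Rightarrow> bool" where
  "lists_ok m s \<longleftrightarrow> (\<forall>v<m. list_row v (mem s tL v) (mem s tLEN v 0) (mem s tWT v 0))"

text \<open>The listed set contains \<open>v\<close> and is closed under arcs, hence contains
  everything reachable.\<close>

lemma found_final:
  assumes f: "found v f mk d w" and v: "v < n" and cl: "w \<le> c \<Longrightarrow> \<forall>i<d. E `` {f i} \<subseteq> f ` {..<d}"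
  shows "list_row v f d w"
proof -
  have "d = card (f ` {..<d})" using f by (simp add: found_def card_image)
  also have "\<dots> \<le> card {..<n}" using found_range[OF f v] by (intro card_mono) auto
  finally have dn: "d \<le> n" by simp
  show ?thesis
  proof (cases "w \<le> c")
    case True
    have "x \<in> f ` {..<d}" if "(v, x) \<in> E\<^sup>+" for x
      using that
    proof (induction rule: trancl_induct)
      case (base y)
      then show ?case using cl[OF True] f unfolding found_def by fastforce
    next
      case (step y z)
      then show ?case using cl[OF True] by fastforce
    qed
    moreover have "v \<in> f ` {..<d}" using f by (auto simp: found_def)
    ultimately have eq: "f ` {..<d} = insert v (below v)" using f by (auto simp: found_def below_def)
    then have "w = weight v" using f True by (simp add: found_def weight_def)
    then show ?thesis using f v True found_le[OF f v True] dn eq by (auto simp: list_row_def found_def relevant_def)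
  next
    case False
    then show ?thesis using f dn by (auto simp: list_row_def found_def relevant_def)
  qed
qed

lemma bfs_correct:
  assumes "base s" "adj_ok n s" "\<forall>u<n. mem s tMARK u 0 = 0"
  shows "wp bfs (lists_ok n) s"
  unfolding bfs_def
proof (rule wp_Loop[where I = "\<lambda>v s'. lists_ok v s' \<and> (\<forall>u<n. mem s' tMARK u 0 \<le> v)"], goal_cases)
  case 1
  then show ?case using assms by (simp add: lists_ok_def)
next
  case (2 v s1)
  then have v: "v < n" by simp
  have b: "base s1" using agree_base[OF 2(3)] assms by simp
  have adj: "adj_ok n s1" using adj_ok_agree[OF 2(3)] assms by simp
  let ?s = "set_reg rS (sz v) (set_reg rD 1 (set_cell tL v 0 v (set_cell tMARK v 0 (Suc v) (set_reg rV v s1))))"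
  let ?end = "put1 tLEN (Rg rV) (Rg rD) ;; put1 tWT (Rg rV) (Rg rS)"
  let ?Q = "\<lambda>s'. lists_ok (Suc v) s' \<and> (\<forall>u<n. mem s' tMARK u 0 \<le> Suc v)"
  have szle: "sz v \<le> sum sz {..<n}" using v member_le_sum[of v "{..<n}" sz] by simp
  have "wp (Loop rI False bfs_expand) (wp ?end ?Q) ?s"
  proof (rule wp_Loop[where I = "\<lambda>i s'. found_state v s' \<and> (\<forall>u. u \<noteq> v \<longrightarrow> mem s' tL u = mem s1 tL u) \<and>
       (reg s' rS \<le> c \<longrightarrow> (\<forall>j<i. j < reg s' rD \<longrightarrow> E `` {mem s' tL v j} \<subseteq> listed v s'))"], goal_cases)
    case 1
    have "c < weight v" if "c < sz v"
    proof -
      have "sum sz {v} \<le> weight v" unfolding weight_def by (intro sum_mono2) auto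
      then show ?thesis using that by simp
    qed
    moreover have "\<forall>u<n. mem s1 tMARK u 0 \<noteq> Suc v" using 2(2) by fastforce
    ultimately show ?case using 2(2) szle v by (auto simp: found_state_def found_def listed_def le_Suc_eq set_cell_def lessThan_Suc)
  next
    case (2 i s2)
    let ?s2 = "set_reg rI i s2"
    have e: "wp bfs_expand (\<lambda>s'. found_state v s' \<and> extends v ?s2 s' \<and> (reg ?s2 rD \<le> i \<longrightarrow> reg s' rD = reg ?s2 rD) \<and>
     (reg s' rS \<le> c \<longrightarrow> i < reg ?s2 rD \<longrightarrow> E `` {mem ?s2 tL v i} \<subseteq> listed v s')) ?s2"
    proof (rule bfs_expand_correct)
      show "base ?s2" using agree_base[OF 2(3)] b by simp
      show "adj_ok n ?s2" using adj_ok_agree[OF 2(3)] adj by (simp add: adj_ok_def)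
      show "reg ?s2 rV = v" using 2(3) by (simp add: agree_def)
      show "found_state v ?s2" using 2(2) by (simp add: found_state_def)
    qed (use 2(1) v in auto)
    show ?case
    proof (rule wp_mono[OF e], goal_cases)
      case (1 s3)
      then have ex: "extends v s2 s3" by (simp add: extends_def)
      have old: "mem s3 tL v j = mem s2 tL v j" if "j < reg s2 rD" for j using ex that by (simp add: extends_def)
      have "E `` {mem s3 tL v j} \<subseteq> listed v s3" if j: "j < Suc i" "j < reg s3 rD" "reg s3 rS \<le> c" for j
      proof (cases "j < reg s2 rD")
        case True
        then show ?thesis using 1 2(2) j old[OF True] extends_listed[OF ex] ex by (auto simp: less_Suc_eq extends_def)
      next
        case False
        then have "i < reg s2 rD" using 1 j(2) by fastforce
        then show ?thesis using False j(1) by simp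
      qed
      then show ?case using 1 2(2) ex by (auto simp: extends_def)
    qed
  next
    case (3 s2)
    have f: "found v (mem s2 tL v) (\<lambda>u. mem s2 tMARK u 0) (reg s2 rD) (reg s2 rS)"
      using 3(1) by (simp add: found_state_def)
    have "\<forall>i<reg s2 rD. E `` {mem s2 tL v i} \<subseteq> mem s2 tL v ` {..<reg s2 rD}" if "reg s2 rS \<le> c"
      using 3(1) that found_le[OF f v that] by (simp add: listed_def)
    then have row: "list_row v (mem s2 tL v) (reg s2 rD) (reg s2 rS)" by (rule found_final[OF f v])
    have "reg s2 rV = v" "mem s2 tLEN = mem s1 tLEN" "mem s2 tWT = mem s1 tWT"
      using 3(2) by (simp_all add: agree_def)
    moreover have "reg s2 rD < M" "reg s2 rS < M" using row less_M by (simp_all add: list_row_def)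
    moreover have "\<forall>u<n. mem s2 tMARK u 0 \<le> Suc v" using f by (simp add: found_def)
    ultimately show ?case using v row 2(2) 3(1) by (auto simp: lists_ok_def less_Suc_eq)
  qed
  then show ?case using b v szle by (simp add: base_def inp_length)
next
  case (3 s')
  then show ?case by (simp add: lists_ok_def)
qed

end

section \<open>Keys and the initial forest\<close>

text \<open>Index 0 of a list is the item itself and is skipped; \<open>rX\<close> is the successor
  of \<open>pos\<close>, matching the shift in \<open>tau\<close>.\<close>

definition tau_scan :: prog where
  "tau_scan =
     Cond (amul (alt (Lit 0) (Rg rK)) (alt (Rg rK) (cell1 tLEN (Rg rV))))
       (Set rU (Cell tL (Rg rV) (Rg rK)) ;;
        Set rX (aadd (aadd (amul (cell1 tWT (Rg rU)) bound_n) (Rg rU)) (Lit 1)) ;;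
        Cond (alt (Rg rT) (Rg rX)) (Set rT (Rg rX)) Nop) Nop"

definition init_item :: prog where
  "init_item =
     put1 tTAU (Rg rV) (Rg rT) ;; put1 tALIVE (Rg rV) (Lit 1) ;; put1 tTID (Rg rV) (Rg rV) ;;
     put1 tMS (Rg rV) (size_of (Rg rV)) ;;
     Put tT (Rg rV) (Lit 0) (Lit 1) ;; Put tT (Rg rV) (size_of (Rg rV)) (Lit 1) ;;
     Set rM (aadd (Rg rM) (Lit 1))"

definition keys_body :: prog where
  "keys_body = Cond (alt (cell1 tWT (Rg rV)) bound_c)
     (Set rT (Lit 0) ;; Loop rK False tau_scan ;; init_item) Nop"

definition keys :: prog where
  "keys = Set rM (Lit 0) ;; Loop rV True keys_body ;; Set rCur bound_n"

context ssg_machine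
begin

lemma keys_mods [simp]:
  "mods tau_scan = {rU, rX, rT}" "amods tau_scan = {}"
  "mods init_item = {rM}" "amods init_item = {tTAU, tALIVE, tTID, tMS, tT}"
  "mods keys_body = {rU, rX, rT, rK, rM}" "amods keys_body = {tTAU, tALIVE, tTID, tMS, tT}"
  by (auto simp: tau_scan_def init_item_def keys_body_def)

lemma lists_okD:
  assumes "lists_ok n s" "v \<in> relevant"
  shows "mem s tWT v 0 = weight v" "0 < mem s tLEN v 0" "mem s tLEN v 0 \<le> c" "mem s tL v 0 = v"
    "inj_on (mem s tL v) {..<mem s tLEN v 0}" "mem s tL v ` {..<mem s tLEN v 0} = insert v (below v)"
    "mem s tL v ` {1..<mem s tLEN v 0} = below v"
proof -
  have row: "list_row v (mem s tL v) (mem s tLEN v 0) (mem s tWT v 0)"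
    using assms by (auto simp: lists_ok_def relevant_def)
  then show *: "mem s tWT v 0 = weight v" "0 < mem s tLEN v 0" "mem s tLEN v 0 \<le> c" "mem s tL v 0 = v"
    "inj_on (mem s tL v) {..<mem s tLEN v 0}" "mem s tL v ` {..<mem s tLEN v 0} = insert v (below v)"
    using assms(2) by (auto simp: list_row_def)
  have "{1..<mem s tLEN v 0} = {..<mem s tLEN v 0} - {0}" by auto
  then have "mem s tL v ` {1..<mem s tLEN v 0} = mem s tL v ` {..<mem s tLEN v 0} - {mem s tL v 0}"
    using *(2,5) inj_on_image_set_diff[of "mem s tL v" "{..<mem s tLEN v 0}" "{..<mem s tLEN v 0}" "{0}"] by auto
  then show "mem s tL v ` {1..<mem s tLEN v 0} = below v" using * by auto
qed

lemma lists_ok_agree: "agree X Y s s' \<Longrightarrow> tL \<notin> Y \<Longrightarrow> tLEN \<notin> Y \<Longrightarrow> tWT \<notin> Y \<Longrightarrow> lists_ok m s \<Longrightarrow> lists_ok m s'"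
  by (simp add: agree_def lists_ok_def)

lemma relevant_less: "v \<in> relevant \<Longrightarrow> v < n"
  by (simp add: relevant_def)

lemma listed_below:
  assumes "lists_ok n s" "v \<in> relevant" "0 < k" "k < mem s tLEN v 0"
  shows "(v, mem s tL v k) \<in> E\<^sup>+" "mem s tL v k \<in> relevant" "mem s tL v k < n"
proof -
  have "mem s tL v k \<in> below v" using lists_okD(7)[OF assms(1,2), symmetric] assms(3,4) by auto
  then show "(v, mem s tL v k) \<in> E\<^sup>+" by simp
  then show "mem s tL v k \<in> relevant" using relevant_below assms(2) by blast
  then show "mem s tL v k < n" by (rule relevant_less)
qed

lemma pos_bound:
  assumes "u \<in> relevant" shows "pos u < n * c + n" "weight u * n \<le> n * c"
proof -
  show *: "weight u * n \<le> n * c" using assms by (simp add: relevant_def mult.commute)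
  show "pos u < n * c + n" unfolding pos_def by (rule add_le_less_mono[OF * relevant_less[OF assms]])
qed

lemma tau_scan_loop:
  assumes b: "base s" and v: "reg s rV = v" "v \<in> relevant" and l: "lists_ok n s" and t: "reg s rT = 0"
    and Q: "\<And>s'. agree {rU, rX, rT, rK} {} s s' \<Longrightarrow> reg s' rT = tau v \<Longrightarrow> Q s'"
  shows "wp (Loop rK False tau_scan) Q s"
proof -
  note lv = lists_okD[OF l v(2)]
  let ?p = "\<lambda>j. Suc (pos (mem s tL v j))" and ?d = "mem s tLEN v 0"
  define I where "I k t \<longleftrightarrow> (\<forall>j. 0 < j \<longrightarrow> j < k \<longrightarrow> j < ?d \<longrightarrow> ?p j \<le> t) \<and>
       (t = 0 \<or> (\<exists>j. 0 < j \<and> j < ?d \<and> t = ?p j))" for k t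
  have skip: "I k t \<Longrightarrow> \<not> (0 < k \<and> k < ?d) \<Longrightarrow> I (Suc k) t" for k t
    by (auto simp: I_def less_Suc_eq)
  have step: "I (Suc k) (if t < ?p k then ?p k else t)" if "I k t" "0 < k \<and> k < ?d" for k t
  proof -
    have "?p j \<le> (if t < ?p k then ?p k else t)" if "0 < j" "j < Suc k" "j < ?d" for j
    proof (cases "j = k")
      case False
      then have "?p j \<le> t" using \<open>I k t\<close> that by (simp add: I_def)
      then show ?thesis by simp
    qed simp
    then show ?thesis using that unfolding I_def by (cases "t < ?p k") auto
  qed
  have I_M: "t < M" if "I k t" for k t
  proof (cases "t = 0")
    case False
    then obtain j where j: "0 < j" "j < ?d" "t = ?p j" using \<open>I k t\<close> by (auto simp: I_def)
    then show ?thesis using pos_bound(1)[OF listed_below(2)[OF l v(2) j(1,2)]] M_bound by simp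
  qed simp
  show ?thesis
  proof (rule wp_Loop[where I = "\<lambda>k s'. I k (reg s' rT)"], goal_cases)
    case 1
    then show ?case using t by (simp add: I_def)
  next
    case (2 k s2)
    have b2: "reg s2 0 = n" "reg s2 1 = c + 1" "reg s2 rV = v" "mem s2 = mem s"
      using agree_base[OF 2(3)] b v(1) 2(3) by (auto simp: base_def agree_def)
    have tM: "reg s2 rT < M" by (rule I_M[OF 2(2)])
    show ?case
    proof (cases "0 < k \<and> k < ?d")
      case False
      then show ?thesis using 2(1) skip[OF 2(2) False] b2 lv(2,3) relevant_less[OF v(2)]
        by (auto simp: tau_scan_def)
    next
      case True
      define u where "u = mem s tL v k"
      have u: "u \<in> relevant" "u < n" using listed_below[OF l v(2)] True unfolding u_def by auto
      have w: "mem s tWT u 0 = weight u" by (rule lists_okD(1)[OF l u(1)])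
      have "weight u \<le> c" using u by (simp add: relevant_def)
      moreover have "n * c < M" using M_bound by simp
      ultimately have wM: "weight u < M" "weight u * n < M" "pos u < M" "Suc (pos u) < M"
        using le_less_trans[OF pos_bound(2)[OF u(1)]] pos_bound(1)[OF u(1)] M_bound by auto
      have Lk: "mem s tL v k = u" by (simp add: u_def)
      have st: "I (Suc k) (if reg s2 rT < Suc (pos u) then Suc (pos u) else reg s2 rT)"
        using step[OF 2(2) True] by (simp only: Lk)
      have p: "weight u * n + u = pos u" by (simp add: pos_def)
      show ?thesis using True 2(1) b2 lv(2,3) relevant_less[OF v(2)] u w wM tM st
        by (auto simp: tau_scan_def p Lk)
    qed
  next
    case (3 s2)
    have below: "below v = mem s tL v ` {1..<?d}" using lv(7) by simp
    have "reg s2 rT = tau v"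
    proof (cases "below v = {}")
      case True
      then have "?d \<le> 1" using below by simp
      then show ?thesis using 3(1) True by (auto simp: tau_def I_def)
    next
      case False
      then obtain x where x: "(v, x) \<in> E\<^sup>+" "tau v = Suc (pos x)" by (rule tau_top)
      then have "x \<in> below v" by simp
      then obtain j where "0 < j" "j < ?d" "x = mem s tL v j"
        unfolding below by (auto simp: Suc_le_eq)
      then have "tau v \<le> reg s2 rT" using 3(1) lv(3) x(2) by (auto simp: I_def)
      moreover have "?p j \<le> tau v" if "0 < j" "j < ?d" for j
        using pos_less_tau[OF listed_below(1)[OF l v(2) that]] by simp
      ultimately show ?thesis using 3(1) x(2) by (auto simp: I_def le_antisym)
    qed
    then show ?case using 3(2) by (intro Q) (auto simp: agree_def)
  qed
qed

text \<open>
  The forest of trees built so far: \<open>A\<close> is the set of live representatives, and row \<open>x\<close> of the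
  tables describes the tree \<open>X x\<close>. Rows \<open>v < n\<close> are leaves, rows from \<open>n\<close> on are inner nodes.
\<close>

definition rows :: "nat \<Rightarrow> nat set" where "rows cur = relevant \<union> {n..<cur}"

text \<open>\<open>X\<close> is a ghost variable. Children come from \<open>rows x\<close>, so their
  numbers are smaller than that of the parent. A nonzero \<open>TYP\<close> identifies a series node
  because sizes are positive.\<close>

definition trees_ok :: "(nat \<Rightarrow> sp) \<Rightarrow> nat \<Rightarrow> astate \<Rightarrow> bool" where
  "trees_ok X cur s \<longleftrightarrow>
     (\<forall>x\<in>rows cur. ordered (X x) \<and> leaves (X x) \<subseteq> relevant \<and> (\<forall>w\<le>c. mem s tT x w \<le> 1 \<and> (mem s tT x w \<noteq> 0 \<longleftrightarrow> w \<in> totals (X x)))) \<and>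
     (\<forall>x\<in>relevant. X x = Leaf x) \<and>
     (\<forall>x\<in>{n..<cur}. mem s tC1 x 0 \<in> rows x \<and> mem s tC2 x 0 \<in> rows x \<and> mem s tC1 x 0 \<noteq> mem s tC2 x 0 \<and>
        (if mem s tTYP x 0 = 0 then X x = Par (X (mem s tC1 x 0)) (X (mem s tC2 x 0))
         else X x = Ser (X (mem s tC1 x 0)) (X (mem s tC2 x 0)) \<and> mem s tTYP x 0 = sum sz (leaves (X (mem s tC2 x 0)))))"

definition children :: "astate \<Rightarrow> nat \<Rightarrow> nat set" where
  "children s x = {mem s tC1 x 0, mem s tC2 x 0}"

text \<open>The clauses on \<open>children\<close> and \<open>TID\<close> make each row either the
  root of one live module or the child of one node. The equation on \<open>card A + cur\<close>
  records that a contraction trades a representative for a new row, which keeps rows below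
  \<open>2 * n\<close>. Rows from \<open>cur\<close> on are zero, so each new table starts
  empty.\<close>

definition forest :: "nat set \<Rightarrow> (nat \<Rightarrow> nat set) \<Rightarrow> (nat \<Rightarrow> sp) \<Rightarrow> nat \<Rightarrow> astate \<Rightarrow> bool" where
  "forest A Mf X cur s \<longleftrightarrow> modules A Mf \<and> trees_ok X cur s \<and> n \<le> cur \<and>
     (\<forall>v<n. mem s tALIVE v 0 = (if v \<in> A then 1 else 0)) \<and>
     (\<forall>v\<in>relevant. mem s tTAU v 0 = tau v) \<and>
     (\<forall>v\<in>A. mem s tTID v 0 \<in> rows cur \<and> leaves (X (mem s tTID v 0)) = Mf v \<and> mem s tMS v 0 = sum sz (Mf v)) \<and>
     inj_on (\<lambda>v. mem s tTID v 0) A \<and>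
     (\<forall>x\<in>{n..<cur}. \<forall>y\<in>{n..<cur}. x \<noteq> y \<longrightarrow> children s x \<inter> children s y = {}) \<and>
     (\<forall>x\<in>{n..<cur}. \<forall>v\<in>A. mem s tTID v 0 \<notin> children s x) \<and>
     (\<forall>x\<in>rows cur. (\<exists>v\<in>A. x = mem s tTID v 0) \<or> (\<exists>y\<in>{n..<cur}. x \<in> children s y)) \<and>
     (\<forall>x\<ge>cur. \<forall>w\<le>c. mem s tT x w = 0) \<and>
     card A + cur = card relevant + n \<and> reg s rM = card A \<and> reg s rCur = cur"

definition keys_inv :: "nat \<Rightarrow> astate \<Rightarrow> bool" where
  "keys_inv m s \<longleftrightarrow> reg s rM = card (relevant \<inter> {..<m}) \<and>
     (\<forall>v. mem s tALIVE v 0 = (if v \<in> relevant \<and> v < m then 1 else 0)) \<and>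
     (\<forall>v\<in>relevant. v < m \<longrightarrow> mem s tTAU v 0 = tau v \<and> mem s tTID v 0 = v \<and> mem s tMS v 0 = sz v) \<and>
     (\<forall>v w. mem s tT v w = (if v \<in> relevant \<and> v < m \<and> (w = 0 \<or> w = sz v) then 1 else 0))"

lemma keys_inv_forest:
  assumes "keys_inv n s" shows "forest relevant (\<lambda>v. {v}) Leaf n (set_reg rCur n s)"
proof -
  have "relevant \<inter> {..<n} = relevant" using relevant_less by auto
  then show ?thesis using assms modules_init relevant_less
    by (auto simp: forest_def keys_inv_def trees_ok_def rows_def inj_on_def children_def)
qed

lemma keys_body_correct:
  assumes b: "base s" and v: "reg s rV = v" "v < n" and l: "lists_ok n s" and k: "keys_inv v s"
  shows "wp keys_body (keys_inv (Suc v)) s"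
proof -
  have row: "mem s tWT v 0 \<le> c + sum sz {..<n}" using l v(2) by (simp add: lists_ok_def list_row_def)
  then have wM: "mem s tWT v 0 < M" using less_M by simp
  show ?thesis
  proof (cases "v \<in> relevant")
    case False
    then have "c < mem s tWT v 0" using l v(2) by (simp add: lists_ok_def list_row_def)
    moreover have "relevant \<inter> {..<Suc v} = relevant \<inter> {..<v}" using False by (auto simp: less_Suc_eq)
    ultimately show ?thesis using b v k wM False
      by (auto simp: keys_body_def base_def keys_inv_def less_Suc_eq)
  next
    case True
    have w: "mem s tWT v 0 = weight v" by (rule lists_okD(1)[OF l True])
    have szc: "sz v \<le> c"
    proof -
      have "sum sz {v} \<le> weight v" unfolding weight_def by (intro sum_mono2) auto
      then show ?thesis using True by (simp add: relevant_def)
    qed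
    have card: "card (relevant \<inter> {..<Suc v}) = Suc (card (relevant \<inter> {..<v}))"
    proof -
      have "relevant \<inter> {..<Suc v} = insert v (relevant \<inter> {..<v})" using True by auto
      then show ?thesis by simp
    qed
    have "card (relevant \<inter> {..<v}) \<le> card {..<v}" by (intro card_mono) auto
    then have cM: "card (relevant \<inter> {..<v}) < n" using v(2) by simp
    have tM: "tau v < M" using tau_le_pos[of v] pos_bound(1)[OF True] M_bound by simp
    have "wp (Loop rK False tau_scan) (wp init_item (keys_inv (Suc v))) (set_reg rT 0 s)"
    proof (rule tau_scan_loop[of _ v], goal_cases)
      case (6 s')
      then have r: "reg s' 0 = n" "reg s' 1 = c + 1" "reg s' rV = v" "reg s' rM = card (relevant \<inter> {..<v})" "mem s' = mem s"
        using b v k by (auto simp: agree_def base_def keys_inv_def)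
      show ?case using r 6(2) v(2) szc tM cM k True
        by (auto simp: init_item_def keys_inv_def card set_cell_apply less_Suc_eq inp_length)
    qed (use b v l True in \<open>auto simp: lists_ok_def\<close>)
    then show ?thesis using w True b v wM by (auto simp: keys_body_def base_def relevant_def)
  qed
qed

lemma keys_correct:
  assumes b: "base s" and l: "lists_ok n s" and z: "\<And>v. mem s tALIVE v 0 = 0" "\<And>v w. mem s tT v w = 0"
  shows "wp keys (forest relevant (\<lambda>v. {v}) Leaf n) s"
proof -
  have "wp (Loop rV True keys_body) (wp (Set rCur bound_n) (forest relevant (\<lambda>v. {v}) Leaf n)) (set_reg rM 0 s)"
  proof (rule wp_Loop[where I = keys_inv], goal_cases)
    case 1
    then show ?case using z by (simp add: keys_inv_def)
  next
    case (2 v s2)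
    show ?case
    proof (rule keys_body_correct)
      show "base (set_reg rV v s2)" using agree_base[OF 2(3)] b by simp
      show "lists_ok n (set_reg rV v s2)" using lists_ok_agree[OF 2(3)] l by (simp add: lists_ok_def)
    qed (use 2 in \<open>auto simp: keys_inv_def\<close>)
  next
    case (3 s2)
    have "base s2" using agree_base[OF 3(2)] b by simp
    moreover have "keys_inv n (set_reg rV n s2)" using 3 by (simp add: keys_inv_def)
    ultimately show ?case using keys_inv_forest by (simp add: base_def)
  qed
  then show ?thesis by (simp add: keys_def)
qed

end

section \<open>Searching for twins\<close>

abbreviation (input) "rLev \<equiv> 23"

text \<open>A running maximum of keys with tie flag \<open>rG\<close>. \<open>rT\<close> stores the
  key plus one, so that 0 means that no candidate has been seen.\<close>

definition scan_item :: prog where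
  "scan_item =
     Cond (cell1 tALIVE (Rg rU))
       (Set rX (aadd (cell1 tTAU (Rg rU)) (Lit 1)) ;;
        Cond (alt (Rg rT) (Rg rX)) (Set rT (Rg rX) ;; Set rQ (Rg rU) ;; Set rG (Lit 0))
          (Cond (aeq (Rg rT) (Rg rX)) (Set rY (Rg rU) ;; Set rG (Lit 1)) Nop)) Nop"

definition scan_listed :: prog where
  "scan_listed =
     Cond (amul (alt (Lit 0) (Rg rK)) (alt (Rg rK) (cell1 tLEN (Rg rP))))
       (Set rU (Cell tL (Rg rP) (Rg rK)) ;; scan_item) Nop"

text \<open>\<open>weight p - sz p\<close> is the size of \<open>below p\<close>;
  \<open>weight q - sz q\<close> plus the module size is that of the module of \<open>q\<close>
  together with \<open>below q\<close>. Terms are moved across to avoid truncated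
  subtraction.\<close>

definition series_test :: aexp where
  "series_test = aeq (aadd (cell1 tWT (Rg rP)) (size_of (Rg rQ)))
     (aadd (aadd (cell1 tWT (Rg rQ)) (cell1 tMS (Rg rQ))) (size_of (Rg rP)))"

definition decide :: prog where
  "decide = Cond (Rg rG) (Set rF (Lit 1))
     (Cond series_test (Set rF (Lit 2) ;; Set rY (Rg rP)) (Set rP (Rg rQ)))"

text \<open>Once twins are found, \<open>rF\<close> is nonzero and the remaining rounds
  idle.\<close>

definition descend :: prog where
  "descend = Cond (Rg rF) Nop
     (Set rT (Lit 0) ;; Set rG (Lit 0) ;; Loop rK False scan_listed ;; decide)"

definition find_twins :: prog where
  "find_twins = Set rF (Lit 0) ;; Set rT (Lit 0) ;; Set rG (Lit 0) ;; Loop rU True scan_item ;;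
     Cond (Rg rG) (Set rF (Lit 1)) (Set rP (Rg rQ)) ;; Loop rLev False descend"

context ssg_machine
begin

lemma find_mods [simp]:
  "mods scan_item = {rX, rT, rQ, rG, rY}" "amods scan_item = {}"
  "mods scan_listed = {rU, rX, rT, rQ, rG, rY}" "amods scan_listed = {}"
  "mods decide = {rF, rY, rP}" "amods decide = {}"
  "mods descend = {rU, rX, rT, rQ, rG, rY, rK, rF, rP}" "amods descend = {}"
  "mods find_twins = {rU, rX, rT, rQ, rG, rY, rK, rF, rP, rLev}" "amods find_twins = {}"
  by (auto simp: scan_item_def scan_listed_def decide_def descend_def find_twins_def)

definition best_of :: "nat set \<Rightarrow> nat \<Rightarrow> nat \<Rightarrow> nat \<Rightarrow> bool" where
  "best_of C q y g \<longleftrightarrow> q \<in> C \<and> (\<forall>z\<in>C. tau z \<le> tau q) \<and>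
     (if g = 0 then \<forall>z\<in>C. tau z = tau q \<longrightarrow> z = q else y \<in> C \<and> y \<noteq> q \<and> tau y = tau q)"

definition scanned :: "nat set \<Rightarrow> astate \<Rightarrow> bool" where
  "scanned C s \<longleftrightarrow> reg s rG \<le> 1 \<and>
     (if C = {} then reg s rT = 0 \<and> reg s rG = 0
      else reg s rT = Suc (tau (reg s rQ)) \<and> best_of C (reg s rQ) (reg s rY) (reg s rG))"

lemma scan_item_correct:
  assumes b: "base s" and u: "reg s rU = u" "u < n" "u \<notin> C" and C: "C \<subseteq> A" and A: "A \<subseteq> relevant"
    and alive: "\<forall>v<n. mem s tALIVE v 0 = (if v \<in> A then 1 else 0)" and tau: "\<forall>v\<in>relevant. mem s tTAU v 0 = tau v"
    and sc: "scanned C s"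
  shows "wp scan_item (scanned (C \<union> ({u} \<inter> A))) s"
proof (cases "u \<in> A")
  case False
  then show ?thesis using assms by (simp add: scan_item_def)
next
  case True
  have tM: "Suc (tau v) < M" "tau v < M" if "v \<in> relevant" for v
    using tau_le_pos[of v] pos_bound(1)[OF that] M_bound by auto
  have tu: "mem s tTAU u 0 = tau u" "Suc (tau u) < M" "tau u < M" using True A tau tM by auto
  have "reg s rT < M"
  proof (cases "C = {}")
    case False
    then have "reg s rQ \<in> relevant" using sc C A by (auto simp: scanned_def best_of_def)
    then show ?thesis using sc False tM by (simp add: scanned_def)
  qed (use sc in \<open>simp add: scanned_def\<close>)
  note run = True tu this alive u(1,2)
  have Cu: "C \<union> ({u} \<inter> A) = insert u C" using True by auto
  have g: "reg s rG < M" using sc by (simp add: scanned_def)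
  show ?thesis
  proof (cases "C = {} \<or> tau (reg s rQ) < tau u")
    case t: True
    have "best_of (insert u C) u y 0" for y
      using t sc u(3) by (fastforce simp: scanned_def best_of_def split: if_splits)
    moreover have "reg s rT < Suc (tau u)" using t sc by (auto simp: scanned_def split: if_splits)
    ultimately show ?thesis using run by (simp add: scan_item_def Cu scanned_def)
  next
    case t: False
    then have best: "best_of C (reg s rQ) (reg s rY) (reg s rG)" "reg s rT = Suc (tau (reg s rQ))"
      using sc by (simp_all add: scanned_def)
    show ?thesis
    proof (cases "tau (reg s rQ) = tau u")
      case eq: True
      have "best_of (insert u C) (reg s rQ) u 1"
        using best(1) eq u(3) by (auto simp: best_of_def)
      then show ?thesis using run t eq best(2) by (simp add: scan_item_def Cu scanned_def)
    next
      case False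
      then have "best_of (insert u C) (reg s rQ) (reg s rY) (reg s rG)"
        using best(1) t by (auto simp: best_of_def)
      then show ?thesis using run t False best(2) sc by (simp add: scan_item_def Cu scanned_def)
    qed
  qed
qed

lemma scan_all:
  assumes b: "base s" and f: "forest A Mf X cur s" and z: "reg s rT = 0" "reg s rG = 0"
    and Q: "\<And>s'. agree {rU, rX, rT, rQ, rG, rY} {} s s' \<Longrightarrow> scanned A s' \<Longrightarrow> Q s'"
  shows "wp (Loop rU True scan_item) Q s"
proof -
  have A: "A \<subseteq> relevant" using f by (simp add: forest_def modules_def)
  show ?thesis
  proof (rule wp_Loop[where I = "\<lambda>k. scanned (A \<inter> {..<k})"], goal_cases)
    case 1
    then show ?case using z by (simp add: scanned_def)
  next
    case (2 u s2)
    have eq: "A \<inter> {..<u} \<union> ({u} \<inter> A) = A \<inter> {..<Suc u}" by (auto simp: less_Suc_eq)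
    have "mem s2 = mem s" using 2(3) by (auto simp: agree_def)
    then have "wp scan_item (scanned (A \<inter> {..<u} \<union> ({u} \<inter> A))) (set_reg rU u s2)"
      using f A 2(1,2) agree_base[OF 2(3) _ _ b] by (intro scan_item_correct) (auto simp: forest_def scanned_def)
    then show ?case by (simp add: eq)
  next
    case (3 s2)
    have "A \<inter> {..<n} = A" using A relevant_less by auto
    then show ?case using 3 by (intro Q) (auto simp: agree_def scanned_def)
  qed
qed

lemma scan_below:
  assumes b: "base s" and f: "forest A Mf X cur s" and l: "lists_ok n s" and p: "reg s rP = p" "p \<in> A"
    and z: "reg s rT = 0" "reg s rG = 0"
    and Q: "\<And>s'. agree {rK, rU, rX, rT, rQ, rG, rY} {} s s' \<Longrightarrow> scanned (candidates A (Some p)) s' \<Longrightarrow> Q s'"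
  shows "wp (Loop rK False scan_listed) Q s"
proof -
  have A: "A \<subseteq> relevant" using f by (simp add: forest_def modules_def)
  have pr: "p \<in> relevant" using A p by blast
  let ?d = "mem s tLEN p 0" and ?L = "mem s tL p"
  note lp = lists_okD[OF l pr]
  define C where "C k = A \<inter> ?L ` {j. 0 < j \<and> j < k \<and> j < ?d}" for k
  show ?thesis
  proof (rule wp_Loop[where I = "\<lambda>k. scanned (C k)"], goal_cases)
    case 1
    then show ?case using z by (simp add: scanned_def C_def)
  next
    case (2 k s2)
    have m: "mem s2 = mem s" "reg s2 rP = p" using 2(3) p by (auto simp: agree_def)
    have b2: "base s2" using agree_base[OF 2(3) _ _ b] by simp
    show ?case
    proof (cases "0 < k \<and> k < ?d")
      case False
      then have "C (Suc k) = C k" by (auto simp: C_def less_Suc_eq)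
      then show ?thesis using False m 2(1,2) b2 lp(3) relevant_less[OF pr]
        by (auto simp: scan_listed_def base_def scanned_def)
    next
      case True
      let ?u = "?L k"
      have u: "?u < n" by (rule listed_below(3)[OF l pr]) (use True in auto)
      have "?u \<notin> C k" using True lp(5) by (auto simp: C_def inj_on_def)
      then have "wp scan_item (scanned (C k \<union> ({?u} \<inter> A))) (set_reg rU ?u (set_reg rK k s2))"
        using f A 2(1,2) b2 u m by (intro scan_item_correct) (auto simp: forest_def scanned_def C_def)
      moreover have "{j. 0 < j \<and> j < Suc k \<and> j < ?d} = insert k {j. 0 < j \<and> j < k \<and> j < ?d}" using True by auto
      then have "C k \<union> ({?u} \<inter> A) = C (Suc k)" by (auto simp: C_def)
      ultimately show ?thesis using True m 2(1) b2 lp(3) relevant_less[OF pr] u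
        by (auto simp: scan_listed_def base_def)
    qed
  next
    case (3 s2)
    have "{j. 0 < j \<and> j < c + 1 \<and> j < ?d} = {1..<?d}" using lp(3) by auto
    then have "C (c + 1) = A \<inter> below p" using lp(7) by (simp add: C_def)
    also have "\<dots> = candidates A (Some p)" by (auto simp: candidates_def)
    finally have "C (c + 1) = candidates A (Some p)" .
    then show ?case using 3 by (intro Q) (auto simp: agree_def scanned_def)
  qed
qed

text \<open>In the series case \<open>rY\<close> is the upper element; in both cases
  \<open>rQ\<close> survives the contraction.\<close>

definition twins_found :: "nat set \<Rightarrow> (nat \<Rightarrow> nat set) \<Rightarrow> astate \<Rightarrow> bool" where
  "twins_found A Mf s \<longleftrightarrow>
     (reg s rF = 1 \<and> (\<exists>p. best_of (candidates A p) (reg s rQ) (reg s rY) 1)) \<or>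
     (reg s rF = 2 \<and> reg s rY \<in> A \<and> reg s rQ \<in> A \<and> (reg s rY, reg s rQ) \<in> E\<^sup>+ \<and> lonely A (Some (reg s rY)) \<and>
        below (reg s rY) = Mf (reg s rQ) \<union> below (reg s rQ))"

text \<open>The union is always contained in \<open>below p\<close>, so comparing sizes decides
  equality; minimality of the representative makes its two parts disjoint.\<close>

lemma series_test_iff:
  assumes m: "modules A Mf" and p: "p \<in> A" "q \<in> A" "(p, q) \<in> E\<^sup>+"
  shows "weight p + sz q = weight q + sum sz (Mf q) + sz p \<longleftrightarrow> below p = Mf q \<union> below q"
proof -
  have "Mf q \<union> below q \<subseteq> below p" using p(2,3) r_tr[OF p(3)] module_below[OF m p(1)] by auto
  moreover have "below p \<subseteq> {..<n}" by (rule below_subset)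
  ultimately have "below p = Mf q \<union> below q \<longleftrightarrow> sum sz (Mf q \<union> below q) = sum sz (below p)"
    using sum_sz_eq_imp_eq by metis
  moreover have "finite (Mf q)" using modulesD(7)[OF m p(2)] finite_relevant finite_subset by blast
  then have "sum sz (Mf q \<union> below q) = sum sz (Mf q) + sum sz (below q)"
    using modulesD(5)[OF m p(2)] by (intro sum.union_disjoint) auto
  moreover have "weight v = sz v + sum sz (below v)" for v by (simp add: weight_def)
  ultimately show ?thesis by auto
qed

lemma sum_relevant_le: "Y \<subseteq> relevant \<Longrightarrow> sum sz Y \<le> sum sz {..<n}"
  using relevant_less by (intro sum_mono2) auto

lemma decide_correct:
  assumes b: "base s" and f: "forest A Mf X cur s" and l: "lists_ok n s" and p: "reg s rP = p" "p \<in> A"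
    and ne: "below p \<noteq> {}" and sc: "scanned (candidates A (Some p)) s" and lp: "lonely A (Some p)" and F: "reg s rF = 0"
  shows "wp decide (\<lambda>s'. twins_found A Mf s' \<or>
     (reg s' rF = 0 \<and> reg s' rP \<in> A \<and> lonely A (Some (reg s' rP)) \<and> below (reg s' rP) \<noteq> {} \<and> weight (reg s' rP) < weight p)) s"
proof -
  have m: "modules A Mf" using f by (simp add: forest_def)
  let ?C = "candidates A (Some p)" and ?q = "reg s rQ"
  have C: "?C \<noteq> {}" using ne module_below[OF m p(2)] by (auto simp: candidates_def)
  then have best: "best_of ?C ?q (reg s rY) (reg s rG)" using sc by (auto simp: scanned_def)
  then have q: "?q \<in> A" "(p, ?q) \<in> E\<^sup>+" by (auto simp: best_of_def candidates_def)
  have rel: "p \<in> relevant" "?q \<in> relevant" using modulesD(1)[OF m] p q by auto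
  have w: "mem s tWT p 0 = weight p" "mem s tWT ?q 0 = weight ?q" "mem s tMS ?q 0 = sum sz (Mf ?q)"
    using lists_okD(1)[OF l] rel f q by (auto simp: forest_def)
  have le: "weight p \<le> c" "weight ?q \<le> c" "sum sz (Mf ?q) \<le> sum sz {..<n}" "sz p \<le> sum sz {..<n}" "sz ?q \<le> sum sz {..<n}"
    using rel sum_relevant_le[OF modulesD(7)[OF m q(1)]] sum_relevant_le[of "{p}"] sum_relevant_le[of "{?q}"]
    by (auto simp: relevant_def)
  have M: "weight p < M" "weight ?q < M" "sum sz (Mf ?q) < M" "weight p + sz ?q < M" "weight ?q + sum sz (Mf ?q) < M"
    "weight ?q + sum sz (Mf ?q) + sz p < M"
    using le by (auto intro!: less_M)
  have iff: "weight p + sz ?q = weight ?q + sum sz (Mf ?q) + sz p \<longleftrightarrow> below p = Mf ?q \<union> below ?q"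
    by (rule series_test_iff[OF m p(2) q])
  have less: "p < n" "?q < n" using rel relevant_less by auto
  have test: "alegal s series_test \<and> (aval s series_test \<noteq> 0 \<longleftrightarrow> below p = Mf ?q \<union> below ?q)"
    using less M w p(1) by (simp add: series_test_def inp_length iff)
  show ?thesis
  proof (cases "reg s rG = 0")
    case False
    then have "best_of ?C ?q (reg s rY) 1" using best by (simp add: best_of_def)
    then show ?thesis using False sc by (auto simp: decide_def twins_found_def scanned_def)
  next
    case True
    show ?thesis
    proof (cases "below p = Mf ?q \<union> below ?q")
      case ser: True
      then show ?thesis using True test p q lp less by (simp add: decide_def twins_found_def)
    next
      case False
      have uniq: "z = ?q" if "z \<in> ?C" "tau z = tau ?q" for z using best True that by (simp add: best_of_def)
      have max: "tau z \<le> tau ?q" if "z \<in> ?C" for z using best that by (simp add: best_of_def)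
      have "lonely A (Some ?q)"
      proof (rule lonely_step[OF m])
        show "?q \<in> ?C" using best by (simp add: best_of_def)
        show "p' \<in> A \<and> below p' \<noteq> Mf ?q \<union> below ?q" if "Some p = Some p'" for p' using that p False by simp
      qed (use uniq max in auto)
      \<comment> \<open>If nothing were below \<open>?q\<close>, its key would be 0 and it would be
        the only candidate; then \<open>below p\<close> would be its module and the series test
        would have succeeded.\<close>
      moreover have "below ?q \<noteq> {}"
      proof
        assume e: "below ?q = {}"
        then have "tau ?q = 0" by (simp add: tau_def)
        then have "?C = {?q}" using uniq max best by (force simp: best_of_def)
        then have "below p = Mf ?q" using module_below[OF m p(2)] by (simp add: candidates_def)
        then show False using False e by simp
      qed
      ultimately show ?thesis using True False test p q F less weight_mono[OF q(2)] by (simp add: decide_def)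
    qed
  qed
qed

lemma forest_agree:
  assumes "forest A Mf X cur s" "agree Z {} s s'" "rM \<notin> Z" "rCur \<notin> Z" shows "forest A Mf X cur s'"
proof -
  have "mem s' = mem s" "reg s' rM = reg s rM" "reg s' rCur = reg s rCur" using assms(2-4) by (auto simp: agree_def)
  then show ?thesis using assms(1) by (simp add: forest_def trees_ok_def children_def)
qed

text \<open>Each round without success lowers the weight, so the second alternative is impossible
  after \<open>c + 1\<close> rounds.\<close>

definition descending :: "nat set \<Rightarrow> (nat \<Rightarrow> nat set) \<Rightarrow> nat \<Rightarrow> astate \<Rightarrow> bool" where
  "descending A Mf k s \<longleftrightarrow> twins_found A Mf s \<or>
     (reg s rF = 0 \<and> reg s rP \<in> A \<and> lonely A (Some (reg s rP)) \<and> below (reg s rP) \<noteq> {} \<and> weight (reg s rP) + k \<le> c)"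

lemma descend_correct:
  assumes b: "base s" and f: "forest A Mf X cur s" and l: "lists_ok n s" and d: "descending A Mf k s"
  shows "wp descend (descending A Mf (Suc k)) s"
proof (cases "reg s rF = 0")
  case False
  then have "twins_found A Mf s" using d by (simp add: descending_def)
  then show ?thesis using False by (auto simp: descend_def descending_def twins_found_def)
next
  case True
  then have p: "reg s rP \<in> A" "lonely A (Some (reg s rP))" "below (reg s rP) \<noteq> {}" "weight (reg s rP) + k \<le> c"
    using d by (auto simp: descending_def twins_found_def)
  let ?s = "set_reg rG 0 (set_reg rT 0 s)"
  have "wp (Loop rK False scan_listed) (wp decide (descending A Mf (Suc k))) ?s"
  proof (rule scan_below)
    show "forest A Mf X cur ?s" by (rule forest_agree[OF f, of "{rG, rT}"]) (auto simp: agree_def)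
    fix s' assume ag: "agree {rK, rU, rX, rT, rQ, rG, rY} {} ?s s'" and sc: "scanned (candidates A (Some (reg s rP))) s'"
    have r: "reg s' rP = reg s rP" "reg s' rF = 0" "base s'" using ag True b by (auto simp: agree_def base_def)
    have ag': "agree {rK, rU, rX, rT, rQ, rG, rY} {} s s'" using ag by (auto simp: agree_def)
    show "wp decide (descending A Mf (Suc k)) s'"
      by (rule wp_mono[OF decide_correct[OF r(3) forest_agree[OF f ag'] lists_ok_agree[OF ag'] r(1)]])
        (use p sc r l in \<open>auto simp: descending_def\<close>)
  qed (use b l p in \<open>auto simp: lists_ok_def\<close>)
  then show ?thesis using True by (simp add: descend_def)
qed

lemma find_twins_correct:
  assumes b: "base s" and f: "forest A Mf X cur s" and l: "lists_ok n s" and A: "2 \<le> card A"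
  shows "wp find_twins (twins_found A Mf) s"
proof -
  have m: "modules A Mf" using f by (simp add: forest_def)
  have rel: "A \<subseteq> relevant" by (rule modulesD(1)[OF m])
  let ?s = "set_reg rG 0 (set_reg rT 0 (set_reg rF 0 s))"
  let ?test = "Cond (Rg rG) (Set rF (Lit 1)) (Set rP (Rg rQ))"
  have "wp (Loop rU True scan_item) (wp ?test (wp (Loop rLev False descend) (twins_found A Mf))) ?s"
  proof (rule scan_all)
    show "forest A Mf X cur ?s" by (rule forest_agree[OF f, of "{rG, rT, rF}"]) (auto simp: agree_def)
    fix s1 assume ag: "agree {rU, rX, rT, rQ, rG, rY} {} ?s s1" and sc: "scanned A s1"
    have ag1: "agree {rU, rX, rT, rQ, rG, rY, rF} {} s s1" and F: "reg s1 rF = 0" using ag by (auto simp: agree_def)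
    have ne: "A \<noteq> {}" using A by auto
    then have best: "best_of A (reg s1 rQ) (reg s1 rY) (reg s1 rG)" using sc by (simp add: scanned_def)
    have q: "reg s1 rQ < n" using best rel relevant_less by (auto simp: best_of_def)
    have loop: "wp (Loop rLev False descend) (twins_found A Mf) s2"
      if d: "descending A Mf 0 s2" and ag2: "agree {rU, rX, rT, rQ, rG, rY, rF, rP} {} s s2" for s2
    proof (rule wp_Loop[where I = "descending A Mf"], goal_cases)
      case (2 k s3)
      let ?s3 = "set_reg rLev k s3"
      have ag3: "agree {rU, rX, rT, rQ, rG, rY, rF, rP, rLev, rK} {} s ?s3"
        using ag2 2(3) by (auto simp: agree_def)
      show ?case
        by (rule descend_correct[OF agree_base[OF ag3 _ _ b] forest_agree[OF f ag3] lists_ok_agree[OF ag3]])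
          (use 2(2) l in \<open>auto simp: descending_def twins_found_def\<close>)
    qed (use d in \<open>auto simp: descending_def twins_found_def\<close>)
    show "wp ?test (wp (Loop rLev False descend) (twins_found A Mf)) s1"
    proof (cases "reg s1 rG = 0")
      case False
      then have "best_of (candidates A None) (reg s1 rQ) (reg s1 rY) 1" using best by (simp add: best_of_def candidates_def)
      then have "twins_found A Mf (set_reg rF 1 s1)" by (auto simp: twins_found_def)
      then have "wp (Loop rLev False descend) (twins_found A Mf) (set_reg rF 1 s1)"
        using ag1 by (intro loop) (auto simp: descending_def agree_def)
      then show ?thesis using False sc by (auto simp: scanned_def)
    next
      case True
      let ?q = "reg s1 rQ"
      have uniq: "z = ?q" if "z \<in> A" "tau z = tau ?q" for z using best True that by (simp add: best_of_def)
      have max: "tau z \<le> tau ?q" if "z \<in> A" for z using best that by (simp add: best_of_def)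
      have "lonely A (Some ?q)"
        by (rule lonely_step[OF m, where p = None]) (use best uniq max in \<open>auto simp: lonely_def candidates_def best_of_def\<close>)
      \<comment> \<open>A unique maximal key 0 would leave a single module, against
        \<open>2 \<le> card A\<close>.\<close>
      moreover have "below ?q \<noteq> {}"
      proof
        assume "below ?q = {}"
        then have "tau ?q = 0" by (simp add: tau_def)
        then have "A = {?q}" using uniq max best by (force simp: best_of_def)
        then have "card A = 1" by (metis card.empty card.insert empty_iff finite.emptyI One_nat_def)
        then show False using A by simp
      qed
      moreover have "?q \<in> A" using best by (simp add: best_of_def)
      moreover have "weight ?q \<le> c" using calculation(3) rel by (auto simp: relevant_def)
      ultimately have "wp (Loop rLev False descend) (twins_found A Mf) (set_reg rP ?q s1)"
        using ag1 F by (intro loop) (auto simp: descending_def agree_def)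
      then show ?thesis using True q by simp
    qed
  qed (use b in auto)
  then show ?thesis by (simp add: find_twins_def)
qed

end

section \<open>Contracting twins and filling tables\<close>

definition par_cell :: prog where
  "par_cell = Cond (amul (alt (aadd (Rg rI) (Rg rK)) bound_c) (Cell tT (Rg rB) (Rg rK)))
     (Put tT (Rg rCur) (aadd (Rg rI) (Rg rK)) (Lit 1)) Nop"

definition par_row :: prog where
  "par_row = Cond (Cell tT (Rg rA) (Rg rI)) (Loop rK False par_cell) Nop"

definition ser_row :: prog where
  "ser_row =
     Cond (Cell tT (Rg rB) (Rg rI)) (Put tT (Rg rCur) (Rg rI) (Lit 1)) Nop ;;
     Cond (amul (alt (aadd (Rg rI) (Rg rSB)) bound_c) (Cell tT (Rg rA) (Rg rI)))
       (Put tT (Rg rCur) (aadd (Rg rI) (Rg rSB)) (Lit 1)) Nop"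

definition fill_row :: prog where
  "fill_row = Set rA (cell1 tTID (Rg rY)) ;; Set rB (cell1 tTID (Rg rQ)) ;;
     Cond (aeq (Rg rF) (Lit 1)) (Set rSB (Lit 0) ;; Loop rI False par_row)
       (Set rSB (cell1 tMS (Rg rQ)) ;; Loop rI False ser_row)"

definition link :: prog where
  "link = put1 tC1 (Rg rCur) (Rg rA) ;; put1 tC2 (Rg rCur) (Rg rB) ;; put1 tTYP (Rg rCur) (Rg rSB) ;;
     put1 tTID (Rg rQ) (Rg rCur) ;; put1 tMS (Rg rQ) (aadd (cell1 tMS (Rg rQ)) (cell1 tMS (Rg rY))) ;;
     put1 tALIVE (Rg rY) (Lit 0) ;; Set rCur (aadd (Rg rCur) (Lit 1)) ;; Set rM (asub (Rg rM) (Lit 1))"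

definition reduce :: prog where
  "reduce = Cond (alt (Lit 1) (Rg rM)) (find_twins ;; fill_row ;; link) Nop"

context ssg_machine
begin

lemma merge_mods [simp]:
  "mods par_cell = {}" "amods par_cell = {tT}" "mods par_row = {rK}" "amods par_row = {tT}"
  "mods ser_row = {}" "amods ser_row = {tT}" "mods fill_row = {rA, rB, rSB, rI, rK}" "amods fill_row = {tT}"
  "mods link = {rCur, rM}" "amods link = {tC1, tC2, tTYP, tTID, tMS, tALIVE}"
  "mods reduce = {rU, rX, rT, rQ, rG, rY, rK, rF, rP, rLev, rA, rB, rSB, rI, rCur, rM}"
  "amods reduce = {tT, tC1, tC2, tTYP, tTID, tMS, tALIVE}"
  by (auto simp: par_cell_def par_row_def ser_row_def fill_row_def link_def reduce_def)

definition marks :: "nat \<Rightarrow> (nat \<Rightarrow> bool) \<Rightarrow> astate \<Rightarrow> astate \<Rightarrow> bool" where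
  "marks cur P s s' \<longleftrightarrow> (\<forall>w\<le>c. mem s' tT cur w = (if P w then 1 else 0)) \<and>
     (\<forall>x. x \<noteq> cur \<longrightarrow> mem s' tT x = mem s tT x)"

definition row_ok :: "nat \<Rightarrow> astate \<Rightarrow> bool" where
  "row_ok x s \<longleftrightarrow> x \<le> 2 * n \<and> (\<forall>w\<le>c. mem s tT x w \<le> 1)"

lemma par_rows:
  assumes b: "base s" and a: "reg s rA = a" "row_ok a s" "a \<noteq> cur" and b': "reg s rB = b" "row_ok b s" "b \<noteq> cur"
    and cur: "reg s rCur = cur" "cur \<le> 2 * n" and z: "\<forall>w\<le>c. mem s tT cur w = 0"
    and Q: "\<And>s'. agree {rI, rK} {tT} s s' \<Longrightarrow>
       marks cur (\<lambda>w. \<exists>i k. mem s tT a i \<noteq> 0 \<and> mem s tT b k \<noteq> 0 \<and> w = i + k) s s' \<Longrightarrow> Q s'"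
  shows "wp (Loop rI False par_row) Q s"
proof -
  let ?a = "mem s tT a" and ?b = "mem s tT b"
  define P where "P m w \<longleftrightarrow> (\<exists>i<m. \<exists>k. ?a i \<noteq> 0 \<and> ?b k \<noteq> 0 \<and> w = i + k)" for m w
  show ?thesis
  proof (rule wp_Loop[where I = "\<lambda>i. marks cur (P i) s"], goal_cases)
    case 1
    then show ?case using z by (simp add: marks_def P_def)
  next
    case (2 i s1)
    let ?s1 = "set_reg rI i s1"
    have i: "i \<le> c" using 2(1) by simp
    have r1: "reg s1 rA = a" "reg s1 0 = n" "reg s1 1 = c + 1" "mem s1 tT a = ?a"
      using 2(2,3) a b by (auto simp: agree_def base_def marks_def)
    show ?case
    proof (cases "?a i = 0")
      case True
      then have "P (Suc i) = P i" by (auto simp: P_def less_Suc_eq fun_eq_iff)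
      then show ?thesis using True r1 2(2) i a(2) by (simp add: par_row_def marks_def row_ok_def)
    next
      case False
      define P' where "P' m w \<longleftrightarrow> P i w \<or> (\<exists>k<m. ?b k \<noteq> 0 \<and> w = i + k)" for m w
      have "wp (Loop rK False par_cell) (marks cur (P (Suc i)) s) ?s1"
      proof (rule wp_Loop[where I = "\<lambda>k. marks cur (P' k) s"], goal_cases)
        case 1
        then show ?case using 2(2) by (simp add: marks_def P'_def)
      next
        case (2 k s2)
        have k: "k \<le> c" using 2(1) by simp
        have r2: "reg s2 rI = i" "reg s2 rB = b" "reg s2 rCur = cur" "reg s2 0 = n" "reg s2 1 = c + 1" "mem s2 tT b = ?b"
          using 2(2,3) \<open>agree _ _ s s1\<close> b' cur b by (auto simp: agree_def base_def marks_def)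
        have bk: "?b k \<le> 1" and bM: "b \<le> 2 * n" using b'(2) k by (simp_all add: row_ok_def)
        have ikM: "i + k < M" "cur < M" "?b k < M" using i k cur(2) bk by (auto intro!: less_M)
        show ?case
        proof (cases "i + k \<le> c \<and> ?b k \<noteq> 0")
          case True
          have "P' (Suc k) w \<longleftrightarrow> w = i + k \<or> P' k w" for w using True by (auto simp: P'_def less_Suc_eq)
          then show ?thesis using True r2 2(2) i k ikM bM b'(3) cur(2)
            by (auto simp: par_cell_def marks_def set_cell_def)
        next
          case False
          then have "P' (Suc k) w \<longleftrightarrow> P' k w" if "w \<le> c" for w using that by (auto simp: P'_def less_Suc_eq)
          then show ?thesis using False r2 2(2) i k ikM bM
            by (auto simp: par_cell_def marks_def)
        qed
      next
        case (3 s2)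
        have "P' (c + 1) w \<longleftrightarrow> P (Suc i) w" if "w \<le> c" for w
          using that False by (auto simp: P'_def P_def less_Suc_eq)
        then show ?case using 3(1) by (simp add: marks_def)
      qed
      moreover have "?a i \<le> 1" using a(2) i by (simp add: row_ok_def)
      then have "?a i < M" by (intro less_M) simp
      ultimately show ?thesis using False r1 i a(2) by (simp add: par_row_def row_ok_def)
    qed
  next
    case (3 s1)
    \<comment> \<open>A summand of \<open>w \<le> c\<close> is itself at most \<open>c\<close>, so
      the scan misses nothing.\<close>
    have "P (c + 1) w \<longleftrightarrow> (\<exists>i k. ?a i \<noteq> 0 \<and> ?b k \<noteq> 0 \<and> w = i + k)" if "w \<le> c" for w
      using that by (auto simp: P_def) (metis le_add1 le_imp_less_Suc le_trans)
    then show ?case using 3 by (intro Q) (auto simp: marks_def agree_def)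
  qed
qed

lemma ser_rows:
  assumes b: "base s" and a: "reg s rA = a" "row_ok a s" "a \<noteq> cur" and b': "reg s rB = b" "row_ok b s" "b \<noteq> cur"
    and cur: "reg s rCur = cur" "cur \<le> 2 * n" and z: "\<forall>w\<le>c. mem s tT cur w = 0"
    and d: "reg s rSB = d" "d \<le> sum sz {..<n}"
    and Q: "\<And>s'. agree {rI} {tT} s s' \<Longrightarrow>
       marks cur (\<lambda>w. mem s tT b w \<noteq> 0 \<or> (\<exists>i. mem s tT a i \<noteq> 0 \<and> w = i + d)) s s' \<Longrightarrow> Q s'"
  shows "wp (Loop rI False ser_row) Q s"
proof -
  let ?a = "mem s tT a" and ?b = "mem s tT b"
  define P where "P m w \<longleftrightarrow> (w < m \<and> ?b w \<noteq> 0) \<or> (\<exists>i<m. ?a i \<noteq> 0 \<and> w = i + d)" for m w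
  show ?thesis
  proof (rule wp_Loop[where I = "\<lambda>i. marks cur (P i) s"], goal_cases)
    case 1
    then show ?case using z by (simp add: marks_def P_def)
  next
    case (2 i s1)
    have i: "i \<le> c" using 2(1) by simp
    have r1: "reg s1 rA = a" "reg s1 rB = b" "reg s1 rCur = cur" "reg s1 rSB = d" "reg s1 0 = n" "reg s1 1 = c + 1"
      "mem s1 tT a = ?a" "mem s1 tT b = ?b"
      using 2(2,3) a b b' cur d by (auto simp: agree_def base_def marks_def)
    have le: "?a i \<le> 1" "?b i \<le> 1" using a(2) b'(2) i by (auto simp: row_ok_def)
    have idM: "i + d < M" "d < M" "cur < M" "?a i < M" "?b i < M" using i d(2) cur(2) le by (auto intro!: less_M)
    have P: "P (Suc i) w \<longleftrightarrow> P i w \<or> (w = i \<and> ?b i \<noteq> 0) \<or> (w = i + d \<and> ?a i \<noteq> 0)" for w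
      by (auto simp: P_def less_Suc_eq)
    have rows: "a \<le> 2 * n" "b \<le> 2 * n" using a b' by (simp_all add: row_ok_def)
    note m = 2(2)[unfolded marks_def]
    show ?case
    proof (cases "?b i = 0"; cases "i + d \<le> c \<and> ?a i \<noteq> 0")
    qed (use m r1 idM i a(3) b'(3) cur(2) rows in \<open>simp_all add: ser_row_def marks_def P set_cell_apply set_cell_def less_Suc_eq_le\<close>)
  next
    case (3 s1)
    have "P (c + 1) w \<longleftrightarrow> ?b w \<noteq> 0 \<or> (\<exists>i. ?a i \<noteq> 0 \<and> w = i + d)" if "w \<le> c" for w
      using that by (auto simp: P_def)
    then show ?case using 3 by (intro Q) (auto simp: marks_def agree_def)
  qed
qed

lemma rows_le: "x \<in> rows cur \<Longrightarrow> x < cur \<or> x < n"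
  by (auto simp: rows_def relevant_def)

lemma forest_bounds:
  assumes f: "forest A Mf X cur s"
  shows "finite A" "card A \<le> n" "n \<le> cur" "A \<noteq> {} \<Longrightarrow> cur < 2 * n" "x \<in> rows cur \<Longrightarrow> x < cur"
    "x \<in> rows cur \<Longrightarrow> A \<noteq> {} \<Longrightarrow> row_ok x s"
proof -
  have A: "A \<subseteq> relevant" using f by (auto simp: forest_def modules_def)
  then show fin: "finite A" using finite_relevant finite_subset by blast
  have "card relevant \<le> card {..<n}" using relevant_less by (intro card_mono) auto
  then have r: "card relevant \<le> n" by simp
  then show "card A \<le> n" using card_mono[OF finite_relevant A] by simp
  show n: "n \<le> cur" using f by (simp add: forest_def)
  show c: "cur < 2 * n" if "A \<noteq> {}"
  proof -
    have "0 < card A" using that fin by (simp add: card_gt_0_iff)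
    then show ?thesis using f r by (simp add: forest_def)
  qed
  show x: "x < cur" if "x \<in> rows cur" for x using rows_le[OF that] n by auto
  show "row_ok x s" if "x \<in> rows cur" "A \<noteq> {}"
    using f that x[OF that(1)] c by (auto simp: row_ok_def forest_def trees_ok_def)
qed

text \<open>\<open>k\<close> is the code in \<open>rF\<close>; the first tree belongs to
  \<open>rY\<close>, the upper element of a series pair.\<close>

definition join :: "nat \<Rightarrow> sp \<Rightarrow> sp \<Rightarrow> sp" where
  "join k a b = (if k = 1 then Par a b else Ser a b)"

text \<open>Both kinds of twins lead to the same bookkeeping: \<open>q\<close> absorbs the module of
  \<open>y\<close>.\<close>

lemma twins_merge:
  assumes f: "forest A Mf X cur s" and t: "twins_found A Mf s"
  defines "q \<equiv> reg s rQ" and "y \<equiv> reg s rY"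
  shows "q \<in> A" "y \<in> A" "q \<noteq> y" "modules (A - {y}) (Mf(q := Mf q \<union> Mf y))"
    "ordered (join (reg s rF) (X (mem s tTID y 0)) (X (mem s tTID q 0)))"
proof -
  have m: "modules A Mf" and tr: "trees_ok X cur s" using f by (auto simp: forest_def)
  have tid: "mem s tTID v 0 \<in> rows cur" "leaves (X (mem s tTID v 0)) = Mf v" "ordered (X (mem s tTID v 0))" if "v \<in> A" for v
    using f that by (auto simp: forest_def trees_ok_def)
  have "q \<in> A \<and> y \<in> A \<and> q \<noteq> y \<and> modules (A - {y}) (Mf(q := Mf q \<union> Mf y)) \<and>
    (if reg s rF = 1 then \<forall>x\<in>Mf y. \<forall>z\<in>Mf q. (x, z) \<notin> E\<^sup>+ \<and> (z, x) \<notin> E\<^sup>+ else \<forall>x\<in>Mf y. \<forall>z\<in>Mf q. (x, z) \<in> E\<^sup>+)"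
  proof (cases "reg s rF = 1")
    case True
    then obtain p where best: "best_of (candidates A p) q y 1" using t by (auto simp: twins_found_def q_def y_def)
    then have c: "q \<in> candidates A p" "y \<in> candidates A p" "q \<noteq> y" "tau q = tau y" by (auto simp: best_of_def)
    have max: "tau z \<le> tau q" if "z \<in> candidates A p" for z using best that by (simp add: best_of_def)
    have "q \<in> A" "y \<in> A" using c by (auto simp: candidates_def split: option.splits)
    then show ?thesis using merge_parallel[OF m c max] c(3) True by auto
  next
    case False
    then have c: "lonely A (Some y)" "y \<in> A" "q \<in> A" "(y, q) \<in> E\<^sup>+" "below y = Mf q \<union> below q"
      using t by (auto simp: twins_found_def q_def y_def)
    then show ?thesis using merge_series[OF m c] False by auto
  qed
  moreover have "Mf y \<inter> Mf q = {}" if "q \<in> A" "y \<in> A" "q \<noteq> y" using modulesD(3)[OF m] that by blast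
  ultimately show "q \<in> A" "y \<in> A" "q \<noteq> y" "modules (A - {y}) (Mf(q := Mf q \<union> Mf y))"
    "ordered (join (reg s rF) (X (mem s tTID y 0)) (X (mem s tTID q 0)))"
    using tid by (auto simp: join_def split: if_splits)
qed

lemma fill_row_correct:
  assumes b: "base s" and f: "forest A Mf X cur s" and t: "twins_found A Mf s"
  defines "q \<equiv> reg s rQ" and "y \<equiv> reg s rY"
  defines "a \<equiv> mem s tTID y 0" and "b' \<equiv> mem s tTID q 0"
  shows "wp fill_row (\<lambda>s'. marks cur (\<lambda>w. w \<in> totals (join (reg s rF) (X a) (X b'))) s s' \<and>
     reg s' rA = a \<and> reg s' rB = b' \<and> reg s' rSB = (if reg s rF = 1 then 0 else mem s tMS q 0)) s"
proof -
  note tm = twins_merge[OF f t, folded q_def y_def]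
  have A: "A \<noteq> {}" using tm by auto
  have ab: "a \<in> rows cur" "b' \<in> rows cur" "leaves (X b') = Mf q" "mem s tMS q 0 = sum sz (Mf q)"
    using f tm by (auto simp: forest_def a_def b'_def)
  note fb = forest_bounds[OF f]
  have ro: "row_ok a s" "row_ok b' s" using fb(6) ab A by auto
  have lt: "a < cur" "b' < cur" "cur < 2 * n" using fb(4,5) ab A by auto
  have z: "\<forall>w\<le>c. mem s tT cur w = 0" using f by (simp add: forest_def)
  have T: "mem s tT x w \<noteq> 0 \<longleftrightarrow> w \<in> totals (X x)" if "x \<in> rows cur" "w \<le> c" for x w
    using f that by (simp add: forest_def trees_ok_def)
  have rel: "q \<in> relevant" "y \<in> relevant" using modulesD(1) f tm unfolding forest_def by blast+
  have less: "q < n" "y < n" using rel relevant_less by auto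
  have ms: "mem s tMS q 0 \<le> sum sz {..<n}"
    using ab(4) sum_relevant_le modulesD(7) f tm(1) unfolding forest_def by metis
  have M: "a < M" "b' < M" "mem s tMS q 0 < M" using lt ms by (auto intro!: less_M)
  have F: "reg s rF < M" using t by (auto simp: twins_found_def)
  let ?s = "set_reg rB b' (set_reg rA a s)"
  show ?thesis
  proof (cases "reg s rF = 1")
    case True
    have "wp (Loop rI False par_row) (\<lambda>s'. marks cur (\<lambda>w. w \<in> totals (join (reg s rF) (X a) (X b'))) s s' \<and>
       reg s' rA = a \<and> reg s' rB = b' \<and> reg s' rSB = 0) (set_reg rSB 0 ?s)"
    proof (rule par_rows[where a = a and b = b' and cur = cur])
      fix s' assume ag: "agree {rI, rK} {tT} (set_reg rSB 0 ?s) s'"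
        and m: "marks cur (\<lambda>w. \<exists>i k. mem (set_reg rSB 0 ?s) tT a i \<noteq> 0 \<and> mem (set_reg rSB 0 ?s) tT b' k \<noteq> 0 \<and> w = i + k) (set_reg rSB 0 ?s) s'"
      have "(\<exists>i k. mem s tT a i \<noteq> 0 \<and> mem s tT b' k \<noteq> 0 \<and> w = i + k) \<longleftrightarrow> w \<in> totals (Par (X a) (X b'))" if "w \<le> c" for w
      proof -
        have "(\<exists>i k. mem s tT a i \<noteq> 0 \<and> mem s tT b' k \<noteq> 0 \<and> w = i + k) \<longleftrightarrow>
          (\<exists>i k. i \<in> totals (X a) \<and> k \<in> totals (X b') \<and> w = i + k)"
          using that T[OF ab(1)] T[OF ab(2)] by (metis le_add1 le_add2 le_trans)
        then show ?thesis by auto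
      qed
      then show "marks cur (\<lambda>w. w \<in> totals (join (reg s rF) (X a) (X b'))) s s' \<and> reg s' rA = a \<and> reg s' rB = b' \<and> reg s' rSB = 0"
        using m ag True by (auto simp: marks_def join_def agree_def)
    qed (use b ro lt z f in \<open>auto simp: row_ok_def forest_def\<close>)
    then show ?thesis using True less M F by (simp add: fill_row_def a_def b'_def q_def y_def)
  next
    case False
    let ?d = "mem s tMS q 0"
    have "wp (Loop rI False ser_row) (\<lambda>s'. marks cur (\<lambda>w. w \<in> totals (join (reg s rF) (X a) (X b'))) s s' \<and>
       reg s' rA = a \<and> reg s' rB = b' \<and> reg s' rSB = ?d) (set_reg rSB ?d ?s)"
    proof (rule ser_rows[where a = a and b = b' and cur = cur and d = ?d])
      fix s' assume ag: "agree {rI} {tT} (set_reg rSB ?d ?s) s'"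
        and m: "marks cur (\<lambda>w. mem (set_reg rSB ?d ?s) tT b' w \<noteq> 0 \<or> (\<exists>i. mem (set_reg rSB ?d ?s) tT a i \<noteq> 0 \<and> w = i + ?d)) (set_reg rSB ?d ?s) s'"
      have "(mem s tT b' w \<noteq> 0 \<or> (\<exists>i. mem s tT a i \<noteq> 0 \<and> w = i + ?d)) \<longleftrightarrow> w \<in> totals (Ser (X a) (X b'))" if "w \<le> c" for w
      proof -
        have "(\<exists>i. mem s tT a i \<noteq> 0 \<and> w = i + ?d) \<longleftrightarrow> (\<exists>i. i \<in> totals (X a) \<and> w = i + ?d)"
          using that T[OF ab(1)] by (metis le_add1 le_trans)
        then show ?thesis using T[OF ab(2) that] ab(3,4) by auto
      qed
      then show "marks cur (\<lambda>w. w \<in> totals (join (reg s rF) (X a) (X b'))) s s' \<and> reg s' rA = a \<and> reg s' rB = b' \<and> reg s' rSB = ?d"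
        using m ag False by (auto simp: marks_def join_def agree_def)
    qed (use b ro lt z f ms in \<open>auto simp: row_ok_def forest_def\<close>)
    then show ?thesis using False less M F by (simp add: fill_row_def a_def b'_def q_def y_def)
  qed
qed

text \<open>The assumptions from \<open>T\<close> on describe the memory after the new row is filled
  and linked, so that the invariant is proved apart from the execution.\<close>

lemma forest_merge:
  assumes f: "forest A Mf X cur s" and qy: "q \<in> A" "y \<in> A" "q \<noteq> y"
    and m': "modules (A - {y}) (Mf(q := Mf q \<union> Mf y))" and k: "k = 1 \<or> k = 2"
  defines "a \<equiv> mem s tTID y 0" and "b \<equiv> mem s tTID q 0"
  assumes o: "ordered (join k (X a) (X b))"
    and T: "marks cur (\<lambda>w. w \<in> totals (join k (X a) (X b))) s s'"
    and C1: "\<And>x. mem s' tC1 x 0 = (if x = cur then a else mem s tC1 x 0)"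
    and C2: "\<And>x. mem s' tC2 x 0 = (if x = cur then b else mem s tC2 x 0)"
    and TYP: "\<And>x. mem s' tTYP x 0 = (if x = cur then if k = 1 then 0 else mem s tMS q 0 else mem s tTYP x 0)"
    and TID: "\<And>v. mem s' tTID v 0 = (if v = q then cur else mem s tTID v 0)"
    and MS: "\<And>v. mem s' tMS v 0 = (if v = q then mem s tMS q 0 + mem s tMS y 0 else mem s tMS v 0)"
    and ALIVE: "\<And>v. mem s' tALIVE v 0 = (if v = y then 0 else mem s tALIVE v 0)"
    and TAU: "mem s' tTAU = mem s tTAU" and r: "reg s' rM = card A - 1" "reg s' rCur = Suc cur"
  shows "forest (A - {y}) (Mf(q := Mf q \<union> Mf y)) (X(cur := join k (X a) (X b))) (Suc cur) s'"
proof -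
  let ?t = "join k (X a) (X b)" and ?X = "X(cur := join k (X a) (X b))"
  have m: "modules A Mf" and tr: "trees_ok X cur s" using f by (auto simp: forest_def)
  note fb = forest_bounds[OF f]
  have tid: "mem s tTID v 0 \<in> rows cur" "leaves (X (mem s tTID v 0)) = Mf v" "mem s tMS v 0 = sum sz (Mf v)" if "v \<in> A" for v
    using f that by (auto simp: forest_def)
  have inj: "v = v'" if "v \<in> A" "v' \<in> A" "mem s tTID v 0 = mem s tTID v' 0" for v v'
    using f that by (auto simp: forest_def inj_on_def)
  have ab: "a \<in> rows cur" "b \<in> rows cur" "a < cur" "b < cur" "leaves (X a) = Mf y" "leaves (X b) = Mf q" "a \<noteq> b"
    using tid[OF qy(1)] tid[OF qy(2)] fb(5) inj[OF qy(1,2)] qy(3) by (auto simp: a_def b_def)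
  have rows: "rows (Suc cur) = insert cur (rows cur)" using fb(3) by (auto simp: rows_def)
  have cur_notin: "cur \<notin> rows cur" "cur \<notin> relevant" using fb(3,5) relevant_less[of cur] by auto
  have child_lt: "children s x \<subseteq> rows cur" if "x \<in> {n..<cur}" for x
    using tr that by (auto simp: trees_ok_def children_def rows_def)
  have children: "children s' x = (if x = cur then {a, b} else children s x)" for x
    by (simp add: children_def C1 C2)
  have lt: "leaves ?t = Mf q \<union> Mf y" using ab by (auto simp: join_def)
  have sumM: "sum sz (Mf q \<union> Mf y) = sum sz (Mf q) + sum sz (Mf y)"
    using modulesD(3)[OF m qy] modulesD(7)[OF m qy(1)] modulesD(7)[OF m qy(2)] finite_subset[OF _ finite_relevant]
    by (intro sum.union_disjoint) auto
  have "trees_ok ?X (Suc cur) s'"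
    unfolding trees_ok_def
  proof (intro conjI ballI)
    fix x assume "x \<in> rows (Suc cur)"
    then consider "x = cur" | "x \<in> rows cur" "x \<noteq> cur" using rows cur_notin by auto
    then have "ordered (?X x) \<and> leaves (?X x) \<subseteq> relevant \<and> (\<forall>w\<le>c. mem s' tT x w \<le> 1 \<and> (mem s' tT x w \<noteq> 0 \<longleftrightarrow> w \<in> totals (?X x)))"
    proof cases
      case 1
      then show ?thesis using o T lt modulesD(7)[OF m qy(1)] modulesD(7)[OF m qy(2)] by (auto simp: marks_def)
    next
      case 2
      then show ?thesis using tr T by (simp add: trees_ok_def marks_def)
    qed
    then show "ordered (?X x)" "leaves (?X x) \<subseteq> relevant" "\<forall>w\<le>c. mem s' tT x w \<le> 1 \<and> (mem s' tT x w \<noteq> 0 \<longleftrightarrow> w \<in> totals (?X x))"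
      by blast+
  next
    fix x assume "x \<in> relevant"
    then show "?X x = Leaf x" using tr cur_notin by (auto simp: trees_ok_def)
  next
    fix x assume "x \<in> {n..<Suc cur}"
    then consider "x = cur" | "x \<in> {n..<cur}" by fastforce
    then have "mem s' tC1 x 0 \<in> rows x \<and> mem s' tC2 x 0 \<in> rows x \<and> mem s' tC1 x 0 \<noteq> mem s' tC2 x 0 \<and>
        (if mem s' tTYP x 0 = 0 then ?X x = Par (?X (mem s' tC1 x 0)) (?X (mem s' tC2 x 0))
         else ?X x = Ser (?X (mem s' tC1 x 0)) (?X (mem s' tC2 x 0)) \<and> mem s' tTYP x 0 = sum sz (leaves (?X (mem s' tC2 x 0))))"
    proof cases
      case 1
      \<comment> \<open>Without a nonzero \<open>TYP\<close>, the new series node would be taken for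
        a parallel one.\<close>
      have "0 < sum sz (Mf q)"
      proof -
        have "q \<in> Mf q" "Mf q \<subseteq> relevant" using modulesD(4,7)[OF m qy(1)] by auto
        then show ?thesis using sz_pos relevant_less finite_subset[OF _ finite_relevant]
          by (metis bot_nat_0.not_eq_extremum sum_eq_0_iff subsetD less_irrefl)
      qed
      then show ?thesis using 1 k ab C1 C2 TYP tid(3)[OF qy(1)] by (auto simp: join_def)
    next
      case 2
      have c: "mem s tC1 x 0 \<in> rows x" "mem s tC2 x 0 \<in> rows x" using tr 2 by (auto simp: trees_ok_def)
      then have "mem s tC1 x 0 \<noteq> cur" "mem s tC2 x 0 \<noteq> cur" using child_lt[OF 2] cur_notin by (auto simp: children_def)
      then show ?thesis using 2 c tr by (simp add: C1 C2 TYP trees_ok_def)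
    qed
    then show "mem s' tC1 x 0 \<in> rows x" "mem s' tC2 x 0 \<in> rows x" "mem s' tC1 x 0 \<noteq> mem s' tC2 x 0"
      "if mem s' tTYP x 0 = 0 then ?X x = Par (?X (mem s' tC1 x 0)) (?X (mem s' tC2 x 0))
         else ?X x = Ser (?X (mem s' tC1 x 0)) (?X (mem s' tC2 x 0)) \<and> mem s' tTYP x 0 = sum sz (leaves (?X (mem s' tC2 x 0)))"
      by blast+
  qed
  moreover have "\<forall>v\<in>A - {y}. mem s' tTID v 0 \<in> rows (Suc cur) \<and> leaves (?X (mem s' tTID v 0)) = (Mf(q := Mf q \<union> Mf y)) v \<and>
      mem s' tMS v 0 = sum sz ((Mf(q := Mf q \<union> Mf y)) v)"
  proof
    fix v assume v: "v \<in> A - {y}"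
    then have "mem s tTID v 0 \<noteq> cur" using tid(1) cur_notin by fastforce
    then show "mem s' tTID v 0 \<in> rows (Suc cur) \<and> leaves (?X (mem s' tTID v 0)) = (Mf(q := Mf q \<union> Mf y)) v \<and>
      mem s' tMS v 0 = sum sz ((Mf(q := Mf q \<union> Mf y)) v)"
      using v tid[of v] tid[OF qy(1)] tid[OF qy(2)] lt sumM by (simp add: rows TID MS)
  qed
  moreover have "inj_on (\<lambda>v. mem s' tTID v 0) (A - {y})"
  proof (rule inj_onI)
    fix v v' assume "v \<in> A - {y}" "v' \<in> A - {y}" "mem s' tTID v 0 = mem s' tTID v' 0"
    then show "v = v'" using inj[of v v'] tid(1)[of v] tid(1)[of v'] cur_notin by (auto simp: TID split: if_splits)
  qed
  moreover have "\<forall>x\<in>{n..<Suc cur}. \<forall>x'\<in>{n..<Suc cur}. x \<noteq> x' \<longrightarrow> children s' x \<inter> children s' x' = {}"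
  proof -
    have "children s x \<inter> {a, b} = {}" if "x \<in> {n..<cur}" for x
      using f that qy by (auto simp: forest_def a_def b_def)
    moreover have "children s x \<inter> children s x' = {}" if "x \<in> {n..<cur}" "x' \<in> {n..<cur}" "x \<noteq> x'" for x x'
      using f that by (simp add: forest_def)
    ultimately have "children s' x \<inter> children s' x' = {}"
      if "x \<in> {n..<Suc cur}" "x' \<in> {n..<Suc cur}" "x \<noteq> x'" for x x'
      using that by (cases "x = cur"; cases "x' = cur") (simp_all add: children Int_commute)
    then show ?thesis by blast
  qed
  moreover have "\<forall>x\<in>{n..<Suc cur}. \<forall>v\<in>A - {y}. mem s' tTID v 0 \<notin> children s' x"
  proof (intro ballI)
    fix x v assume x: "x \<in> {n..<Suc cur}" and v: "v \<in> A - {y}"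
    show "mem s' tTID v 0 \<notin> children s' x"
    proof (cases "v = q")
      case True
      then show ?thesis using x ab(3,4) child_lt[of x] cur_notin by (auto simp: TID children)
    next
      case False
      then have "mem s tTID v 0 \<notin> {a, b}" using v inj qy unfolding a_def b_def by blast
      moreover have "mem s tTID v 0 \<notin> children s x" if "x \<noteq> cur" using f that x v by (simp add: forest_def)
      ultimately show ?thesis using False by (simp add: TID children)
    qed
  qed
  moreover have "\<forall>x\<in>rows (Suc cur). (\<exists>v\<in>A - {y}. x = mem s' tTID v 0) \<or> (\<exists>x'\<in>{n..<Suc cur}. x \<in> children s' x')"
  proof
    fix x assume "x \<in> rows (Suc cur)"
    then consider "x = cur" | "x \<in> rows cur" "x \<noteq> cur" using rows cur_notin by auto
    then show "(\<exists>v\<in>A - {y}. x = mem s' tTID v 0) \<or> (\<exists>x'\<in>{n..<Suc cur}. x \<in> children s' x')"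
    proof cases
      case 1
      then show ?thesis using qy by (intro disjI1 bexI[of _ q]) (simp_all add: TID)
    next
      case 2
      then consider v where "v \<in> A" "x = mem s tTID v 0" | x' where "x' \<in> {n..<cur}" "x \<in> children s x'"
        using f by (auto simp: forest_def)
      then show ?thesis
      proof cases
        case (1 v)
        then have "v = q \<or> v = y \<or> (v \<in> A - {y} \<and> x = mem s' tTID v 0)" using qy by (auto simp: TID)
        moreover have "x \<in> children s' cur" if "v = q \<or> v = y" using that 1 by (auto simp: children a_def b_def)
        ultimately show ?thesis using fb(3) by (metis atLeastLessThan_iff lessI)
      next
        case (2 x')
        then show ?thesis by (intro disjI2 bexI[of _ x']) (auto simp: children)
      qed
    qed
  qed
  moreover have "\<forall>x\<ge>Suc cur. \<forall>w\<le>c. mem s' tT x w = 0" using f T by (simp add: forest_def marks_def)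
  moreover have "card (A - {y}) = card A - 1" "0 < card A" using qy fb(1) by (auto simp: card_gt_0_iff)
  moreover have "card A + cur = card relevant + n" using f by (simp add: forest_def)
  moreover have "\<forall>v<n. mem s' tALIVE v 0 = (if v \<in> A - {y} then 1 else 0)" using f by (simp add: forest_def ALIVE)
  moreover have "\<forall>v\<in>relevant. mem s' tTAU v 0 = tau v" using f by (simp add: forest_def TAU)
  ultimately show ?thesis unfolding forest_def using m' r fb(3) by simp
qed

end

abbreviation (input) "rStep \<equiv> 22"

text \<open>There are at most \<open>n\<close> modules, so \<open>n\<close> rounds suffice; those
  after the last contraction idle.\<close>

definition reduce_all :: prog where
  "reduce_all = Loop rStep True reduce"

context ssg_machine
begin

lemma link_correct:
  assumes b: "base s" and f: "forest A Mf X cur s" and t: "twins_found A Mf s" and m: "marks cur (\<lambda>w. w \<in> totals (join (reg s rF)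
      (X (mem s tTID (reg s rY) 0)) (X (mem s tTID (reg s rQ) 0)))) s s1"
    and ag: "agree {rA, rB, rSB, rI, rK} {tT} s s1"
    and ab: "reg s1 rA = mem s tTID (reg s rY) 0" "reg s1 rB = mem s tTID (reg s rQ) 0"
      "reg s1 rSB = (if reg s rF = 1 then 0 else mem s tMS (reg s rQ) 0)"
  shows "wp link (\<lambda>s'. \<exists>Mf' X'. forest (A - {reg s rY}) Mf' X' (Suc cur) s') s1"
proof -
  define q where "q = reg s rQ"
  define y where "y = reg s rY"
  define a where "a = mem s tTID y 0"
  define b' where "b' = mem s tTID q 0"
  note tm = twins_merge[OF f t, folded q_def y_def]
  have A: "A \<noteq> {}" using tm by auto
  note fb = forest_bounds[OF f]
  have r: "reg s1 0 = n" "reg s1 rQ = q" "reg s1 rY = y" "reg s1 rCur = cur" "reg s1 rM = card A"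
    "\<And>t. t \<noteq> tT \<Longrightarrow> mem s1 t = mem s t"
    using ag b f by (auto simp: agree_def base_def q_def y_def forest_def)
  have k: "reg s rF = 1 \<or> reg s rF = 2" using t by (auto simp: twins_found_def)
  have rel: "q \<in> relevant" "y \<in> relevant" using modulesD(1) f tm unfolding forest_def by blast+
  have less: "q < n" "y < n" using rel relevant_less by auto
  have ms: "mem s tMS q 0 \<le> sum sz {..<n}" "mem s tMS y 0 \<le> sum sz {..<n}"
    using f tm sum_relevant_le modulesD(7) unfolding forest_def by metis+
  have lt: "a < cur" "b' < cur" "cur < 2 * n" using fb(4,5) f tm A unfolding a_def b'_def forest_def by auto
  have M: "a < M" "b' < M" "cur < M" "mem s tMS q 0 < M" "mem s tMS y 0 < M" "card A < M" "card A - 1 < M"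
    "mem s tMS q 0 + mem s tMS y 0 < M" "Suc cur < M"
    using lt ms fb(2) by (auto intro!: less_M)
  define s' where "s' = set_reg rM (card A - 1) (set_reg rCur (Suc cur) (set_cell tALIVE y 0 0
     (set_cell tMS q 0 (mem s tMS q 0 + mem s tMS y 0) (set_cell tTID q 0 cur
     (set_cell tTYP cur 0 (reg s1 rSB) (set_cell tC2 cur 0 b' (set_cell tC1 cur 0 a s1)))))))"
  have "reg s1 rSB < M" using ab(3) M by (simp add: q_def)
  then have run: "wp link Q s1 \<longleftrightarrow> Q s'" for Q
    using r ab M lt less unfolding s'_def by (simp add: link_def a_def b'_def q_def y_def)
  have "forest (A - {y}) (Mf(q := Mf q \<union> Mf y)) (X(cur := join (reg s rF) (X a) (X b'))) (Suc cur) s'"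
    unfolding a_def b'_def
    by (rule forest_merge[OF f tm(1-4) k tm(5)])
      (use m r ab in \<open>simp_all add: s'_def marks_def a_def b'_def q_def y_def set_cell_apply\<close>)
  then show ?thesis unfolding run y_def by blast
qed

lemma reduce_correct:
  assumes b: "base s" and f: "forest A Mf X cur s" and l: "lists_ok n s"
  shows "wp reduce (\<lambda>s'. \<exists>A' Mf' X' cur'. forest A' Mf' X' cur' s' \<and> (card A \<le> 1 \<and> card A' = card A \<or> Suc (card A') = card A)) s" (is "wp _ ?R _")
proof (cases "2 \<le> card A")
  case False
  have M: "reg s rM < M" using f forest_bounds(2)[OF f] by (auto simp: forest_def intro!: less_M)
  have "reg s rM = card A" using f by (simp add: forest_def)
  then show ?thesis using False f M by (auto simp: reduce_def)
next
  case True
  have M: "reg s rM < M" using f forest_bounds(2)[OF f] by (auto simp: forest_def intro!: less_M)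
  have rM: "reg s rM = card A" using f by (simp add: forest_def)
  have "wp find_twins (wp fill_row (wp link ?R)) s"
  proof (rule wp_mono[OF find_twins_correct[OF b f l True]])
    fix s1 assume t: "twins_found A Mf s1" and "agree (mods find_twins) (amods find_twins) s s1"
    then have ag: "agree {rU, rX, rT, rQ, rG, rY, rK, rF, rP, rLev} {} s s1" by simp
    have b1: "base s1" using agree_base[OF ag _ _ b] by simp
    have f1: "forest A Mf X cur s1" using forest_agree[OF f ag] by simp
    show "wp fill_row (wp link ?R) s1"
    proof (rule wp_mono[OF fill_row_correct[OF b1 f1 t]], elim conjE)
      fix s2
      assume *: "marks cur (\<lambda>w. w \<in> totals (join (reg s1 rF) (X (mem s1 tTID (reg s1 rY) 0)) (X (mem s1 tTID (reg s1 rQ) 0)))) s1 s2"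
        "reg s2 rA = mem s1 tTID (reg s1 rY) 0" "reg s2 rB = mem s1 tTID (reg s1 rQ) 0"
        "reg s2 rSB = (if reg s1 rF = 1 then 0 else mem s1 tMS (reg s1 rQ) 0)"
        and "agree (mods fill_row) (amods fill_row) s1 s2"
      then have ag2: "agree {rA, rB, rSB, rI, rK} {tT} s1 s2" by simp
      have "reg s1 rY \<in> A" by (rule twins_merge(2)[OF f1 t])
      then have "Suc (card (A - {reg s1 rY})) = card A" using forest_bounds(1)[OF f] by (simp add: card_gt_0_iff) (metis card_gt_0_iff empty_iff Suc_pred)
      then show "wp link ?R s2"
        by (intro wp_mono[OF link_correct[OF b1 f1 t *(1) ag2 *(2-4)]]) blast
    qed
  qed
  then show ?thesis using True M rM by (simp add: reduce_def)
qed

lemma reduce_all_correct: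
  assumes b: "base s" and f: "forest relevant (\<lambda>v. {v}) Leaf n s" and l: "lists_ok n s"
  shows "wp reduce_all (\<lambda>s'. \<exists>A Mf X cur. forest A Mf X cur s' \<and> card A \<le> 1) s"
  unfolding reduce_all_def
proof (rule wp_Loop[where I = "\<lambda>k s'. \<exists>A Mf X cur. forest A Mf X cur s' \<and> (card A \<le> 1 \<or> card A + k \<le> n)"], goal_cases)
  case 1
  then show ?case using f forest_bounds(2)[OF f] by force
next
  case (2 k s1)
  then obtain A Mf X cur where 1: "forest A Mf X cur s1" "card A \<le> 1 \<or> card A + k \<le> n" by blast
  have f1: "forest A Mf X cur (set_reg rStep k s1)" by (rule forest_agree[OF 1(1), of "{rStep}"]) (auto simp: agree_def)
  have b1: "base (set_reg rStep k s1)" using agree_base[OF 2(3) _ _ b] by simp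
  have l1: "lists_ok n (set_reg rStep k s1)" using lists_ok_agree[OF 2(3)] l by (simp add: lists_ok_def)
  show ?case
  proof (rule wp_mono[OF reduce_correct[OF b1 f1 l1]], elim exE conjE)
    fix s' A' Mf' X' cur'
    assume "forest A' Mf' X' cur' s'" "card A \<le> 1 \<and> card A' = card A \<or> Suc (card A') = card A"
    then show "\<exists>A Mf X cur. forest A Mf X cur s' \<and> (card A \<le> 1 \<or> card A + Suc k \<le> n)" using 1(2)
      by (intro exI[of _ A'] exI[of _ Mf'] exI[of _ X'] exI[of _ cur']) auto
  qed
next
  case (3 s1)
  then obtain A Mf X cur where 1: "forest A Mf X cur s1" "card A \<le> 1 \<or> card A + n \<le> n" by auto
  have "forest A Mf X cur (set_reg rStep n s1)" by (rule forest_agree[OF 1(1), of "{rStep}"]) (auto simp: agree_def)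
  moreover have "card A \<le> 1" using 1(2) by auto
  ultimately show ?case by auto
qed

end

section \<open>Reading a solution from the root\<close>

abbreviation (input) "rBest \<equiv> 21"

definition find_root :: prog where
  "find_root = Set rRow bound_n ;; Loop rU True (Cond (cell1 tALIVE (Rg rU)) (Set rRow (cell1 tTID (Rg rU))) Nop)"

definition find_best :: prog where
  "find_best = Set rBest (Lit 0) ;; Loop rI False (Cond (Cell tT (Rg rRow) (Rg rI)) (Set rBest (Rg rI)) Nop) ;;
     put1 tWANT (Rg rRow) (Rg rBest)"

text \<open>The outer test keeps the truncated subtraction exact.\<close>

definition par_search :: prog where
  "par_search = Cond (alt (Rg rI) (aadd (Rg rW) (Lit 1)))
     (Cond (amul (Cell tT (Rg rA) (Rg rI)) (Cell tT (Rg rB) (asub (Rg rW) (Rg rI)))) (Set rX (Rg rI)) Nop) Nop"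

text \<open>Rows are visited from \<open>cur - 1\<close> downwards, so a parent is split before its
  children. At a series node, a total attainable in the lower child is taken there alone; otherwise
  the lower child is taken completely.\<close>

definition split_row :: prog where
  "split_row = Cond (alt (aadd bound_n (Rg rStep)) (Rg rCur))
     (Set rRow (asub (asub (Rg rCur) (Lit 1)) (Rg rStep)) ;;
      Set rW (cell1 tWANT (Rg rRow)) ;; Set rA (cell1 tC1 (Rg rRow)) ;; Set rB (cell1 tC2 (Rg rRow)) ;;
      Set rSB (cell1 tTYP (Rg rRow)) ;;
      Cond (Rg rSB)
        (Cond (Cell tT (Rg rB) (Rg rW))
           (put1 tWANT (Rg rB) (Rg rW) ;; put1 tWANT (Rg rA) (Lit 0))
           (put1 tWANT (Rg rB) (Rg rSB) ;; put1 tWANT (Rg rA) (asub (Rg rW) (Rg rSB))))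
        (Set rX (Lit 0) ;; Loop rI False par_search ;;
         put1 tWANT (Rg rA) (Rg rX) ;; put1 tWANT (Rg rB) (asub (Rg rW) (Rg rX)))) Nop"

text \<open>A leaf ends up with 0 or its positive size, so the wanted totals already form a
  characteristic vector.\<close>

definition write_output :: prog where
  "write_output = Loop rU True (Out (Rg rU) (cell1 tWANT (Rg rU)))"

definition read_solution :: prog where
  "read_solution = find_root ;; find_best ;; Loop rStep True split_row ;; write_output"

context ssg_machine
begin

lemma read_solution_mods [simp]:
  "mods find_root = {rRow, rU}" "amods find_root = {}" "mods find_best = {rBest, rI}" "amods find_best = {tWANT}"
  "mods par_search = {rX}" "amods par_search = {}"
  "mods split_row = {rRow, rW, rA, rB, rSB, rX, rI}" "amods split_row = {tWANT}"
  "mods write_output = {rU}" "amods write_output = {0}"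
  by (auto simp: find_root_def find_best_def par_search_def split_row_def write_output_def)

lemma rows_less: "z \<in> rows x \<Longrightarrow> n \<le> x \<Longrightarrow> z < x"
  using relevant_less[of z] by (auto simp: rows_def)

text \<open>\<open>want\<close> has been propagated from the root \<open>f\<close> to the children of all rows from \<open>lo\<close> on.\<close>

definition split_ok :: "(nat \<Rightarrow> sp) \<Rightarrow> astate \<Rightarrow> (nat \<Rightarrow> nat) \<Rightarrow> nat \<Rightarrow> bool" where
  "split_ok X s want x \<longleftrightarrow> (if mem s tTYP x 0 = 0
     then split_Par (X (mem s tC1 x 0)) (X (mem s tC2 x 0)) (want x) (want (mem s tC1 x 0)) (want (mem s tC2 x 0))
     else split_Ser (X (mem s tC1 x 0)) (X (mem s tC2 x 0)) (want x) (want (mem s tC1 x 0)) (want (mem s tC2 x 0)))"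

definition wants :: "(nat \<Rightarrow> sp) \<Rightarrow> nat \<Rightarrow> nat \<Rightarrow> nat \<Rightarrow> astate \<Rightarrow> nat \<Rightarrow> (nat \<Rightarrow> nat) \<Rightarrow> bool" where
  "wants X cur f t s lo want \<longleftrightarrow> (\<forall>x\<in>{lo..<cur}. split_ok X s want x) \<and>
     (\<forall>x\<in>rows cur. x = f \<or> (\<exists>y\<in>{lo..<cur}. x \<in> children s y) \<longrightarrow> want x \<in> totals (X x) \<and> want x \<le> c) \<and>
     (\<forall>x<n. x \<notin> relevant \<longrightarrow> want x = 0) \<and> want f = t"

text \<open>The update at \<open>a\<close> and \<open>b\<close> disturbs nothing that holds already:
  child sets of different rows are disjoint, children precede their parents, and the root is
  nobody's child.\<close>

lemma wants_step:
  assumes f: "forest A Mf X cur s" and A: "A = {v}" "mem s tTID v 0 = f"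
    and w: "wants X cur f t s (Suc x) want" and x: "x \<in> {n..<cur}"
  defines "a \<equiv> mem s tC1 x 0" and "b \<equiv> mem s tC2 x 0"
  shows "want x \<in> totals (X x)" "want x \<le> c" "a \<in> rows cur" "b \<in> rows cur" "a < x" "b < x" "a \<noteq> b"
    and "split_ok X s (want(a := wa, b := wb)) x \<Longrightarrow> wants X cur f t s x (want(a := wa, b := wb))"
proof -
  have tr: "trees_ok X cur s" using f by (simp add: forest_def)
  have xr: "x \<in> rows cur" using x by (simp add: rows_def)
  have ab: "a \<in> rows x" "b \<in> rows x" "a \<noteq> b" using tr x by (auto simp: trees_ok_def a_def b_def)
  then show abr: "a \<in> rows cur" "b \<in> rows cur" "a \<noteq> b" using x by (auto simp: rows_def)
  show lt: "a < x" "b < x" using ab x rows_less by auto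
  have child_lt: "z < y" if "y \<in> {n..<cur}" "z \<in> children s y" for y z
  proof -
    have "z \<in> rows y" using tr that by (auto simp: trees_ok_def children_def)
    then show ?thesis using that relevant_less[of z] by (auto simp: rows_def)
  qed
  have "x = f \<or> (\<exists>y\<in>{n..<cur}. x \<in> children s y)" using f xr A by (auto simp: forest_def)
  then have "x = f \<or> (\<exists>y\<in>{Suc x..<cur}. x \<in> children s y)" using child_lt x by fastforce
  then show wx: "want x \<in> totals (X x)" "want x \<le> c" using w xr by (auto simp: wants_def)
  let ?w = "want(a := wa, b := wb)"
  assume sp: "split_ok X s ?w x"
  have cx: "children s x = {a, b}" by (simp add: children_def a_def b_def)
  have same: "?w z = want z" if "z \<notin> {a, b}" for z using that by simp
  have "split_ok X s ?w y" if y: "y \<in> {Suc x..<cur}" for y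
  proof -
    have "children s y \<inter> children s x = {}" using f x y by (auto simp: forest_def)
    then have "mem s tC1 y 0 \<notin> {a, b}" "mem s tC2 y 0 \<notin> {a, b}" unfolding cx by (auto simp: children_def)
    moreover have "y \<notin> {a, b}" using lt y by auto
    moreover have "split_ok X s want y" using w y by (simp add: wants_def)
    ultimately show ?thesis unfolding split_ok_def using same by metis
  qed
  moreover have "{x..<cur} = insert x {Suc x..<cur}" using x by auto
  ultimately have 1: "\<forall>y\<in>{x..<cur}. split_ok X s ?w y" using sp by simp
  have 2: "?w z \<in> totals (X z) \<and> ?w z \<le> c" if z: "z \<in> rows cur" "z = f \<or> (\<exists>y\<in>{x..<cur}. z \<in> children s y)" for z
  proof (cases "z \<in> {a, b}")
    case True
    have "?w a \<in> totals (X a) \<and> ?w b \<in> totals (X b) \<and> want x = ?w a + ?w b"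
      using sp lt by (auto simp: split_ok_def split_Par_def split_Ser_def a_def[symmetric] b_def[symmetric] split: if_splits)
    then show ?thesis using True wx(2) by auto
  next
    case False
    then have "z = f \<or> (\<exists>y\<in>{Suc x..<cur}. z \<in> children s y)" using z(2) cx
      unfolding \<open>{x..<cur} = insert x {Suc x..<cur}\<close> by auto
    then have "want z \<in> totals (X z) \<and> want z \<le> c" using w z(1) unfolding wants_def by blast
    then show ?thesis using same[OF False] by simp
  qed
  have 3: "?w z = 0" if "z < n" "z \<notin> relevant" for z
  proof -
    have "z \<notin> rows cur" using that by (auto simp: rows_def)
    then have "z \<notin> {a, b}" using abr by auto
    then show ?thesis using same w that by (simp add: wants_def)
  qed
  have "f \<notin> children s x" using f x A by (auto simp: forest_def)
  then have 4: "?w f = t" using same[of f] w cx by (simp add: wants_def)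
  show "wants X cur f t s x ?w" unfolding wants_def using 1 2 3 4 by blast
qed

text \<open>By induction on row numbers, the leaves of row \<open>x\<close> with nonzero
  \<open>want\<close> form a closed set of size exactly \<open>want x\<close>.\<close>

lemma wants_final:
  assumes f: "forest A Mf X cur s" and A: "A = {v}" "mem s tTID v 0 = f"
    and w: "wants X cur f t s n want"
  shows "closed_in relevant {u. u < n \<and> want u \<noteq> 0}" "sum sz {u. u < n \<and> want u \<noteq> 0} = want f"
proof -
  have tr: "trees_ok X cur s" using f by (simp add: forest_def)
  have pend: "want x \<in> totals (X x)" if "x \<in> rows cur" for x
    using f w that A by (auto simp: forest_def wants_def)
  define sel where "sel x = {u \<in> leaves (X x). want u \<noteq> 0}" for x
  have "x \<in> rows cur \<Longrightarrow> closed_in (leaves (X x)) (sel x) \<and> sum sz (sel x) = want x" for x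
  proof (induction x rule: less_induct)
    case (less x)
    show ?case
    proof (cases "x \<in> relevant")
      case True
      then have X: "X x = Leaf x" using tr by (simp add: trees_ok_def)
      have "want x \<in> {0, sz x}" using pend[OF less.prems] X by simp
      moreover have "sel x = (if want x = 0 then {} else {x})" by (auto simp: sel_def X)
      ultimately show ?thesis by (auto simp: X closed_in_def)
    next
      case False
      then have x: "x \<in> {n..<cur}" using less.prems by (simp add: rows_def)
      define a where "a = mem s tC1 x 0"
      define b where "b = mem s tC2 x 0"
      have ab: "a \<in> rows x" "b \<in> rows x"
        "if mem s tTYP x 0 = 0 then X x = Par (X a) (X b) else X x = Ser (X a) (X b)"
        using tr x by (auto simp: trees_ok_def a_def b_def split: if_splits)
      have lt: "a < x" "b < x" using ab x rows_less by auto
      have "a \<in> rows cur" "b \<in> rows cur" using ab x by (auto simp: rows_def)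
      note IH = less.IH[OF lt(1) this(1)] less.IH[OF lt(2) this(2)]
      have o: "ordered (X x)" using tr less.prems by (simp add: trees_ok_def)
      have sp: "split_ok X s want x" using w x by (simp add: wants_def)
      have sel: "sel x = sel a \<union> sel b" using ab(3) by (auto simp: sel_def split: if_splits)
      show ?thesis
      proof (cases "mem s tTYP x 0 = 0")
        case True
        then show ?thesis unfolding sel using ab(3) o sp IH
          by (simp add: split_ok_def a_def[symmetric] b_def[symmetric] del: leaves.simps ordered.simps)
            (intro closed_in_split_Par[of "X a" "X b" "want x" "want a" "want b"], auto)
      next
        case False
        then show ?thesis unfolding sel using ab(3) o sp IH
          by (simp add: split_ok_def a_def[symmetric] b_def[symmetric] del: leaves.simps ordered.simps)
            (intro closed_in_split_Ser[of "X a" "X b" "want x" "want a" "want b"], auto)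
      qed
    qed
  qed
  moreover have fr: "f \<in> rows cur" "leaves (X f) = Mf v" using f A by (auto simp: forest_def)
  moreover have "Mf v = relevant" using f A modulesD(2)[of A Mf] by (simp add: forest_def)
  moreover have "sel f = {u. u < n \<and> want u \<noteq> 0}"
    using fr \<open>Mf v = relevant\<close> w relevant_less by (auto simp: sel_def wants_def)
  ultimately show "closed_in relevant {u. u < n \<and> want u \<noteq> 0}" "sum sz {u. u < n \<and> want u \<noteq> 0} = want f"
    by metis+
qed

text \<open>The search keeps the last index that works; which one is irrelevant.\<close>

lemma par_search_loop:
  assumes b: "base s" and r: "reg s rW = w" "reg s rA = a" "reg s rB = b" "w \<le> c" "row_ok a s" "row_ok b s" "reg s rX = 0"
    and ex: "i0 \<le> w" "mem s tT a i0 \<noteq> 0" "mem s tT b (w - i0) \<noteq> 0"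
    and Q: "\<And>s' i. agree {rX, rI} {} s s' \<Longrightarrow> reg s' rX = i \<Longrightarrow> i \<le> w \<Longrightarrow> mem s tT a i \<noteq> 0 \<Longrightarrow> mem s tT b (w - i) \<noteq> 0 \<Longrightarrow> Q s'"
  shows "wp (Loop rI False par_search) Q s"
proof -
  define P where "P i \<longleftrightarrow> i \<le> w \<and> mem s tT a i \<noteq> 0 \<and> mem s tT b (w - i) \<noteq> 0" for i
  show ?thesis
  proof (rule wp_Loop[where I = "\<lambda>k s'. (\<exists>i<k. P i) \<longrightarrow> P (reg s' rX)"], goal_cases)
    case (2 k s1)
    have k: "k \<le> c" using 2(1) by simp
    have r1: "reg s1 rW = w" "reg s1 rA = a" "reg s1 rB = b" "mem s1 = mem s" "reg s1 0 = n" "reg s1 1 = c + 1"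
      using 2(3) r b by (auto simp: agree_def base_def)
    have M: "w < M" "Suc w < M" "k < M" "w - k < M" using r(4) k by (auto intro!: less_M)
    have T: "mem s tT a k \<le> 1" using r(5) k by (simp add: row_ok_def)
    have T': "mem s tT b (w - k) \<le> 1" using r(4,6) by (simp add: row_ok_def)
    have TT: "mem s tT a k * mem s tT b (w - k) \<le> 1" using mult_le_mono[OF T T'] by simp
    have TM: "mem s tT a k < M" "mem s tT b (w - k) < M" "mem s tT a k * mem s tT b (w - k) < M"
      using T T' TT by (auto intro!: less_M)
    have ab: "a \<le> 2 * n" "b \<le> 2 * n" using r by (auto simp: row_ok_def)
    show ?case
    proof (cases "P k")
      case True
      then show ?thesis using r1 M TM ab k r(4) by (simp add: par_search_def P_def)
    next
      case False
      then have "(\<exists>i<Suc k. P i) \<longleftrightarrow> (\<exists>i<k. P i)" by (auto simp: less_Suc_eq)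
      then have I: "(\<exists>i<Suc k. P i) \<longrightarrow> P (reg s1 rX)" using 2(2) by simp
      show ?thesis
      proof (cases "k \<le> w")
        case True
        then have "mem s tT a k = 0 \<or> mem s tT b (w - k) = 0" using False by (simp add: P_def)
        then show ?thesis using True I r1 M TM ab k r(4) by (simp add: par_search_def)
      next
        case False
        then show ?thesis using I r1 M by (simp add: par_search_def)
      qed
    qed
  next
    case (3 s1)
    have "P i0" "i0 < c + 1" using ex r(4) by (auto simp: P_def)
    then have "P (reg s1 rX)" using 3(1) by auto
    then show ?case using 3(2) by (intro Q[of _ "reg s1 rX"]) (auto simp: P_def agree_def)
  qed simp
qed

definition want_of :: "astate \<Rightarrow> nat \<Rightarrow> nat" where
  "want_of s x = mem s tWANT x 0"

lemma want_of_set [simp]: "want_of (set_cell tWANT x 0 w s) = (want_of s)(x := w)"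
  "want_of (set_reg r k s) = want_of s"
  by (auto simp: want_of_def fun_eq_iff)

text \<open>\<open>max n\<close> accounts for the idle rounds, in which all inner rows are already
  split.\<close>

lemma split_row_correct:
  assumes b: "base s1" and f: "forest A Mf X cur s" and A: "A = {v}" "mem s tTID v 0 = f"
    and s1: "mem s1 tT = mem s tT" "mem s1 tC1 = mem s tC1" "mem s1 tC2 = mem s tC2" "mem s1 tTYP = mem s tTYP"
      "reg s1 rCur = cur" "reg s1 rStep = k" "k < n"
    and w: "wants X cur f t s (max n (cur - k)) (want_of s1)"
  shows "wp split_row (\<lambda>s'. wants X cur f t s (max n (cur - Suc k)) (want_of s')) s1"
proof -
  note fb = forest_bounds[OF f]
  have cur: "cur < 2 * n" "n \<le> cur" using fb(3,4) A by auto
  have M: "cur < M" "cur - 1 < M" using cur by (auto intro!: less_M)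
  have base: "reg s1 0 = n" "reg s1 1 = c + 1" using b by (auto simp: base_def)
  show ?thesis
  proof (cases "n + k < cur")
    case False
    then have eq: "max n (cur - k) = n" "max n (cur - Suc k) = n" by auto
    have "n + k < M" using s1(7) by (intro less_M) simp
    then show ?thesis using False w base s1 M unfolding eq by (simp add: split_row_def)
  next
    case True
    define x where "x = cur - 1 - k"
    have x: "x \<in> {n..<cur}" "max n (cur - k) = Suc x" "max n (cur - Suc k) = x" using True by (auto simp: x_def)
    define a where "a = mem s tC1 x 0"
    define b' where "b' = mem s tC2 x 0"
    define wx where "wx = want_of s1 x"
    note ws = wants_step[OF f A w[unfolded x(2)] x(1), folded a_def b'_def wx_def]
    have tr: "trees_ok X cur s" using f by (simp add: forest_def)
    have Xx: "if mem s tTYP x 0 = 0 then X x = Par (X a) (X b')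
       else X x = Ser (X a) (X b') \<and> mem s tTYP x 0 = sum sz (leaves (X b'))"
      using tr x(1) unfolding trees_ok_def a_def b'_def by blast
    have T: "mem s tT y i \<noteq> 0 \<longleftrightarrow> i \<in> totals (X y)" if "y \<in> rows cur" "i \<le> c" for y i
      using tr that by (simp add: trees_ok_def)
    have ro: "row_ok a s" "row_ok b' s" using fb(6) ws(3,4) A by auto
    have ab2: "a \<le> 2 * n" "b' \<le> 2 * n" using ro by (auto simp: row_ok_def)
    have "leaves (X b') \<subseteq> relevant" using tr ws(4) by (simp add: trees_ok_def)
    then have d: "mem s tTYP x 0 \<le> sum sz {..<n}" using Xx sum_relevant_le by (auto split: if_splits)
    have Ms: "n + k < M" "x < M" "wx < M" "a < M" "b' < M" "mem s tTYP x 0 < M"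
      "mem s tT b' wx < M" "x \<le> 2 * n" "k < M" "wx - mem s tTYP x 0 < M"
      using True cur x(1) ws(2) ab2 d ro(2) by (auto simp: row_ok_def intro!: less_M)
    have xs: "cur - Suc k = x" "cur - Suc (Suc k) = x - 1" "mem s tC1 x 0 = a" "mem s tC2 x 0 = b'" by (simp_all add: x_def a_def b'_def)
    have mx: "mem s1 tWANT x 0 = wx" by (simp add: wx_def want_of_def)
    let ?s = "set_reg rSB (mem s tTYP x 0) (set_reg rB b' (set_reg rA a (set_reg rW wx (set_reg rRow x s1))))"
    let ?Q = "\<lambda>s'. wants X cur f t s x (want_of s')"
    show ?thesis
    proof (cases "mem s tTYP x 0 = 0")
      case par: True
      then have XP: "X x = Par (X a) (X b')" using Xx by simp
      obtain i0 j0 where i0: "i0 \<in> totals (X a)" "j0 \<in> totals (X b')" "wx = i0 + j0" using ws(1) XP by auto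
      have "wp (Loop rI False par_search) (wp (put1 tWANT (Rg rA) (Rg rX) ;; put1 tWANT (Rg rB) (asub (Rg rW) (Rg rX))) ?Q) (set_reg rX 0 ?s)"
      proof (rule par_search_loop[where w = wx and a = a and b = b' and ?i0.0 = i0])
        fix s2 i assume ag: "agree {rX, rI} {} (set_reg rX 0 ?s) s2" and i: "reg s2 rX = i" "i \<le> wx"
          "mem (set_reg rX 0 ?s) tT a i \<noteq> 0" "mem (set_reg rX 0 ?s) tT b' (wx - i) \<noteq> 0"
        have i': "i \<in> totals (X a)" "wx - i \<in> totals (X b')" using T[OF ws(3), of i] T[OF ws(4), of "wx - i"] i ws(2) s1 by auto
        have r2: "reg s2 rA = a" "reg s2 rB = b'" "reg s2 rW = wx" "mem s2 = mem s1" using ag by (auto simp: agree_def)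
        have wo: "want_of s2 = want_of s1" using r2 by (simp add: want_of_def fun_eq_iff)
        have iM: "i < M" "wx - i < M" using i ws(2) by (auto intro!: less_M)
        have ne: "x \<noteq> a" "x \<noteq> b'" "b' \<noteq> a" using ws by auto
        have "split_ok X s ((want_of s1)(a := i, b' := wx - i)) x"
          using i i' par ne by (simp add: split_ok_def a_def[symmetric] b'_def[symmetric] wx_def[symmetric] split_Par_def)
        from ws(8)[OF this] show "wp (put1 tWANT (Rg rA) (Rg rX) ;; put1 tWANT (Rg rB) (asub (Rg rW) (Rg rX))) ?Q s2"
          using r2 i(1) iM Ms ab2 by (simp add: wo)
      qed (use b ro ws(2) i0 T[OF ws(3)] T[OF ws(4)] s1 in \<open>auto simp: row_ok_def\<close>)
      then show ?thesis using True base s1 M Ms par xs mx ab2 unfolding x(3) by (simp add: split_row_def)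
    next
      case ser: False
      then have XS: "X x = Ser (X a) (X b')" "mem s tTYP x 0 = sum sz (leaves (X b'))" using Xx by simp_all
      have o: "ordered (X y)" if "y \<in> rows cur" for y using tr that by (simp add: trees_ok_def)
      have tot0: "0 \<in> totals (X y)" "sum sz (leaves (X y)) \<in> totals (X y)" if "y \<in> rows cur" for y
        unfolding totals_closed_in[OF o[OF that]] using closed_in_leaves[of "X y"]
        by (auto simp: closed_in_def intro!: image_eqI[of 0 _ "{}"])
      have ne: "x \<noteq> a" "x \<noteq> b'" "b' \<noteq> a" using ws by auto
      let ?d = "mem s tTYP x 0"
      show ?thesis
      proof (cases "wx \<in> totals (X b')")
        case in_b: True
        have "split_ok X s ((want_of s1)(a := 0, b' := wx)) x"
          using in_b ser ne tot0 ws(3) by (simp add: split_ok_def a_def[symmetric] b'_def[symmetric] wx_def[symmetric] split_Ser_def)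
        from ws(8)[OF this] have "wants X cur f t s x ((want_of s1)(b' := wx, a := 0))" using ne by (simp add: fun_upd_twist)
        then show ?thesis using True base s1 M Ms ser xs mx ab2 in_b T[OF ws(4,2)] ws(2) unfolding x(3)
          by (simp add: split_row_def)
      next
        \<comment> \<open>The total then stems from the second branch of \<open>totals\<close>: the
          lower child is exhausted and the difference is attainable above.\<close>
        case not_in_b: False
        then obtain i where i: "i \<in> totals (X a)" "wx = i + ?d" using ws(1) XS by auto
        have "split_Ser (X a) (X b') wx (wx - ?d) ?d"
          using i tot0(2)[OF ws(4)] XS(2) by (simp add: split_Ser_def)
        then have "split_ok X s ((want_of s1)(a := wx - ?d, b' := ?d)) x"
          using ser ne by (simp add: split_ok_def a_def[symmetric] b'_def[symmetric] wx_def[symmetric])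
        from ws(8)[OF this] have "wants X cur f t s x ((want_of s1)(b' := ?d, a := wx - ?d))" using ne by (simp add: fun_upd_twist)
        then show ?thesis using True base s1 M Ms ser xs mx ab2 not_in_b T[OF ws(4,2)] ws(2) unfolding x(3)
          by (simp add: split_row_def)
      qed
    qed
  qed
qed

definition optimal :: "nat set \<Rightarrow> bool" where
  "optimal U \<longleftrightarrow> closed_in relevant U \<and> sum sz U \<le> c \<and> (\<forall>V. closed_in relevant V \<longrightarrow> sum sz V \<le> c \<longrightarrow> sum sz V \<le> sum sz U)"

lemma find_root_correct:
  assumes b: "base s" and f: "forest A Mf X cur s" and A: "card A \<le> 1"
    and Q: "\<And>s'. agree {rRow, rU} {} s s' \<Longrightarrow> (if A = {} then reg s' rRow = n else \<exists>v. A = {v} \<and> reg s' rRow = mem s tTID v 0) \<Longrightarrow> Q s'"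
  shows "wp find_root Q s"
proof -
  have rel: "A \<subseteq> relevant" using f by (simp add: forest_def modules_def)
  note fb = forest_bounds[OF f]
  have alive: "mem s tALIVE v 0 = (if v \<in> A then 1 else 0)" if "v < n" for v using f that by (simp add: forest_def)
  have "wp (Loop rU True (Cond (cell1 tALIVE (Rg rU)) (Set rRow (cell1 tTID (Rg rU))) Nop)) Q (set_reg rRow n s)"
  proof (rule wp_Loop[where I = "\<lambda>k s'. if A \<inter> {..<k} = {} then reg s' rRow = n else \<exists>v. A = {v} \<and> reg s' rRow = mem s tTID v 0"], goal_cases)
    case (2 k s1)
    then have k: "k < n" by simp
    have m: "mem s1 = mem s" using 2(3) by (auto simp: agree_def)
    show ?case
    proof (cases "k \<in> A")
      case True
      then have "A = {k}" using A fb(1) by (metis card_le_Suc0_iff_eq One_nat_def insertE singletonI subsetI subset_antisym empty_subsetI insert_subset)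
      moreover have "mem s tTID k 0 < M"
      proof -
        have "mem s tTID k 0 \<in> rows cur" "A \<noteq> {}" using f True by (auto simp: forest_def)
        then have "mem s tTID k 0 < 2 * n" using fb(4,5) less_trans by blast
        then show ?thesis by simp
      qed
      ultimately show ?thesis using k m alive[OF k] by (auto simp: less_Suc_eq)
    next
      case False
      then have "A \<inter> {..<Suc k} = A \<inter> {..<k}" by (auto simp: less_Suc_eq)
      then show ?thesis using False k m alive[OF k] 2(2) by simp
    qed
  next
    case (3 s1)
    have "A \<inter> {..<n} = A" using rel relevant_less by auto
    then show ?case using 3 by (intro Q) (auto simp: agree_def)
  qed simp
  then show ?thesis using b by (simp add: find_root_def base_def)
qed

lemma find_best_correct:
  assumes b: "base s" and f: "reg s rRow = f" "row_ok f s"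
    and Q: "\<And>s' w. agree {rBest, rI} {tWANT} s s' \<Longrightarrow> want_of s' = (want_of s)(f := w) \<Longrightarrow> w \<le> c \<Longrightarrow>
      (mem s tT f w \<noteq> 0 \<or> w = 0) \<Longrightarrow> (\<forall>i\<le>c. mem s tT f i \<noteq> 0 \<longrightarrow> i \<le> w) \<Longrightarrow> Q s'"
  shows "wp find_best Q s"
proof -
  have "wp (Loop rI False (Cond (Cell tT (Rg rRow) (Rg rI)) (Set rBest (Rg rI)) Nop)) (wp (put1 tWANT (Rg rRow) (Rg rBest)) Q) (set_reg rBest 0 s)"
  proof (rule wp_Loop[where I = "\<lambda>k s'. reg s' rBest \<le> c \<and> (mem s tT f (reg s' rBest) \<noteq> 0 \<or> reg s' rBest = 0) \<and>
      (\<forall>i<k. mem s tT f i \<noteq> 0 \<longrightarrow> i \<le> reg s' rBest)"], goal_cases)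
    case (2 k s1)
    have k: "k \<le> c" using 2(1) by simp
    have m: "mem s1 = mem s" "reg s1 rRow = f" using 2(3) f by (auto simp: agree_def)
    have "mem s tT f k \<le> 1" using f(2) k by (simp add: row_ok_def)
    then have "mem s tT f k < M" "f \<le> 2 * n" using f(2) by (auto simp: row_ok_def intro!: less_M)
    then show ?case using 2(2) k m by (auto simp: less_Suc_eq)
  next
    case (3 s1)
    have m: "mem s1 = mem s" "reg s1 rRow = f" using 3(2) f by (auto simp: agree_def)
    have wo: "want_of s1 = want_of s" using m by (simp add: want_of_def fun_eq_iff)
    have "f \<le> 2 * n" using f(2) by (simp add: row_ok_def)
    moreover have "Q (set_cell tWANT f 0 (reg s1 rBest) (set_reg rI (c + 1) s1))"
      using 3 m by (intro Q[of _ "reg s1 rBest"]) (auto simp: agree_def wo)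
    ultimately show ?case using m 3(1) by simp
  qed simp
  then show ?thesis by (simp add: find_best_def)
qed

lemma write_output_correct:
  assumes b: "base s" and w: "\<forall>v<n. want_of s v \<le> c" "U = {v. v < n \<and> want_of s v \<noteq> 0}"
  shows "wp write_output (\<lambda>s'. {v. v < n \<and> mem s' 0 v 0 \<noteq> 0} = U) s"
  unfolding write_output_def
proof (rule wp_Loop[where I = "\<lambda>k s'. \<forall>v<k. mem s' 0 v 0 = want_of s v"], goal_cases)
  case (2 k s1)
  have m: "mem s1 tWANT = mem s tWANT" using 2(3) by (auto simp: agree_def)
  have "mem s tWANT k 0 \<le> c" using w 2(1) by (simp add: want_of_def)
  then show ?case using 2(1,2) m by (auto simp: less_Suc_eq want_of_def)
next
  case (3 s1)
  then show ?case using w by auto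
qed simp

lemma read_solution_correct:
  assumes b: "base s" and f: "forest A Mf X cur s" and A: "card A \<le> 1" and z: "\<And>x. mem s tWANT x 0 = 0"
  shows "wp read_solution (\<lambda>s'. optimal {v. v < n \<and> mem s' 0 v 0 \<noteq> 0}) s"
proof -
  note fb = forest_bounds[OF f]
  have m: "modules A Mf" and tr: "trees_ok X cur s" using f by (auto simp: forest_def)
  let ?Q = "\<lambda>s'. optimal {v. v < n \<and> mem s' 0 v 0 \<noteq> 0}"
  have "wp find_root (wp find_best (wp (Loop rStep True split_row) (wp write_output ?Q))) s"
  proof (rule find_root_correct[OF b f A])
    fix s1 assume ag1: "agree {rRow, rU} {} s s1"
      and row: "if A = {} then reg s1 rRow = n else \<exists>v. A = {v} \<and> reg s1 rRow = mem s tTID v 0"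
    define f where "f = reg s1 rRow"
    have m1: "mem s1 = mem s" using ag1 by (auto simp: agree_def)
    have b1: "base s1" using agree_base[OF ag1 _ _ b] by simp
    have fr: "f \<in> rows cur \<and> leaves (X f) = relevant" if ne: "A \<noteq> {}"
    proof -
      obtain v where v: "A = {v}" "f = mem s tTID v 0" using row ne f_def by auto
      then have "Mf v = relevant" using modulesD(2)[OF m] by simp
      then show ?thesis using \<open>forest A Mf X cur s\<close> v by (simp add: forest_def)
    qed
    have empty: "A = {} \<Longrightarrow> relevant = {} \<and> cur = n" using modulesD(2)[OF m] \<open>forest A Mf X cur s\<close> by (auto simp: forest_def)
    have T: "(if A = {} then mem s tT f i = 0 else mem s tT f i \<noteq> 0 \<longleftrightarrow> i \<in> totals (X f))" if "i \<le> c" for i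
      using \<open>forest A Mf X cur s\<close> tr that empty row fr f_def by (auto simp: forest_def trees_ok_def)
    have ro: "row_ok f s1"
    proof (cases "A = {}")
      case True
      then show ?thesis using T row m1 f_def by (simp add: row_ok_def)
    next
      case False
      then show ?thesis using fb(6) fr m1 by (simp add: row_ok_def)
    qed
    show "wp find_best (wp (Loop rStep True split_row) (wp write_output ?Q)) s1"
    proof (rule find_best_correct[OF b1 f_def[symmetric] ro])
      fix s2 w assume ag2: "agree {rBest, rI} {tWANT} s1 s2" and w: "want_of s2 = (want_of s1)(f := w)" "w \<le> c"
        "mem s1 tT f w \<noteq> 0 \<or> w = 0" "\<forall>i\<le>c. mem s1 tT f i \<noteq> 0 \<longrightarrow> i \<le> w"
      have want2: "want_of s2 = (\<lambda>x. if x = f then w else 0)" using w(1) z m1 by (auto simp: want_of_def fun_eq_iff)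
      have b2: "base s2" using agree_base[OF ag2 _ _ b1] by simp
      have same: "mem s2 t = mem s t" if "t \<noteq> tWANT" for t using ag2 m1 that by (simp add: agree_def)
      have cur2: "reg s2 rCur = cur" using ag1 ag2 \<open>forest A Mf X cur s\<close> by (simp add: agree_def forest_def)
      show "wp (Loop rStep True split_row) (wp write_output ?Q) s2"
      proof (cases "A = {}")
        case True
        then have e: "relevant = {}" "cur = n" "w = 0" using empty w(3) T[OF w(2)] m1 by auto
        show ?thesis
        proof (rule wp_Loop[where I = "\<lambda>k s'. \<forall>x. want_of s' x = 0"], goal_cases)
          case 1
          then show ?case using want2 e by simp
        next
          case (2 k s3)
          have "base s3" "reg s3 rCur = n" using agree_base[OF 2(3) _ _ b2] 2(3) cur2 e by (auto simp: agree_def)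
          moreover have "n + k < M" using 2(1) by (intro less_M) simp
          ultimately show ?case using 2(1,2) by (simp add: split_row_def base_def)
        next
          case (3 s3)
          have "wp write_output (\<lambda>s'. {v. v < n \<and> mem s' 0 v 0 \<noteq> 0} = {}) (set_reg rStep n s3)"
            using 3 agree_base[OF 3(2) _ _ b2] by (intro write_output_correct) auto
          then have "wp write_output ?Q (set_reg rStep n s3)"
          proof (rule wp_mono)
            fix s' assume "{v. v < n \<and> mem s' 0 v 0 \<noteq> 0} = {}"
            moreover have "optimal {}" using e by (auto simp: optimal_def closed_in_def)
            ultimately show "?Q s'" by (simp only:)
          qed
          then show ?case by simp
        qed
      next
        case False
        then obtain v where v: "A = {v}" "mem s tTID v 0 = f" using row f_def by auto
        note fr = fr[OF False]
        have o: "ordered (X f)" using tr fr by (simp add: trees_ok_def)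
        have tot: "totals (X f) = sum sz ` {U. closed_in relevant U}" using totals_closed_in[OF o] fr by simp
        have wt: "w \<in> totals (X f)"
        proof (cases "w = 0")
          case True
          have "closed_in relevant {}" by (simp add: closed_in_def)
          then show ?thesis unfolding tot True by (intro image_eqI[of _ _ "{}"]) auto
        next
          case nz: False
          then show ?thesis using w(2,3) T[OF w(2)] False m1 by simp
        qed
        have cn: "cur - n \<le> n" using fb(4)[OF False] by simp
        show ?thesis
        proof (rule wp_Loop[where I = "\<lambda>k s'. wants X cur f w s (max n (cur - k)) (want_of s')"], goal_cases)
          case 1
          have "f \<in> relevant \<or> n \<le> f" using fr by (auto simp: rows_def)
          then show ?case using want2 wt w(2) fb(3) by (auto simp: wants_def)
        next
          case (2 k s3)
          let ?s3 = "set_reg rStep k s3"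
          have k: "k < n" using 2(1) by simp
          have mm: "mem ?s3 t = mem s t" if "t \<noteq> tWANT" for t using 2(3) same that by (simp add: agree_def)
          show ?case
            by (rule split_row_correct[OF _ \<open>forest A Mf X cur s\<close> v])
              (use 2(2) 2(3) k cur2 agree_base[OF 2(3) _ _ b2] mm in \<open>auto simp: agree_def\<close>)
        next
          case (3 s3)
          have wf: "wants X cur f w s n (want_of s3)" using 3(1) cn by (simp add: max_def split: if_splits)
          then have wf2: "want_of s3 f = w" by (simp add: wants_def)
          let ?U = "{u. u < n \<and> want_of s3 u \<noteq> 0}"
          note fin = wants_final[OF \<open>forest A Mf X cur s\<close> v wf]
          have opt: "optimal ?U"
            unfolding optimal_def
          proof (intro conjI allI impI)
            show "closed_in relevant ?U" "sum sz ?U \<le> c" using fin wf2 w(2) by simp_all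
            fix V assume V: "closed_in relevant V" "sum sz V \<le> c"
            then have "sum sz V \<in> totals (X f)" unfolding tot by blast
            then show "sum sz V \<le> sum sz ?U" using V w(4) T[OF V(2)] False m1 fin(2) wf2 by simp
          qed
          have "want_of s3 u \<le> c" if "u < n" for u
          proof (cases "u \<in> relevant")
            case True
            then have "u \<in> rows cur" by (simp add: rows_def)
            moreover have "u = f \<or> (\<exists>y\<in>{n..<cur}. u \<in> children s y)"
              using \<open>forest A Mf X cur s\<close> v calculation by (auto simp: forest_def)
            ultimately show ?thesis using wf by (auto simp: wants_def)
          next
            case False
            then show ?thesis using wf that by (simp add: wants_def)
          qed
          then have "wp write_output (\<lambda>s'. {v. v < n \<and> mem s' 0 v 0 \<noteq> 0} = ?U) (set_reg rStep n s3)"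
            using agree_base[OF 3(2) _ _ b2] by (intro write_output_correct) auto
          then have "wp write_output ?Q (set_reg rStep n s3)" by (rule wp_mono) (use opt in \<open>simp only:\<close>)
          then show ?case by simp
        qed
      qed
    qed
  qed
  then show ?thesis by (simp add: read_solution_def)
qed

end

section \<open>Cost, limits and the final bound\<close>

definition ssg_program :: prog where
  "ssg_program = adjacency ;; bfs ;; keys ;; reduce_all ;; read_solution"

definition ssg_com :: com where
  "ssg_com = Seq (Assign 0 (Inp (Const 0))) (Seq (Assign 1 (Bin Plus (Inp (Const 1)) (Const 1))) (compile ssg_program))"

lemma ssg_program_well_formed: "well_formed ssg_program"
  by (simp add: ssg_program_def adjacency_def adjacency_body_def bfs_def bfs_expand_def bfs_visit_def keys_def
      keys_body_def tau_scan_def init_item_def reduce_all_def reduce_def find_twins_def descend_def decide_def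
      scan_listed_def scan_item_def fill_row_def par_row_def par_cell_def ser_row_def link_def
      read_solution_def find_root_def find_best_def split_row_def par_search_def write_output_def)

text \<open>The term in \<open>n * (c * c)\<close> comes from the searches, the descents and the
  tables; the one in \<open>n * n\<close> from the matrix and the top-level scans.\<close>

lemma ssg_program_cost:
  "cost n c ssg_program = 114 + 25 * c + 1313 * n + 838 * (n * c) + 104 * (n * n) + 247 * (n * (c * c))"
  by (simp add: ssg_program_def adjacency_def adjacency_body_def bfs_def bfs_expand_def bfs_visit_def keys_def
      keys_body_def tau_scan_def init_item_def reduce_all_def reduce_def find_twins_def descend_def decide_def
      scan_listed_def scan_item_def fill_row_def par_row_def par_cell_def ser_row_def link_def series_test_def
      read_solution_def find_root_def find_best_def split_row_def par_search_def write_output_def algebra_simps)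

lemma ssg_program_cost_le:
  assumes "0 < n" "0 < c"
  shows "11 + cost n c ssg_program \<le> 3000 * (n * c\<^sup>2 + n\<^sup>2)"
proof -
  have c1: "1 \<le> c * c" "c \<le> c * c" and n1: "n \<le> n * n" using assms by simp_all
  have "n * 1 \<le> n * (c * c)" "n * c \<le> n * (c * c)" "1 * (c * c) \<le> n * (c * c)"
    using c1 assms by (intro mult_le_mono; simp)+
  \<comment> \<open>Products are replaced by variables so that the comparison is linear; 125 is 114
    + 11.\<close>
  moreover have "125 + 25 * c + 1313 * n + 838 * x + 104 * y + 247 * z \<le> 3000 * z + 3000 * y"
    if "1 \<le> w" "c \<le> w" "n \<le> y" "n \<le> z" "x \<le> z" "w \<le> z" for w x y z :: nat
    using that by linarith
  from this[of "c * c" "n * n" "n * (c * c)" "n * c"] calculation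
  show ?thesis using c1 n1 unfolding ssg_program_cost power2_eq_square distrib_left by simp
qed

context ssg_machine
begin

lemma ssg_program_correct:
  assumes b: "base s" and z: "\<And>t i j. mem s t i j = 0"
  shows "wp ssg_program (\<lambda>s'. optimal {v. v < n \<and> mem s' 0 v 0 \<noteq> 0}) s"
proof -
  let ?Q = "\<lambda>s'. optimal {v. v < n \<and> mem s' 0 v 0 \<noteq> 0}"
  have "wp adjacency (wp bfs (wp keys (wp reduce_all (wp read_solution ?Q)))) s"
  proof (rule wp_mono[OF adjacency_correct[OF b]])
    fix s1 assume a1: "adj_ok n s1" and "agree (mods adjacency) (amods adjacency) s s1"
    then have ag1: "agree {rU, rD, rV} {tADJ, tDEG} s s1" by (simp add: adjacency_def adjacency_body_def insert_commute)
    have b1: "base s1" using agree_base[OF ag1 _ _ b] by simp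
    have "wp bfs (lists_ok n) s1" by (rule bfs_correct[OF b1 a1]) (use ag1 z in \<open>auto simp: agree_def\<close>)
    then show "wp bfs (wp keys (wp reduce_all (wp read_solution ?Q))) s1"
    proof (rule wp_mono)
      fix s2 assume l2: "lists_ok n s2" and "agree (mods bfs) (amods bfs) s1 s2"
      then have ag2: "agree {rV, rD, rS, rI, rU, rK, rW} {tMARK, tL, tLEN, tWT} s1 s2"
        by (auto simp: bfs_def agree_def)
      have b2: "base s2" using agree_base[OF ag2 _ _ b1] by simp
      have "wp keys (forest relevant (\<lambda>v. {v}) Leaf n) s2"
        by (rule keys_correct[OF b2 l2]) (use ag1 ag2 z in \<open>auto simp: agree_def\<close>)
      then show "wp keys (wp reduce_all (wp read_solution ?Q)) s2"
      proof (rule wp_mono)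
        fix s3 assume f3: "forest relevant (\<lambda>v. {v}) Leaf n s3" and "agree (mods keys) (amods keys) s2 s3"
        then have ag3: "agree {rV, rU, rX, rT, rK, rM, rCur} {tTAU, tALIVE, tTID, tMS, tT} s2 s3"
          by (auto simp: keys_def agree_def)
        have b3: "base s3" using agree_base[OF ag3 _ _ b2] by simp
        have l3: "lists_ok n s3" using lists_ok_agree[OF ag3] l2 by simp
        show "wp reduce_all (wp read_solution ?Q) s3"
        proof (rule wp_mono[OF reduce_all_correct[OF b3 f3 l3]], elim exE conjE)
          fix s4 A Mf X cur assume f4: "forest A Mf X cur s4" "card A \<le> 1" and "agree (mods reduce_all) (amods reduce_all) s3 s4"
          then have ag4: "agree {rStep, rU, rX, rT, rQ, rG, rY, rK, rF, rP, rLev, rA, rB, rSB, rI, rCur, rM} {tT, tC1, tC2, tTYP, tTID, tMS, tALIVE} s3 s4"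
            by (auto simp: reduce_all_def agree_def)
          have b4: "base s4" using agree_base[OF ag4 _ _ b3] by simp
          show "wp read_solution ?Q s4"
            by (rule read_solution_correct[OF b4 f4]) (use ag1 ag2 ag3 ag4 z in \<open>auto simp: agree_def\<close>)
        qed
      qed
    qed
  qed
  then show ?thesis by (simp add: ssg_program_def)
qed

text \<open>Links arcs, in which feasibility is stated, with reachability, in which the order theory
  is.\<close>

lemma closed_in_trancl: "closed_in {..<n} U \<longleftrightarrow> U \<subseteq> {..<n} \<and> (\<forall>x\<in>U. \<forall>y. (x, y) \<in> E \<longrightarrow> y \<in> U)"
proof
  assume "closed_in {..<n} U"
  then show "U \<subseteq> {..<n} \<and> (\<forall>x\<in>U. \<forall>y. (x, y) \<in> E \<longrightarrow> y \<in> U)"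
    using E_less unfolding closed_in_def by (meson lessThan_iff r_into_trancl')
next
  assume U: "U \<subseteq> {..<n} \<and> (\<forall>x\<in>U. \<forall>y. (x, y) \<in> E \<longrightarrow> y \<in> U)"
  have "y \<in> U" if "(x, y) \<in> E\<^sup>+" "x \<in> U" for x y
    using that by (induction rule: trancl_induct) (use U in auto)
  then show "closed_in {..<n} U" using U by (auto simp: closed_in_def)
qed

text \<open>The 11 covers the prelude that loads \<open>n\<close> and \<open>c + 1\<close> into
  registers 0 and 1.\<close>

lemma ssg_com_correct:
  assumes S: "n + 16 * (2 * n * (c + 1) + c) + 16 \<le> S" and SW: "S \<le> W" and MW: "M \<le> W"
    and i0: "inp ! 0 = n" "inp ! 1 = c"
  shows "\<exists>t \<sigma>. exec W S inp ssg_com init_state t \<sigma> \<and> optimal {v. v < n \<and> snd \<sigma> v \<noteq> 0} \<and> t \<le> 11 + cost n c ssg_program"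
proof -
  let ?\<rho> = "(\<lambda>_. 0)(0 := n, 1 := c + 1) :: nat \<Rightarrow> nat"
  define s where "s = State ?\<rho> (\<lambda>_ _ _. 0)"
  have M': "n < M" "c + 1 < M" "16 < M" "1 < M" "c < M" "0 < M" using M_bound by auto
  have W': "n < W" "c < W" "Suc c < W" "0 < W" "Suc 0 < W" using less_le_trans[OF M'(1) MW]
    less_le_trans[OF M'(5) MW] less_le_trans[OF M'(2) MW] by simp_all
  have len: "1 < length inp" "0 < length inp" using inp_length by auto
  have 1: "exec W S inp (Assign 0 (Inp (Const 0))) init_state 3 ((\<lambda>_. 0)(0 := n), \<lambda>_. 0)"
    using Assign[of W S inp "\<lambda>_. 0" "\<lambda>_. 0" "Inp (Const 0)" 0] len i0 W'
    by (simp add: init_state_def numeral_eq_Suc)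
  have 2: "exec W S inp (Assign 1 (Bin Plus (Inp (Const 1)) (Const 1))) ((\<lambda>_. 0)(0 := n), \<lambda>_. 0) 5 (?\<rho>, \<lambda>_. 0)"
    using Assign[of W S inp "(\<lambda>_. 0)(0 := n)" "\<lambda>_. 0" "Bin Plus (Inp (Const 1)) (Const 1)" 1] len i0 W'
    by (simp add: numeral_eq_Suc)
  have b: "base s" by (simp add: base_def s_def)
  obtain s' where s': "run ssg_program s = Some s'" "optimal {v. v < n \<and> mem s' 0 v 0 \<noteq> 0}"
    using ssg_program_correct[OF b] by (auto simp: wp_def s_def)
  have "simulates (?\<rho>, \<lambda>_. 0) s" by (simp add: simulates_def s_def)
  from compile_correct[OF S SW MW M'(1-3) ssg_program_well_formed this s'(1)]
  obtain t \<sigma> where 3: "exec W S inp (compile ssg_program) (?\<rho>, \<lambda>_. 0) t \<sigma>" "simulates \<sigma> s'" "t \<le> cost n c ssg_program"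
    by blast
  have "{v. v < n \<and> snd \<sigma> v \<noteq> 0} = {v. v < n \<and> mem s' 0 v 0 \<noteq> 0}" using 3(2) by (auto simp: simulates_def)
  then show ?thesis using Seq[OF 1 Seq[OF 2 3(1)]] 3(3) s'(2) unfolding ssg_com_def
    by (intro exI[of _ "1 + 3 + (1 + 5 + t)"] exI[of _ \<sigma>]) auto
qed

end

lemma nth_concat_rows:
  "u < m \<Longrightarrow> v < n \<Longrightarrow> concat (map (\<lambda>u. map (f u) [0..<n]) [0..<m]) ! (u * n + v) = f u v"
proof (induction m)
  case (Suc m)
  have len: "length (concat (map (\<lambda>u. map (f u) [0..<n]) [0..<m])) = m * n"
    by (simp add: length_concat comp_def sum_list_triv)
  show ?case
  proof (cases "u < m")
    case True
    then have "Suc u * n \<le> m * n" by (intro mult_le_mono1) simp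
    then have "u * n + v < m * n" using Suc.prems by simp
    then show ?thesis using Suc True len by (simp add: nth_append)
  next
    case False
    then have "u = m" using Suc.prems by simp
    then show ?thesis using Suc.prems len by (simp add: nth_append)
  qed
qed simp

lemma nth_ssg_input:
  shows "length (ssg_input n sz c G) = 2 + n + n * n" "ssg_input n sz c G ! 0 = n" "ssg_input n sz c G ! 1 = c"
    "v < n \<Longrightarrow> ssg_input n sz c G ! (2 + v) = sz v"
    "u < n \<Longrightarrow> v < n \<Longrightarrow> ssg_input n sz c G ! (2 + n + (u * n + v)) = (if (u, v) \<in> parcs G then 1 else 0)"
proof -
  let ?M = "concat (map (\<lambda>u. map (\<lambda>v. if (u, v) \<in> parcs G then 1 else (0::nat)) [0..<n]) [0..<n])"
  show "length (ssg_input n sz c G) = 2 + n + n * n"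
    by (simp add: ssg_input_def length_concat comp_def sum_list_triv)
  show "ssg_input n sz c G ! 0 = n" "ssg_input n sz c G ! 1 = c" by (simp_all add: ssg_input_def)
  show "v < n \<Longrightarrow> ssg_input n sz c G ! (2 + v) = sz v" by (simp add: ssg_input_def nth_append)
  show "u < n \<Longrightarrow> v < n \<Longrightarrow> ssg_input n sz c G ! (2 + n + (u * n + v)) = (if (u, v) \<in> parcs G then 1 else 0)"
    using nth_concat_rows[of u n v n "\<lambda>u v. if (u, v) \<in> parcs G then 1 else 0"] by (simp add: ssg_input_def nth_append)
qed

text \<open>The base is at least 3 and 3^10 exceeds 3000, so of the exponent 12 ten factors absorb
  the constant and two remain for a quadratic term.\<close>

lemma word_limit_bounds:
  assumes "0 < n" "0 < c" "0 < sum sz {..<n}"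
  shows "3000 * (n * c) \<le> word_limit 12 n sz c"
    and "100 * (n + c + sum sz {..<n} + 1) + n * n + n * c < word_limit 12 n sz c"
proof -
  define B where "B = n + c + sum sz {..<n}"
  have B: "3 \<le> B" "n \<le> B" "c \<le> B" using assms by (simp_all add: B_def)
  have "(3::nat) ^ 10 \<le> B ^ 10" using B(1) by (rule power_mono) simp
  then have "3000 * (B * B) \<le> B ^ 10 * (B * B)" by (intro mult_le_mono1) simp
  also have "\<dots> = word_limit 12 n sz c" by (simp add: word_limit_def B_def flip: power_add power2_eq_square)
  finally have le: "3000 * (B * B) \<le> word_limit 12 n sz c" .
  have sq: "n * c \<le> B * B" "n * n \<le> B * B" "B \<le> B * B" using mult_le_mono[OF B(2,3)] mult_le_mono[OF B(2,2)] B(1) by simp_all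
  show "3000 * (n * c) \<le> word_limit 12 n sz c" using le sq(1) by linarith
  have "1 \<le> B" using B(1) by simp
  then show "100 * (n + c + sum sz {..<n} + 1) + n * n + n * c < word_limit 12 n sz c"
  proof -
    have "100 * B + 100 + x + y < z" if "1 \<le> B" "B \<le> w" "x \<le> w" "y \<le> w" "3000 * w \<le> z" for w x y z
      using that by linarith
    then show ?thesis using le sq \<open>1 \<le> B\<close> unfolding B_def[symmetric] distrib_left mult_1_right by blast
  qed
qed

theorem theorem6:
  shows "\<exists>(p :: com) (K :: nat) (k :: nat).
    \<forall>(n :: nat) (sz :: nat \<Rightarrow> nat) (c :: nat) (G :: nat pair_pre_digraph).
      ssg_instance n sz c G \<and> series_parallel G \<longrightarrow>
      (\<exists>t \<sigma>. exec (word_limit k n sz c) (K * (n * c)) (ssg_input n sz c G) p init_state t \<sigma> \<and>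
         ssg_solution sz c G (ssg_output n \<sigma>) \<and>
         real t \<le> real K * (real n * (real c)\<^sup>2 + real n powr 2.3729))"
proof (rule exI[of _ ssg_com], rule exI[of _ 3000], rule exI[of _ 12], intro allI impI, elim conjE)
  fix n c :: nat and sz :: "nat \<Rightarrow> nat" and G :: "nat pair_pre_digraph"
  assume inst: "ssg_instance n sz c G" and sp: "series_parallel G"
  have G: "pair_digraph G" "pverts G = {..<n}" "\<And>j. j < n \<Longrightarrow> 0 < sz j" "0 < c"
    using inst by (auto simp: ssg_instance_def)
  note order = series_parallel_order[OF sp]
  \<comment> \<open>A series-parallel digraph has a vertex, so the degenerate case
    \<open>n = 0\<close> does not arise.\<close>
  have n: "0 < n" using order(1) G(2) by (cases n) auto
  have tot: "0 < sum sz {..<n}" using G(3) n by (intro sum_pos) auto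
  interpret pair_digraph G by (rule G(1))
  have arcs: "parcs G \<subseteq> {..<n} \<times> {..<n}" using in_arcsD1 in_arcsD2 G(2) by fastforce
  let ?W = "word_limit 12 n sz c" and ?S = "3000 * (n * c)"
  note W = word_limit_bounds[OF n G(4) tot]
  interpret ssg_machine n sz c "parcs G" ?W "ssg_input n sz c G"
  proof
    show "(parcs G)\<^sup>+ \<subseteq> {..<n} \<times> {..<n}" by (rule trancl_on[OF arcs])
  qed (use order G n W nth_ssg_input[where n = n and sz = sz and c = c and G = G] in auto)
  have nc: "n \<le> n * c" "c \<le> n * c" "1 \<le> n * c" using n G(4) by simp_all
  \<comment> \<open>Sixteen arrays of \<open>2 * n + 1\<close> rows and \<open>c + 1\<close> columns
    behind \<open>n\<close> output cells; since \<open>n\<close> and \<open>c\<close> are positive,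
    this is at most 97 times \<open>n * c\<close>.\<close>
  have "n + 16 * (2 * n * (c + 1) + c) + 16 = 32 * (n * c) + 33 * n + 16 * c + 16" by (simp add: algebra_simps)
  also have "\<dots> \<le> ?S" using nc by linarith
  finally have space: "n + 16 * (2 * n * (c + 1) + c) + 16 \<le> ?S" .
  obtain t \<sigma> where ex: "exec ?W ?S (ssg_input n sz c G) ssg_com init_state t \<sigma>"
    and opt: "optimal (ssg_output n \<sigma>)" and t: "t \<le> 11 + cost n c ssg_program"
    using ssg_com_correct[OF space W(1) order_refl nth_ssg_input(2,3)] unfolding ssg_output_def by blast
  have feas: "ssg_feasible sz c G U \<longleftrightarrow> closed_in relevant U \<and> sum sz U \<le> c" for U
  proof -
    have "ssg_feasible sz c G U \<longleftrightarrow> closed_in {..<n} U \<and> sum sz U \<le> c"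
      unfolding ssg_feasible_def closed_in_trancl G(2) in_nbrs_def using arcs by blast
    then show ?thesis using closed_iff_relevant by blast
  qed
  have "ssg_solution sz c G (ssg_output n \<sigma>)"
    using opt unfolding ssg_solution_def is_arg_max_def feas optimal_def by (auto simp: not_less)
  moreover have "real t \<le> real 3000 * (real n * (real c)\<^sup>2 + real n powr 2.3729)"
  proof -
    have "real t \<le> real (3000 * (n * c\<^sup>2 + n\<^sup>2))"
      using t ssg_program_cost_le[OF n G(4)] by (simp only: of_nat_le_iff)
    \<comment> \<open>The exponent only has to be at least 2.\<close>
    moreover have "real (n\<^sup>2) \<le> real n powr 2.3729"
      using powr_mono[of 2 "2.3729" "real n"] n by (simp add: powr_numeral)
    ultimately show ?thesis by (simp add: algebra_simps)
  qed
  ultimately show "\<exists>t \<sigma>. exec ?W ?S (ssg_input n sz c G) ssg_com init_state t \<sigma> \<and>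
      ssg_solution sz c G (ssg_output n \<sigma>) \<and> real t \<le> real 3000 * (real n * (real c)\<^sup>2 + real n powr 2.3729)"
    using ex by blast
qed

end
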